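(* Let $n\ge 2$ and $\mathbb{T}^n=(\mathbb{R}/2\pi\mathbb{Z})^n$. There exist smooth functions $u_1,u_2:\mathbb{T}\to\mathbb{R}$ and a smooth diagonal Riemannian metric $g$ on $\mathbb{T}^n$ such that the Tonelli Lagrangian \[ L(x,\dot x)=\langle \dot x,\dot x\rangle_g+u_1(x_n)+u_2(x_n)\sum_{i=1}^{n-1}(1-\cos x_i),\qquad (x,\dot x)\in \mathbb{T}^n\times\mathbb{R}^n, \] has the following properties: (i) its $\alpha$ function has a flat $\mathbb{F}$ of full dimension $n$ at its lowest level $\min\alpha$; (ii) there are $2^{n-1}$ points $c_1,\dots,c_{2^{n-1}}\in\partial\mathbb{F}$ such that, for each $c_i$, the Mather set $\widetilde{\mathcal{M}}(c_i)$ supports, in addition to the minimizing measure supported on the minimal fixed point, $n-1$ further ergodic $c_i$-minimizing measures; (iii) these $n-1$ further measures have non-zero rotation vectors, pairwise different from each other.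
   Context: A Tonelli Lagrangian $L\in C^r(T\mathbb{T}^n,\mathbb{R})$, $r\ge2$, is one that is fiberwise strictly convex (positive definite Hessian in $v$), superlinear in $v$ uniformly in $x$, and has complete Euler–Lagrange flow $\Phi^t$. For $c\in H^1(\mathbb{T}^n,\mathbb{R})\cong\mathbb{R}^n$ let $\eta_c$ be a closed 1-form with cohomology class $c$ (e.g. $\eta_c(x,v)=\langle c,v\rangle$). Let $\mathcal{M}_{inv}$ be the set of $\Phi^t$-invariant Borel probability measures on $T\mathbb{T}^n$. Mather's $\alpha$ function is $\alpha(c)=-\min_{\mu\in\mathcal{M}_{inv}}\int (L-\eta_c)\,d\mu$; measures attaining the minimum are called $c$-minimizing measures, and the union of their supports is the Mather set $\widetilde{\mathcal{M}}(c)$. The rotation vector $\rho(\mu)\in H_1(\mathbb{T}^n,\mathbb{R})\cong\mathbb{R}^n$ of $\mu$ is defined by $\langle \rho(\mu),c\rangle=\int\eta_c\,d\mu$ for all $c$. A flat $\mathbb{F}$ of the convex function $\alpha$ is a maximal connected set (of positive dimension) on which $\alpha$ is affine (not strictly convex); here the relevant flat is one on which $\alpha$ is constant equal to its minimum value. "Full dimension" means $\mathbb{F}$ has nonempty interior in $H^1(\mathbb{T}^n,\mathbb{R})$. *)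

theory Defs
  imports "HOL-Analysis.Analysis" "HOL-Probability.Probability"
begin

definition smooth1 :: "(real \<Rightarrow> real) \<Rightarrow> bool" where
  "smooth1 u \<longleftrightarrow> (\<forall>k x. ((deriv ^^ k) u) differentiable (at x))"

definition periodic1 :: "(real \<Rightarrow> real) \<Rightarrow> bool" where
  "periodic1 u \<longleftrightarrow> (\<forall>x. u (x + 2 * pi) = u x)"

definition partial :: "'n \<Rightarrow> (real^'n::finite \<Rightarrow> real) \<Rightarrow> real^'n \<Rightarrow> real" where
  "partial i f x = deriv (\<lambda>t. f (x + t *\<^sub>R axis i 1)) 0"

definition smoothn :: "(real^'n::finite \<Rightarrow> real) \<Rightarrow> bool" where
  "smoothn f \<longleftrightarrow> (\<forall>is :: 'n list.
      continuous_on UNIV (fold partial is f) \<and>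
      (\<forall>i x. (\<lambda>t. fold partial is f (x + t *\<^sub>R axis i 1)) differentiable (at 0)))"

definition periodicn :: "(real^'n::finite \<Rightarrow> real) \<Rightarrow> bool" where
  "periodicn f \<longleftrightarrow> (\<forall>x i. f (x + (2 * pi) *\<^sub>R axis i 1) = f x)"

definition diag_metric :: "('n \<Rightarrow> real^'n::finite \<Rightarrow> real) \<Rightarrow> bool" where
  "diag_metric g \<longleftrightarrow> (\<forall>i. smoothn (g i) \<and> periodicn (g i) \<and> (\<forall>x. g i x > 0))"

definition last_idx :: "'n::{finite,linorder}" where
  "last_idx = Max UNIV"

definition mech_lag ::
  "('n::{finite,linorder} \<Rightarrow> (real, 'n::{finite,linorder}) vec \<Rightarrow> real) \<Rightarrow> (real \<Rightarrow> real) \<Rightarrow> (real \<Rightarrow> real)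
     \<Rightarrow> (real, 'n::{finite,linorder}) vec \<Rightarrow> (real, 'n::{finite,linorder}) vec \<Rightarrow> real" where
  "mech_lag g u1 u2 x v =
     (\<Sum>i\<in>UNIV. g i x * (v $ i)\<^sup>2) + u1 (x $ last_idx)
     + u2 (x $ last_idx) * (\<Sum>i\<in>UNIV - {last_idx}. 1 - cos (x $ i))"

definition vgrad :: "(real^'n::finite \<Rightarrow> real^'n \<Rightarrow> real) \<Rightarrow> real^'n \<Rightarrow> real^'n \<Rightarrow> real^'n" where
  "vgrad L x v = (THE w. ((L x) has_derivative (\<lambda>h. w \<bullet> h)) (at v))"

definition xgrad :: "(real^'n::finite \<Rightarrow> real^'n \<Rightarrow> real) \<Rightarrow> real^'n \<Rightarrow> real^'n \<Rightarrow> real^'n" where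
  "xgrad L x v = (THE w. ((\<lambda>y. L y v) has_derivative (\<lambda>h. w \<bullet> h)) (at x))"

definition EL_solution :: "(real^'n::finite \<Rightarrow> real^'n \<Rightarrow> real) \<Rightarrow> (real \<Rightarrow> real^'n) \<Rightarrow> bool" where
  "EL_solution L \<gamma> \<longleftrightarrow> (\<exists>\<gamma>'.
      (\<forall>t. (\<gamma> has_vector_derivative \<gamma>' t) (at t)) \<and>
      (\<forall>t. ((\<lambda>s. vgrad L (\<gamma> s) (\<gamma>' s)) has_vector_derivative xgrad L (\<gamma> t) (\<gamma>' t)) (at t)))"

text \<open>Lifted Euler--Lagrange flow on the universal cover R^n x R^n.\<close>
definition EL_flow :: "(real^'n::finite \<Rightarrow> real^'n \<Rightarrow> real) \<Rightarrow> real \<Rightarrow> (real^'n) \<times> (real^'n) \<Rightarrow> (real^'n) \<times> (real^'n)" where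
  "EL_flow L t z = (THE z'. \<exists>\<gamma>. EL_solution L \<gamma> \<and> \<gamma> 0 = fst z \<and>
       vector_derivative \<gamma> (at 0) = snd z \<and> z' = (\<gamma> t, vector_derivative \<gamma> (at t)))"

definition tproj :: "real^'n::finite \<Rightarrow> real^'n" where
  "tproj x = (\<chi> i. x $ i - 2 * pi * of_int \<lfloor>x $ i / (2 * pi)\<rfloor>)"

definition fund_dom :: "((real^'n::finite) \<times> (real^'n)) set" where
  "fund_dom = {z. \<forall>i. 0 \<le> fst z $ i \<and> fst z $ i < 2 * pi}"

text \<open>The Euler--Lagrange flow on T T^n = [0,2pi)^n x R^n.\<close>
definition tflow :: "(real^'n::finite \<Rightarrow> real^'n \<Rightarrow> real) \<Rightarrow> real \<Rightarrow> (real^'n) \<times> (real^'n) \<Rightarrow> (real^'n) \<times> (real^'n)" where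
  "tflow L t z = (tproj (fst (EL_flow L t z)), snd (EL_flow L t z))"

definition invariant_prob :: "(real^'n::finite \<Rightarrow> real^'n \<Rightarrow> real) \<Rightarrow> ((real^'n) \<times> (real^'n)) measure \<Rightarrow> bool" where
  "invariant_prob L \<mu> \<longleftrightarrow> sets \<mu> = sets borel \<and> prob_space \<mu> \<and> emeasure \<mu> fund_dom = 1 \<and>
     (\<forall>t. tflow L t \<in> borel_measurable borel \<and> distr \<mu> \<mu> (tflow L t) = \<mu>)"

text \<open>Invariant probability measures with finite action (only those can be minimizing).\<close>
definition admissible :: "(real^'n::finite \<Rightarrow> real^'n \<Rightarrow> real) \<Rightarrow> ((real^'n) \<times> (real^'n)) measure \<Rightarrow> bool" where
  "admissible L \<mu> \<longleftrightarrow> invariant_prob L \<mu> \<and> integrable \<mu> (\<lambda>z. L (fst z) (snd z))"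

definition action :: "(real^'n::finite \<Rightarrow> real^'n \<Rightarrow> real) \<Rightarrow> real^'n \<Rightarrow> ((real^'n) \<times> (real^'n)) measure \<Rightarrow> real" where
  "action L c \<mu> = (\<integral>z. L (fst z) (snd z) - c \<bullet> snd z \<partial>\<mu>)"

definition alpha :: "(real^'n::finite \<Rightarrow> real^'n \<Rightarrow> real) \<Rightarrow> real^'n \<Rightarrow> real" where
  "alpha L c = - (INF \<mu> \<in> {\<mu>. admissible L \<mu>}. action L c \<mu>)"

definition c_minimizing :: "(real^'n::finite \<Rightarrow> real^'n \<Rightarrow> real) \<Rightarrow> real^'n \<Rightarrow> ((real^'n) \<times> (real^'n)) measure \<Rightarrow> bool" where
  "c_minimizing L c \<mu> \<longleftrightarrow> admissible L \<mu> \<and> action L c \<mu> = - alpha L c"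

definition ergodic :: "(real^'n::finite \<Rightarrow> real^'n \<Rightarrow> real) \<Rightarrow> ((real^'n) \<times> (real^'n)) measure \<Rightarrow> bool" where
  "ergodic L \<mu> \<longleftrightarrow> invariant_prob L \<mu> \<and>
     (\<forall>A \<in> sets borel. (\<forall>t. {z \<in> fund_dom. tflow L t z \<in> A} = A \<inter> fund_dom) \<longrightarrow>
        measure \<mu> A = 0 \<or> measure \<mu> A = 1)"

definition rotation_vector :: "((real^'n::finite) \<times> (real^'n)) measure \<Rightarrow> real^'n" where
  "rotation_vector \<mu> = (THE \<rho>. \<forall>c. \<rho> \<bullet> c = (\<integral>z. c \<bullet> snd z \<partial>\<mu>))"

definition affine_on :: "(real^'n::finite \<Rightarrow> real) \<Rightarrow> (real^'n) set \<Rightarrow> bool" where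
  "affine_on f S \<longleftrightarrow> (\<exists>a b. \<forall>c\<in>S. f c = a \<bullet> c + b)"

definition is_flat :: "(real^'n::finite \<Rightarrow> real) \<Rightarrow> (real^'n) set \<Rightarrow> bool" where
  "is_flat f F \<longleftrightarrow> connected F \<and> aff_dim F > 0 \<and> affine_on f F \<and>
     (\<forall>G. connected G \<and> F \<subseteq> G \<and> affine_on f G \<longrightarrow> G = F)"

end

theory Submission
  imports Defs
begin

text \<open>Take the flat metric \<open>g = 1/2\<close>, so that \<open>L = \<bar>v\<bar>\<^sup>2 / 2 + U\<close> with \<open>U \<ge> 0\<close> vanishing at the fixed point \<open>0\<close>.
  If \<open>\<bar>c + df\<bar>\<^sup>2 / 2 \<le> U\<close> for a periodic function \<open>f\<close>, then completing the square gives
  \<open>L - c \<bullet> v - df(v) \<ge> 0\<close>; as \<open>df\<close> integrates to zero against invariant measures, \<open>\<alpha>(c) = 0 = min \<alpha>\<close>, and closed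
  curves with \<open>v = c + df\<close> along which the inequality is an equality carry \<open>c\<close>-minimizing measures.

  Write \<open>y\<close> for the last coordinate and fix \<open>n\<close> distinct nodes \<open>a 0 = 0, a 1, \<dots>, a (n - 1)\<close> with a partition of unity
  \<open>\<theta> j\<close> such that \<open>\<theta> j (a k) = \<delta>\<^sub>j\<^sub>k\<close>. On the slice \<open>y = a j\<close> with \<open>j > 0\<close> the potential is a sum of identical pendulum
  potentials \<open>(A j + B j (1 - cos x)) / 2\<close>, tuned so that the zero-energy momentum \<open>p j\<close> has mean 1 for all \<open>j\<close>, whereas the
  period \<open>T j\<close> depends on \<open>j\<close>. For a sign vector \<open>\<sigma>\<close> the class \<open>c = (\<sigma>, 0)\<close> is then calibrated by
  \<open>f = \<Sum>i. \<sigma> i (\<Sum>j. \<theta> j y w j (x i))\<close> with \<open>w j' = p j - 1\<close>: off the slices Jensen's inequality controls the derivatives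
  in the \<open>x i\<close>, and a multiple of \<open>\<Sum>j. (\<theta> j')\<^sup>2\<close> added to \<open>U\<close> controls the derivative in \<open>y\<close>. The diagonal orbit in
  slice \<open>j\<close> has rotation vector \<open>(2 \<pi> / T j) c\<close>, and these are distinct and pair positively with \<open>c\<close>, so that \<open>c\<close> lies on
  the boundary of the flat.\<close>

section \<open>Globally Lipschitz differential equations\<close>

text \<open>Gronwall in differential form: the squared distance, damped by
  \<open>exp (- (2 * K) * s)\<close>, has nonpositive derivative by Cauchy--Schwarz. The square is
  differentiable also where the distance vanishes.\<close>

lemma lipschitz_ode_dist_pos:
  fixes X Y :: "real \<Rightarrow> 'a::real_inner"
  assumes lip: "\<And>x y. norm (F x - F y) \<le> K * norm (x - y)"
    and X: "\<And>t. (X has_vector_derivative F (X t)) (at t)"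
    and Y: "\<And>t. (Y has_vector_derivative F (Y t)) (at t)"
    and t: "0 \<le> t"
  shows "norm (X t - Y t) \<le> exp (K * t) * norm (X 0 - Y 0)"
proof -
  define h where "h s = exp (- (2 * K) * s) * ((X s - Y s) \<bullet> (X s - Y s))" for s
  have D: "(h has_real_derivative
      exp (- (2 * K) * s) * (2 * ((X s - Y s) \<bullet> (F (X s) - F (Y s))) - 2 * K * ((X s - Y s) \<bullet> (X s - Y s)))) (at s)" for s
  proof -
    have XY: "((\<lambda>s. X s - Y s) has_vector_derivative F (X s) - F (Y s)) (at s)"
      by (intro has_vector_derivative_diff X Y)
    have inner: "((\<lambda>s. (X s - Y s) \<bullet> (X s - Y s)) has_real_derivative 2 * ((X s - Y s) \<bullet> (F (X s) - F (Y s)))) (at s)"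
      using has_derivative_inner[OF XY[unfolded has_vector_derivative_def] XY[unfolded has_vector_derivative_def]]
      unfolding has_field_derivative_def
      by (rule has_derivative_eq_rhs) (simp add: fun_eq_iff inner_commute[of _ "X s - Y s"] mult.commute)
    have "((\<lambda>s. exp (- (2 * K) * s)) has_real_derivative exp (- (2 * K) * s) * - (2 * K)) (at s)"
      by (auto intro!: derivative_eq_intros)
    from DERIV_mult[OF this inner] show ?thesis
      unfolding h_def by (rule DERIV_cong) (simp add: right_diff_distrib mult_ac)
  qed
  have "h t \<le> h 0"
  proof (rule DERIV_nonpos_imp_nonincreasing[OF t])
    fix s
    have "(X s - Y s) \<bullet> (F (X s) - F (Y s)) \<le> norm (X s - Y s) * norm (F (X s) - F (Y s))"
      by (rule norm_cauchy_schwarz)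
    also have "\<dots> \<le> norm (X s - Y s) * (K * norm (X s - Y s))"
      by (intro mult_left_mono lip) auto
    also have "\<dots> = K * ((X s - Y s) \<bullet> (X s - Y s))"
      by (simp add: dot_square_norm power2_eq_square)
    finally have "2 * ((X s - Y s) \<bullet> (F (X s) - F (Y s))) - 2 * K * ((X s - Y s) \<bullet> (X s - Y s)) \<le> 0"
      by simp
    then show "\<exists>y. (h has_real_derivative y) (at s) \<and> y \<le> 0"
      using D[of s] mult_nonneg_nonpos[OF exp_ge_zero] by blast
  qed
  then have "(norm (X t - Y t))\<^sup>2 \<le> exp (2 * K * t) * (norm (X 0 - Y 0))\<^sup>2"
    using mult_left_mono[of "h t" "h 0" "exp (2 * K * t)"]
    by (simp add: h_def dot_square_norm mult.assoc[symmetric] flip: exp_add)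
  also have "\<dots> = (exp (K * t) * norm (X 0 - Y 0))\<^sup>2"
    using exp_double[of "K * t"] by (simp add: power_mult_distrib mult.assoc)
  finally show ?thesis
    by (rule power2_le_imp_le) simp
qed

lemma has_vector_derivative_reflect:
  assumes "(X has_vector_derivative D) (at (- t))"
  shows "((\<lambda>s. X (- s)) has_vector_derivative - D) (at t)"
proof -
  have "(uminus has_vector_derivative - 1) (at t)"
    by (rule has_vector_derivative_minus[OF has_vector_derivative_id])
  from vector_diff_chain_at[OF this assms] show ?thesis
    by (simp add: o_def)
qed

text \<open>Negative times reduce to positive ones, because reflected curves solve the equation of
  \<open>- F\<close>, which has the same Lipschitz constant. Equal initial values give uniqueness;
  in general the time \<open>t\<close> map comes out Lipschitz, hence Borel.\<close>

lemma lipschitz_ode_dist: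
  fixes X Y :: "real \<Rightarrow> 'a::real_inner"
  assumes lip: "\<And>x y. norm (F x - F y) \<le> K * norm (x - y)"
    and X: "\<And>t. (X has_vector_derivative F (X t)) (at t)"
    and Y: "\<And>t. (Y has_vector_derivative F (Y t)) (at t)"
  shows "norm (X t - Y t) \<le> exp (K * \<bar>t\<bar>) * norm (X 0 - Y 0)"
proof (cases "0 \<le> t")
  case True
  then show ?thesis using lipschitz_ode_dist_pos[of F K X Y t] assms by auto
next
  case False
  have "norm (X (- (- t)) - Y (- (- t))) \<le> exp (K * (- t)) * norm (X (- 0) - Y (- 0))"
  proof (rule lipschitz_ode_dist_pos[where F = "\<lambda>x. - F x"])
    show "norm (- F x - - F y) \<le> K * norm (x - y)" for x y
      using lip[of y x] by (simp add: norm_minus_commute)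
  qed (use False in \<open>auto intro!: has_vector_derivative_reflect X Y\<close>)
  then show ?thesis using False by simp
qed

lemma continuous_has_antiderivative:
  fixes f :: "real \<Rightarrow> 'a::euclidean_space"
  assumes "continuous_on UNIV f"
  obtains J where "J 0 = 0" "\<And>t. (J has_vector_derivative f t) (at t)"
proof -
  define J where "J t = (LBINT s=ereal 0..ereal t. f s)" for t :: real
  have "(J has_vector_derivative f t) (at t)" for t :: real
  proof -
    \<comment> \<open>A compact interval that contains 0 and has \<open>t\<close> in its interior,
      so that the derivative within it is the full derivative.\<close>
    let ?a = "- \<bar>t\<bar> - 1" and ?b = "\<bar>t\<bar> + 1"
    have "((\<lambda>u. LBINT y=ereal 0..u. f y) has_vector_derivative f t) (at t within {?a..?b})"
      by (rule interval_integral_FTC2) (auto intro: continuous_on_subset[OF assms])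
    moreover have "t \<in> interior {?a..?b}"
      by (auto simp: interior_atLeastAtMost_real)
    ultimately show ?thesis
      unfolding J_def[abs_def] by (simp only: at_within_interior)
  qed
  moreover have "J 0 = 0" by (simp add: J_def)
  ultimately show thesis using that by blast
qed

text \<open>\<open>C / l * exp (l * t)\<close> is a primitive of the bound
  \<open>C * exp (l * t)\<close>. The gained factor \<open>1 / l\<close> is what lets a large rate
  \<open>l\<close> turn integration into a contraction.\<close>

lemma antiderivative_exp_bound_pos:
  fixes J :: "real \<Rightarrow> 'a::real_normed_vector"
  assumes J: "J 0 = 0" "\<And>t. (J has_vector_derivative f t) (at t)"
    and b: "\<And>t. norm (f t) \<le> C * exp (l * \<bar>t\<bar>)" and l: "0 < l" and t: "0 \<le> t"
  shows "norm (J t) \<le> C / l * exp (l * \<bar>t\<bar>)"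
proof (cases "t = 0")
  case True
  have "0 \<le> C" using order_trans[OF norm_ge_zero b[of 0]] by simp
  then show ?thesis using l True by (simp add: J)
next
  case False
  have "0 \<le> C" using order_trans[OF norm_ge_zero b[of 0]] by simp
  have cont: "continuous_on UNIV J"
    using J(2) by (meson continuous_at_imp_continuous_on has_vector_derivative_continuous)
  have "norm (J t - J 0) \<le> C / l * exp (l * t) - C / l * exp (l * 0)"
  proof (rule differentiable_bound_general)
    show "continuous_on {0..t} J" using cont continuous_on_subset by blast
    show "((\<lambda>t. C / l * exp (l * t)) has_vector_derivative C * exp (l * x)) (at x)" for x
      using l by (auto intro!: derivative_eq_intros simp: has_real_derivative_iff_has_vector_derivative[symmetric])
    show "norm (f x) \<le> C * exp (l * x)" if "0 < x" for x
      using b[of x] that by simp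
  qed (use l t False J(2) in \<open>auto intro!: continuous_intros\<close>)
  moreover have "0 \<le> C / l" using \<open>0 \<le> C\<close> l by simp
  ultimately show ?thesis using t J by simp
qed

lemma antiderivative_exp_bound:
  fixes J :: "real \<Rightarrow> 'a::real_normed_vector"
  assumes J: "J 0 = 0" "\<And>t. (J has_vector_derivative f t) (at t)"
    and b: "\<And>t. norm (f t) \<le> C * exp (l * \<bar>t\<bar>)" and l: "0 < l"
  shows "norm (J t) \<le> C / l * exp (l * \<bar>t\<bar>)"
proof (cases "0 \<le> t")
  case True
  then show ?thesis using antiderivative_exp_bound_pos assms by blast
next
  case False
  have "norm (J (- (- t))) \<le> C / l * exp (l * \<bar>- t\<bar>)"
  proof (rule antiderivative_exp_bound_pos)
    show "((\<lambda>s. J (- s)) has_vector_derivative - f (- s)) (at s)" for s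
      by (intro has_vector_derivative_reflect J)
    show "norm (- f (- s)) \<le> C * exp (l * \<bar>s\<bar>)" for s
      using b[of "- s"] by simp
  qed (use False J l in auto)
  then show ?thesis by simp
qed

text \<open>Picard iteration for all times at once: rescaling by \<open>exp (2 K \<bar>t\<bar>)\<close> makes the integral
  operator a contraction of the space of bounded continuous curves.\<close>

lemma lipschitz_ode_exists:
  fixes F :: "'a::euclidean_space \<Rightarrow> 'a"
  assumes lip: "\<And>x y. norm (F x - F y) \<le> K * norm (x - y)" and K: "0 < K"
  obtains X where "X 0 = z" "\<And>t. (X has_vector_derivative F (X t)) (at t)"
proof -
  \<comment> \<open>With this rate the contraction factor \<open>K / l\<close> equals
    \<open>1 / 2\<close>.\<close>
  define l where "l = 2 * K"
  have l: "0 < l" using K by (simp add: l_def)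
  have contF: "continuous_on UNIV F"
    by (rule lipschitz_on_continuous_on[of K])
       (auto simp: lipschitz_on_def dist_norm lip K less_imp_le)
  \<comment> \<open>The unknown curve is \<open>z + exp (l * \<bar>s\<bar>) *\<^sub>R Y s\<close>
    with \<open>Y\<close> bounded; \<open>G Y\<close> is the field along it.\<close>
  define G where "G Y = (\<lambda>s. F (z + exp (l * \<bar>s\<bar>) *\<^sub>R apply_bcontfun Y s))" for Y :: "real \<Rightarrow>\<^sub>C 'a"
  have contG: "continuous_on UNIV (G Y)" for Y
    unfolding G_def
    by (rule continuous_on_compose2[OF contF]) (auto intro!: continuous_intros)
  have "\<exists>J. \<forall>Y. J Y 0 = 0 \<and> (\<forall>t. (J Y has_vector_derivative G Y t) (at t))"
    by (rule choice) (metis continuous_has_antiderivative[OF contG])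
  then obtain J where J0: "\<And>Y. J Y 0 = 0"
    and J: "\<And>Y t. (J Y has_vector_derivative G Y t) (at t)" by blast
  have contJ: "continuous_on UNIV (J Y)" for Y
    using J by (meson continuous_at_imp_continuous_on has_vector_derivative_continuous)
  have bound: "norm (J Y t) \<le> (norm (F z) + K * norm Y) / l * exp (l * \<bar>t\<bar>)" for Y t
  proof (rule antiderivative_exp_bound[OF J0 J _ l])
    fix t
    have "norm (G Y t) \<le> norm (F z) + norm (G Y t - F z)"
      by (metis norm_triangle_sub)
    also have "norm (G Y t - F z) \<le> K * norm (exp (l * \<bar>t\<bar>) *\<^sub>R Y t)"
      unfolding G_def using lip[of "z + exp (l * \<bar>t\<bar>) *\<^sub>R Y t" z] by simp
    also have "\<dots> \<le> K * norm Y * exp (l * \<bar>t\<bar>)"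
      using K norm_bounded[of Y t] by simp
    also have "norm (F z) \<le> norm (F z) * exp (l * \<bar>t\<bar>)"
      using l by (simp add: mult_le_cancel_left1)
    finally show "norm (G Y t) \<le> (norm (F z) + K * norm Y) * exp (l * \<bar>t\<bar>)"
      by (simp add: algebra_simps)
  qed
  define S where "S Y = (\<lambda>t. exp (- (l * \<bar>t\<bar>)) *\<^sub>R J Y t)" for Y
  have "S Y \<in> bcontfun" for Y
  proof (rule bcontfun_normI)
    show "continuous_on UNIV (S Y)" unfolding S_def
      by (intro continuous_intros contJ)
    show "norm (S Y t) \<le> (norm (F z) + K * norm Y) / l" for t
      using bound[of Y t] by (simp add: S_def exp_minus field_simps)
  qed
  then have S: "apply_bcontfun (Bcontfun (S Y)) = S Y" for Y
    by (rule Bcontfun_inverse)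
  have "\<exists>!Y. Bcontfun (S Y) = Y"
  proof (rule banach_fix_type)
    show "\<forall>Y Y'. dist (Bcontfun (S Y)) (Bcontfun (S Y')) \<le> 1/2 * dist Y Y'"
    proof (intro allI dist_bound)
      fix Y Y' :: "real \<Rightarrow>\<^sub>C 'a" and t
      have "norm (J Y t - J Y' t) \<le> (K * dist Y Y') / l * exp (l * \<bar>t\<bar>)"
      proof (rule antiderivative_exp_bound[OF _ _ _ l])
        show "((\<lambda>t. J Y t - J Y' t) has_vector_derivative G Y t - G Y' t) (at t)" for t
          by (intro has_vector_derivative_diff J)
        show "norm (G Y t - G Y' t) \<le> K * dist Y Y' * exp (l * \<bar>t\<bar>)" for t
        proof -
          have "norm (G Y t - G Y' t) \<le> K * norm (exp (l * \<bar>t\<bar>) *\<^sub>R (Y t - Y' t))"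
            unfolding G_def using lip[of "z + exp (l * \<bar>t\<bar>) *\<^sub>R Y t" "z + exp (l * \<bar>t\<bar>) *\<^sub>R Y' t"]
            by (simp add: algebra_simps)
          also have "\<dots> \<le> K * (exp (l * \<bar>t\<bar>) * dist Y Y')"
            using K dist_bounded[of Y t Y'] by (simp add: dist_norm)
          finally show ?thesis by (simp add: algebra_simps)
        qed
      qed (simp add: J0)
      then have "exp (- (l * \<bar>t\<bar>)) * norm (J Y t - J Y' t) \<le> exp (- (l * \<bar>t\<bar>)) * ((K * dist Y Y') / l * exp (l * \<bar>t\<bar>))"
        by (rule mult_left_mono) simp
      also have "\<dots> = 1 / 2 * dist Y Y'"
        using K by (simp add: exp_minus l_def)
      finally show "dist (Bcontfun (S Y) t) (Bcontfun (S Y') t) \<le> 1/2 * dist Y Y'"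
        unfolding S by (simp add: S_def dist_norm flip: scaleR_diff_right)
    qed
  qed auto
  then obtain Y where "Bcontfun (S Y) = Y" by blast
  then have Y: "Y t = exp (- (l * \<bar>t\<bar>)) *\<^sub>R J Y t" for t
    using S[of Y] by (simp add: S_def)
  have GY: "G Y t = F (z + J Y t)" for t
    unfolding G_def Y by (simp add: exp_minus)
  show thesis
  proof (rule that[of "\<lambda>t. z + J Y t"])
    show "((\<lambda>t. z + J Y t) has_vector_derivative F (z + J Y t)) (at t)" for t
      using J[of Y t] by (auto intro!: derivative_eq_intros simp: GY)
  qed (simp add: J0)
qed

section \<open>The torus as a fundamental domain, and averages over a period\<close>

definition lattice_vec :: "('n::finite \<Rightarrow> int) \<Rightarrow> real^'n" where
  "lattice_vec k = (\<chi> i. 2 * pi * of_int (k i))"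

text \<open>Reducing modulo the lattice is itself a translation by a lattice vector, though one that
  depends on the point; lattice periodic functions therefore cannot see
  \<open>tproj\<close>.\<close>

lemma tproj_lattice: "tproj x = x + lattice_vec (\<lambda>i. - \<lfloor>x $ i / (2 * pi)\<rfloor>)"
  by (simp add: tproj_def lattice_vec_def vec_eq_iff)

lemma tproj_add_lattice: "tproj (x + lattice_vec k) = tproj x"
  by (simp add: tproj_def lattice_vec_def vec_eq_iff add_divide_distrib algebra_simps)

lemma tproj_fund_dom: "(tproj x, v) \<in> fund_dom"
proof -
  have "0 \<le> a - 2 * pi * of_int \<lfloor>a / (2 * pi)\<rfloor> \<and> a - 2 * pi * of_int \<lfloor>a / (2 * pi)\<rfloor> < 2 * pi" for a :: real
  proof -
    have "of_int \<lfloor>a / (2 * pi)\<rfloor> \<le> a / (2 * pi)" "a / (2 * pi) < of_int \<lfloor>a / (2 * pi)\<rfloor> + 1"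
      by linarith+
    then have "of_int \<lfloor>a / (2 * pi)\<rfloor> * (2 * pi) \<le> a" "a < (of_int \<lfloor>a / (2 * pi)\<rfloor> + 1) * (2 * pi)"
      by (simp_all only: pos_le_divide_eq pos_divide_less_eq pi_gt_zero zero_less_mult_iff zero_less_numeral simp_thms)
    then show ?thesis by (simp add: algebra_simps)
  qed
  then show ?thesis by (simp add: fund_dom_def tproj_def)
qed

lemma borel_measurable_vec_nth [measurable]: "(\<lambda>x :: real^'n::finite. x $ i) \<in> borel_measurable borel"
  by (intro borel_measurable_continuous_onI continuous_intros)

lemma borel_measurable_vecI:
  fixes f :: "'a \<Rightarrow> real^'n::finite"
  assumes "\<And>i. (\<lambda>x. f x $ i) \<in> borel_measurable M"
  shows "f \<in> borel_measurable M"
  using assms by (subst borel_measurable_euclidean_space) (auto simp: Basis_vec_def inner_axis)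

lemma borel_measurable_tproj [measurable]: "tproj \<in> borel_measurable borel"
  unfolding tproj_def by (rule borel_measurable_vecI) simp

lemma sets_fund_dom [measurable]: "fund_dom \<in> sets borel"
proof -
  have "fund_dom = (\<Inter>i. {z :: (real^'n::finite) \<times> (real^'n). 0 \<le> fst z $ i} \<inter> {z. fst z $ i < 2 * pi})"
    by (auto simp: fund_dom_def)
  also have "\<dots> \<in> sets borel"
    by (intro sets.finite_INT sets.Int borel_closed borel_open closed_Collect_le open_Collect_less
          continuous_intros) auto
  finally show ?thesis .
qed

lemma emeasure_lborel_translate:
  fixes A :: "real set"
  assumes "A \<in> sets borel"
  shows "emeasure lborel {s. c + s \<in> A} = emeasure lborel A"
proof -
  have "emeasure lborel A = emeasure (distr lborel borel ((+) c)) A"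
    by (simp add: lborel_distr_plus)
  also have "\<dots> = emeasure lborel ((+) c -` A \<inter> space lborel)"
    using assms by (intro emeasure_distr) auto
  also have "(+) c -` A \<inter> space lborel = {s. c + s \<in> A}"
    by auto
  finally show ?thesis ..
qed

text \<open>The half-open window from \<open>t\<close> to \<open>t + T\<close> contains exactly one
  multiple \<open>m * T\<close> of the period. The part before it, moved back by
  \<open>(m - 1) * T\<close>, and the part after it, moved back by \<open>m * T\<close>, tile the
  window from 0 to \<open>T\<close>. This underlies the invariance of the uniform measure on a
  closed orbit.\<close>

lemma emeasure_periodic_shift:
  fixes B :: "real set"
  assumes B [measurable]: "B \<in> sets borel" and per: "\<And>s. s + T \<in> B \<longleftrightarrow> s \<in> B" and T: "0 < T"
  shows "emeasure lborel ({0..<T} \<inter> {s. s + t \<in> B}) = emeasure lborel ({0..<T} \<inter> B)"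
proof -
  have nat: "s + real n * T \<in> B \<longleftrightarrow> s \<in> B" for s n
  proof (induction n)
    case (Suc n)
    then show ?case using per[of "s + real n * T"] by (simp add: algebra_simps)
  qed simp
  have int: "s + of_int m * T \<in> B \<longleftrightarrow> s \<in> B" for s m
  proof (cases "0 \<le> m")
    case True
    then show ?thesis using nat[of s "nat m"] by simp
  next
    case False
    then show ?thesis using nat[of "s + of_int m * T" "nat (- m)"] by (simp add: algebra_simps)
  qed
  define m where "m = \<lceil>t / T\<rceil>"
  have m: "t \<le> of_int m * T" "of_int m * T < t + T"
  proof -
    have "t / T \<le> of_int m" "of_int m < t / T + 1"
      unfolding m_def by linarith+
    then show "t \<le> of_int m * T" "of_int m * T < t + T" using T by (simp_all add: field_simps)
  qed
  let ?c = "t + T - of_int m * T"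
  have "emeasure lborel ({0..<T} \<inter> {s. s + t \<in> B}) = emeasure lborel {s. t + s \<in> {t..<t + T} \<inter> B}"
    by (rule arg_cong[where f = "emeasure lborel"]) (auto simp: add.commute)
  also have "\<dots> = emeasure lborel ({t..<t + T} \<inter> B)"
    by (rule emeasure_lborel_translate) simp
  also have "{t..<t + T} \<inter> B = ({t..<of_int m * T} \<inter> B) \<union> ({of_int m * T..<t + T} \<inter> B)"
    using m by auto
  also have "emeasure lborel \<dots> = emeasure lborel ({t..<of_int m * T} \<inter> B) + emeasure lborel ({of_int m * T..<t + T} \<inter> B)"
    by (rule plus_emeasure[symmetric]) auto
  also have "emeasure lborel ({t..<of_int m * T} \<inter> B) = emeasure lborel {s. of_int (m - 1) * T + s \<in> {t..<of_int m * T} \<inter> B}"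
    by (rule emeasure_lborel_translate[symmetric]) simp
  also have "{s. of_int (m - 1) * T + s \<in> {t..<of_int m * T} \<inter> B} = {?c..<T} \<inter> B"
    using int[of _ "m - 1"] by (auto simp: algebra_simps)
  also have "emeasure lborel ({of_int m * T..<t + T} \<inter> B) = emeasure lborel {s. of_int m * T + s \<in> {of_int m * T..<t + T} \<inter> B}"
    by (rule emeasure_lborel_translate[symmetric]) simp
  also have "{s. of_int m * T + s \<in> {of_int m * T..<t + T} \<inter> B} = {0..<?c} \<inter> B"
    using int[of _ m] by (auto simp: algebra_simps)
  also have "emeasure lborel ({?c..<T} \<inter> B) + emeasure lborel ({0..<?c} \<inter> B) = emeasure lborel (({?c..<T} \<inter> B) \<union> ({0..<?c} \<inter> B))"
    by (rule plus_emeasure) auto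
  also have "({?c..<T} \<inter> B) \<union> ({0..<?c} \<inter> B) = {0..<T} \<inter> B"
    using m by auto
  finally show ?thesis .
qed

lemma integral_uniform_interval:
  fixes g :: "real \<Rightarrow> real"
  assumes T: "0 < T" and H: "\<And>s. (H has_real_derivative g s) (at s)" and g: "continuous_on UNIV g"
  shows "(\<integral>s. g s \<partial>uniform_measure lborel {0..<T}) = (H T - H 0) / T"
proof -
  have [measurable]: "g \<in> borel_measurable borel"
    using g by (rule borel_measurable_continuous_onI)
  have "(\<integral>s. g s \<partial>uniform_measure lborel {0..<T}) = (\<integral>s. (indicator {0..<T} s / T) * g s \<partial>lborel)"
  proof -
    have "uniform_measure lborel {0..<T} = density lborel (\<lambda>s. ennreal (indicator {0..<T} s / T))"
      unfolding uniform_measure_def using T divide_ennreal[of 1 T]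
      by (intro density_cong) (auto split: split_indicator)
    then show ?thesis using T by (simp add: integral_real_density)
  qed
  \<comment> \<open>The measure lives on the half-open interval, the fundamental theorem on the
    closed one; the endpoint \<open>T\<close> is a null set.\<close>
  also have "\<dots> = (\<integral>s. (indicator {0..T} s *\<^sub>R g s) / T \<partial>lborel)"
  proof (rule integral_cong_AE)
    show "AE s in lborel. indicator {0..<T} s / T * g s = indicator {0..T} s *\<^sub>R g s / T"
      using AE_lborel_singleton[of T] by eventually_elim (auto split: split_indicator)
  qed simp_all
  also have "\<dots> = (\<integral>s. indicator {0..T} s *\<^sub>R g s \<partial>lborel) / T"
    by simp
  also have "(\<integral>s. indicator {0..T} s *\<^sub>R g s \<partial>lborel) = H T - H 0"
    using T H g
    by (intro integral_FTC_atLeastAtMost)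
       (auto simp: has_real_derivative_iff_has_vector_derivative[symmetric] intro: has_field_derivative_at_within continuous_on_subset)
  finally show ?thesis .
qed

text \<open>Uniqueness of gradients, through which the definite descriptions in \<open>vgrad\<close>
  and \<open>xgrad\<close> are evaluated.\<close>

lemma inner_derivative_unique:
  fixes w w' :: "real^'n"
  assumes "(f has_derivative (\<lambda>h. w \<bullet> h)) (at x)" "(f has_derivative (\<lambda>h. w' \<bullet> h)) (at x)"
  shows "w = w'"
  using has_derivative_unique[OF assms] by (metis vector_eq_rdot inner_commute)

section \<open>Mechanical Lagrangians on the torus\<close>

text \<open>\<open>U\<close> enters \<open>L\<close> with a plus sign, so it is minus the potential
  energy and the equation of motion is \<open>x'' = G x\<close>. The single constant
  \<open>K\<close> serves at once as upper bound of \<open>U\<close>, bound of the force and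
  Lipschitz constant of the force.\<close>

locale mechanical =
  fixes U :: "real^'n::finite \<Rightarrow> real" and G :: "real^'n \<Rightarrow> real^'n" and K :: real
    and L :: "real^'n \<Rightarrow> real^'n \<Rightarrow> real"
  assumes L: "\<And>x v. L x v = (v \<bullet> v) / 2 + U x"
    and U_deriv: "\<And>x. (U has_derivative (\<lambda>h. G x \<bullet> h)) (at x)"
    and U_per: "\<And>x k. U (x + lattice_vec k) = U x"
    and G_lip: "\<And>x y. norm (G x - G y) \<le> K * norm (x - y)"
    and G_bd: "\<And>x. norm (G x) \<le> K"
    and U_bd: "\<And>x. U x \<le> K"
    and U_nonneg: "\<And>x. 0 \<le> U x"
    and U_0: "U 0 = 0"
    and K_pos: "0 < K"
begin

lemma vgrad_L: "vgrad L x v = v"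
proof -
  have "(L x has_derivative (\<lambda>h. v \<bullet> h)) (at v)"
    unfolding L[abs_def]
    by (rule derivative_eq_intros refl | simp add: inner_commute)+
  then show ?thesis
    unfolding vgrad_def by (rule the_equality) (metis inner_derivative_unique \<open>(L x has_derivative (\<lambda>h. v \<bullet> h)) (at v)\<close>)
qed

lemma xgrad_L: "xgrad L x v = G x"
proof -
  have D: "((\<lambda>y. L y v) has_derivative (\<lambda>h. G x \<bullet> h)) (at x)"
    unfolding L by (rule derivative_eq_intros U_deriv refl | simp)+
  then show ?thesis
    unfolding xgrad_def by (rule the_equality) (metis inner_derivative_unique D)
qed

lemma G_per: "G (x + lattice_vec k) = G x"
proof -
  have "((\<lambda>y. U (y + lattice_vec k)) has_derivative (\<lambda>h. G (x + lattice_vec k) \<bullet> h)) (at x)"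
    by (rule has_derivative_compose[OF _ U_deriv, of "\<lambda>y. y + lattice_vec k" "\<lambda>h. h"])
       (auto intro!: derivative_eq_intros)
  then show ?thesis
    unfolding U_per by (rule inner_derivative_unique[OF _ U_deriv])
qed

lemma G_0: "G 0 = 0"
proof -
  have "(\<lambda>h. G 0 \<bullet> h) = (\<lambda>h. 0)"
    by (rule differential_zero_maxmin[OF _ open_UNIV U_deriv]) (auto simp: U_0 U_nonneg)
  then show ?thesis by (metis inner_eq_zero_iff)
qed

definition field :: "(real^'n) \<times> (real^'n) \<Rightarrow> (real^'n) \<times> (real^'n)" where
  "field z = (snd z, G (fst z))"

lemma field_lip: "norm (field z - field z') \<le> (1 + K) * norm (z - z')"
proof -
  have "norm (field z - field z') \<le> norm (snd z - snd z') + norm (G (fst z) - G (fst z'))"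
    unfolding field_def by (simp add: norm_Pair_le)
  also have "norm (snd z - snd z') \<le> norm (z - z')"
    by (metis norm_snd_le prod.collapse snd_diff)
  also have "norm (G (fst z) - G (fst z')) \<le> K * norm (z - z')"
  proof -
    have "norm (fst z - fst z') \<le> norm (z - z')"
      by (metis norm_fst_le prod.collapse fst_diff)
    then show ?thesis
      using G_lip[of "fst z" "fst z'"] K_pos by (meson mult_left_mono order.trans less_imp_le)
  qed
  finally show ?thesis by (simp add: algebra_simps)
qed

definition sol :: "(real^'n) \<times> (real^'n) \<Rightarrow> real \<Rightarrow> (real^'n) \<times> (real^'n)" where
  "sol z = (SOME X. X 0 = z \<and> (\<forall>t. (X has_vector_derivative field (X t)) (at t)))"

lemma sol: "sol z 0 = z" "(sol z has_vector_derivative field (sol z t)) (at t)"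
proof -
  have "\<exists>X. X 0 = z \<and> (\<forall>t. (X has_vector_derivative field (X t)) (at t))"
    using lipschitz_ode_exists[of field "1 + K" z] field_lip K_pos by (metis add_pos_pos zero_less_one)
  from someI_ex[OF this] show "sol z 0 = z" "(sol z has_vector_derivative field (sol z t)) (at t)"
    by (auto simp: sol_def)
qed

lemma sol_unique:
  assumes "\<And>t. (X has_vector_derivative field (X t)) (at t)"
  shows "X t = sol (X 0) t"
  using lipschitz_ode_dist[of field "1 + K" X "sol (X 0)" t] field_lip assms sol by auto

lemma sol_unique_pair:
  assumes "\<And>t. (\<gamma> has_vector_derivative \<gamma>' t) (at t)" "\<And>t. (\<gamma>' has_vector_derivative G (\<gamma> t)) (at t)"
  shows "sol (\<gamma> 0, \<gamma>' 0) t = (\<gamma> t, \<gamma>' t)"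
proof -
  have "((\<lambda>t. (\<gamma> t, \<gamma>' t)) has_vector_derivative field (\<gamma> t, \<gamma>' t)) (at t)" for t
    using has_derivative_Pair[OF assms[of t, unfolded has_vector_derivative_def]]
    by (simp add: has_vector_derivative_def field_def)
  from sol_unique[OF this, of t] show ?thesis by simp
qed

lemma sol_fst: "((\<lambda>t. fst (sol z t)) has_vector_derivative snd (sol z t)) (at t)"
  using has_derivative_fst[OF sol(2)[unfolded has_vector_derivative_def], of z t]
  by (simp add: has_vector_derivative_def field_def)

lemma sol_snd: "((\<lambda>t. snd (sol z t)) has_vector_derivative G (fst (sol z t))) (at t)"
  using has_derivative_snd[OF sol(2)[unfolded has_vector_derivative_def], of z t]
  by (simp add: has_vector_derivative_def field_def)

text \<open>The fiber derivative of \<open>L\<close> is the velocity itself, so an Euler--Lagrange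
  solution is a curve whose velocity has derivative \<open>G\<close>; uniqueness for the first-order
  system then resolves the definite description.\<close>

lemma EL_flow_eq: "EL_flow L t z = sol z t"
  unfolding EL_flow_def
proof (rule the_equality)
  have "EL_solution L (\<lambda>t. fst (sol z t))"
    unfolding EL_solution_def vgrad_L xgrad_L using sol_fst sol_snd
    by (intro exI[of _ "\<lambda>t. snd (sol z t)"]) blast
  then show "\<exists>\<gamma>. EL_solution L \<gamma> \<and> \<gamma> 0 = fst z \<and> vector_derivative \<gamma> (at 0) = snd z \<and>
      sol z t = (\<gamma> t, vector_derivative \<gamma> (at t))"
    using vector_derivative_at[OF sol_fst, of z] sol(1)[of z]
    by (intro exI[of _ "\<lambda>t. fst (sol z t)"]) auto
next
  fix z'
  assume "\<exists>\<gamma>. EL_solution L \<gamma> \<and> \<gamma> 0 = fst z \<and> vector_derivative \<gamma> (at 0) = snd z \<and>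
      z' = (\<gamma> t, vector_derivative \<gamma> (at t))"
  then obtain \<gamma> \<gamma>' where g: "\<gamma> 0 = fst z" "vector_derivative \<gamma> (at 0) = snd z" "z' = (\<gamma> t, vector_derivative \<gamma> (at t))"
    and d: "\<And>t. (\<gamma> has_vector_derivative \<gamma>' t) (at t)" "\<And>t. (\<gamma>' has_vector_derivative G (\<gamma> t)) (at t)"
    unfolding EL_solution_def vgrad_L xgrad_L by blast
  show "z' = sol z t"
    using sol_unique_pair[of \<gamma> \<gamma>' t] d g vector_derivative_at[OF d(1)] by (metis prod.collapse)
qed

text \<open>The translated curve solves the same equation because \<open>G\<close> is periodic. The
  flow on the torus can thus be computed from any lift of the initial point, which is the content of
  \<open>tflow_tproj\<close>.\<close>

lemma sol_translate: "sol (x + lattice_vec k, v) t = sol (x, v) t + (lattice_vec k, 0)"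
proof -
  have "((\<lambda>t. sol (x, v) t + (lattice_vec k, 0)) has_vector_derivative field (sol (x, v) t + (lattice_vec k, 0))) (at t)" for t
    using has_vector_derivative_add[OF sol(2)[of "(x, v)" t] has_vector_derivative_const[of "(lattice_vec k, 0)"]]
    by (simp add: field_def G_per)
  from sol_unique[OF this, of t] show ?thesis by (simp add: sol(1))
qed

lemma tflow_eq: "tflow L t z = (tproj (fst (sol z t)), snd (sol z t))"
  by (simp add: tflow_def EL_flow_eq)

lemma tflow_tproj: "tflow L t (tproj x, v) = tflow L t (x, v)"
  unfolding tflow_eq tproj_lattice[of x] sol_translate by (simp add: tproj_add_lattice)

lemma sol_measurable [measurable]: "(\<lambda>z. sol z t) \<in> borel_measurable borel"
proof -
  have "lipschitz_on (exp ((1 + K) * \<bar>t\<bar>)) UNIV (\<lambda>z. sol z t)"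
  proof (rule lipschitz_onI)
    show "dist (sol z t) (sol z' t) \<le> exp ((1 + K) * \<bar>t\<bar>) * dist z z'" for z z'
      using lipschitz_ode_dist[OF field_lip sol(2) sol(2), of z t z'] by (simp add: dist_norm sol(1))
  qed simp
  then show ?thesis
    by (intro borel_measurable_continuous_onI lipschitz_on_continuous_on)
qed

lemma tflow_measurable [measurable]: "tflow L t \<in> borel_measurable borel"
proof -
  have [measurable]: "(\<lambda>z. fst (sol z t)) \<in> borel_measurable borel" "(\<lambda>z. snd (sol z t)) \<in> borel_measurable borel"
    by (rule measurable_compose[OF sol_measurable], intro borel_measurable_continuous_onI continuous_intros)+
  show ?thesis
    unfolding tflow_eq[abs_def] by (intro borel_measurable_Pair) measurable
qed

end

section \<open>Exact forms under invariant measures\<close>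

lemma curve_bound:
  fixes X :: "real \<Rightarrow> 'a::real_normed_vector"
  assumes X: "\<And>t. (X has_vector_derivative X' t) (at t)"
    and b: "0 \<le> b" "\<And>t. 0 \<le> t \<Longrightarrow> t \<le> b \<Longrightarrow> norm (X' t) \<le> C"
  shows "norm (X b - X 0) \<le> C * b"
proof (cases "b = 0")
  case False
  have "norm (X b - X 0) \<le> C * b - C * 0"
  proof (rule differentiable_bound_general)
    show "continuous_on {0..b} X"
      using X by (meson continuous_at_imp_continuous_on has_vector_derivative_continuous)
    show "((\<lambda>t. C * t) has_vector_derivative C) (at x)" for x
      by (auto intro!: derivative_eq_intros simp: has_real_derivative_iff_has_vector_derivative[symmetric])
  qed (use False b X in \<open>auto intro!: continuous_intros\<close>)
  then show ?thesis by simp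
qed simp

context mechanical
begin

lemma L_measurable [measurable]: "(\<lambda>z. L (fst z) (snd z)) \<in> borel_measurable borel"
proof -
  have "continuous_on UNIV U"
    using U_deriv by (meson continuous_at_imp_continuous_on has_derivative_continuous)
  then have "continuous_on UNIV (\<lambda>z :: (real^'n) \<times> (real^'n). U (fst z))"
    by (rule continuous_on_compose2[OF _ continuous_on_fst[OF continuous_on_id]]) auto
  then show ?thesis
    unfolding L by (intro borel_measurable_continuous_onI continuous_intros) auto
qed

text \<open>The force is bounded by \<open>K\<close>. Up to time 1 this gives the majorant
  \<open>norm (snd z) + K\<close> of the speed, which dominates the difference quotients in
  \<open>integral_exact_form\<close>.\<close>

lemma velocity_growth:
  assumes "0 \<le> t"
  shows "norm (snd (sol z t)) \<le> norm (snd z) + K * t"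
proof -
  have "norm (snd (sol z t) - snd (sol z 0)) \<le> K * t"
    by (rule curve_bound[OF sol_snd]) (use assms G_bd in auto)
  then show ?thesis
    using norm_triangle_sub[of "snd (sol z t)" "snd z"] by (simp add: sol(1))
qed

lemma along_flow:
  assumes "\<And>x. (f has_derivative (\<lambda>h. Df x \<bullet> h)) (at x)"
  shows "((\<lambda>t. f (fst (sol z t))) has_real_derivative Df (fst (sol z t)) \<bullet> snd (sol z t)) (at t)"
  unfolding has_field_derivative_def
  by (rule has_derivative_eq_rhs[OF has_derivative_compose[OF sol_fst[unfolded has_vector_derivative_def] assms]])
     (simp add: fun_eq_iff)

text \<open>An invariant measure does not see the exact form \<open>df\<close>: differentiate the constant
  \<open>\<integral> f \<circ> \<Phi>\<^sup>t d\<mu>\<close> under the integral sign at \<open>t = 0\<close>.\<close>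

lemma integral_exact_form:
  assumes inv: "invariant_prob L \<mu>" and v: "integrable \<mu> (\<lambda>z. norm (snd z))"
    and f: "\<And>x. (f has_derivative (\<lambda>h. Df x \<bullet> h)) (at x)"
    and per: "\<And>x k. f (x + lattice_vec k) = f x"
    and bd: "\<And>x. \<bar>f x\<bar> \<le> M" "\<And>x. norm (Df x) \<le> M"
  shows "integrable \<mu> (\<lambda>z. Df (fst z) \<bullet> snd z)" "(\<integral>z. Df (fst z) \<bullet> snd z \<partial>\<mu>) = 0"
proof -
  interpret prob_space \<mu> using inv by (simp add: invariant_prob_def)
  have sets [measurable_cong]: "sets \<mu> = sets borel"
    and distr: "\<And>t. distr \<mu> \<mu> (tflow L t) = \<mu>" using inv by (auto simp: invariant_prob_def)
  have M: "0 \<le> M" using bd(1)[of 0] by linarith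
  define g where "g z = f (fst z)" for z :: "(real^'n) \<times> (real^'n)"
  have "continuous_on UNIV f"
    using f by (meson continuous_at_imp_continuous_on has_derivative_continuous)
  then have g_meas [measurable]: "g \<in> borel_measurable borel"
    unfolding g_def
    by (intro borel_measurable_continuous_onI continuous_on_compose2[OF _ continuous_on_fst[OF continuous_on_id]]) auto
  \<comment> \<open>Since \<open>f\<close> is periodic it can be evaluated along the lifted
    solution, where \<open>tproj\<close> causes no jumps.\<close>
  have g_flow: "g (tflow L t z) = g (sol z t)" for t z
    by (simp add: g_def tflow_eq tproj_lattice per)
  have tfl [measurable]: "tflow L t \<in> measurable \<mu> \<mu>" for t
    using tflow_measurable[of t] by (simp add: measurable_cong_sets[OF sets sets])
  have g_int: "integrable \<mu> (\<lambda>z. g (sol z t))" for t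
  proof (rule integrable_const_bound[of _ M])
    show "(\<lambda>z. g (sol z t)) \<in> borel_measurable \<mu>" by measurable
  qed (simp add: g_def bd)
  have g_inv: "(\<integral>z. g (sol z t) \<partial>\<mu>) = (\<integral>z. g z \<partial>\<mu>)" for t
    using integral_distr[OF tfl[of t], of g] by (simp add: distr g_flow)
  \<comment> \<open>Difference quotients along the sequence of times \<open>1 / Suc k\<close>, so
    that dominated convergence applies: their integrals are 0 by invariance and their pointwise
    limit is the derivative of \<open>f\<close> along the flow.\<close>
  define h where "h k z = real (Suc k) * (g (sol z (inverse (real (Suc k)))) - g (sol z 0))" for k z
  have h_zero: "integral\<^sup>L \<mu> (h k) = 0" for k
    unfolding h_def by (simp add: g_int g_inv)
  have h_lim: "(\<lambda>k. h k z) \<longlonglongrightarrow> Df (fst z) \<bullet> snd z" for z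
  proof -
    have "(\<lambda>d. (g (sol z (0 + d)) - g (sol z 0)) / d) \<midarrow>0\<rightarrow> Df (fst z) \<bullet> snd z"
      using along_flow[OF f, of z 0] unfolding DERIV_def g_def by (simp add: sol(1))
    moreover have "filterlim (\<lambda>k. inverse (real (Suc k))) (at 0) sequentially"
      using LIMSEQ_inverse_real_of_nat by (simp add: filterlim_at)
    ultimately have "(\<lambda>k. (g (sol z (0 + inverse (real (Suc k)))) - g (sol z 0)) / inverse (real (Suc k))) \<longlonglongrightarrow> Df (fst z) \<bullet> snd z"
      by (rule filterlim_compose)
    moreover have "(g (sol z (0 + inverse (real (Suc k)))) - g (sol z 0)) / inverse (real (Suc k)) = h k z" for k
      unfolding h_def by (simp only: add_0_left divide_inverse inverse_inverse_eq mult.commute)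
    ultimately show ?thesis by simp
  qed
  have h_bd: "norm (h k z) \<le> M * (norm (snd z) + K)" for k z
  proof -
    let ?t = "inverse (real (Suc k))"
    have "norm (g (sol z ?t) - g (sol z 0)) \<le> (M * (norm (snd z) + K)) * ?t"
    proof (rule curve_bound)
      show "((\<lambda>t. g (sol z t)) has_vector_derivative Df (fst (sol z t)) \<bullet> snd (sol z t)) (at t)" for t
        using along_flow[OF f, of z t] by (simp add: has_real_derivative_iff_has_vector_derivative g_def)
      fix t :: real assume t: "0 \<le> t" "t \<le> ?t"
      have "norm (Df (fst (sol z t)) \<bullet> snd (sol z t)) \<le> norm (Df (fst (sol z t))) * norm (snd (sol z t))"
        by (simp add: Cauchy_Schwarz_ineq2)
      also have "\<dots> \<le> M * norm (snd (sol z t))"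
        by (intro mult_right_mono bd) simp
      also have "\<dots> \<le> M * (norm (snd z) + K)"
      proof (intro mult_left_mono M)
        have "?t \<le> 1" by (simp add: inverse_eq_divide)
        then have "K * t \<le> K * 1" using t K_pos by (intro mult_left_mono) auto
        then show "norm (snd (sol z t)) \<le> norm (snd z) + K"
          using velocity_growth[of t z] t by simp
      qed
      finally show "norm (Df (fst (sol z t)) \<bullet> snd (sol z t)) \<le> M * (norm (snd z) + K)" .
    qed simp
    then have "real (Suc k) * norm (g (sol z ?t) - g (sol z 0)) \<le> real (Suc k) * ((M * (norm (snd z) + K)) * ?t)"
      by (intro mult_left_mono) auto
    also have "\<dots> = M * (norm (snd z) + K)" by simp
    finally show ?thesis unfolding h_def norm_mult by simp
  qed
  have h_meas [measurable]: "h k \<in> borel_measurable \<mu>" for k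
    unfolding h_def by measurable
  have lim_meas: "(\<lambda>z. Df (fst z) \<bullet> snd z) \<in> borel_measurable \<mu>"
    by (rule borel_measurable_LIMSEQ_real[OF h_lim h_meas])
  have dom: "integrable \<mu> (\<lambda>z. M * (norm (snd z) + K))"
    using v by simp
  show "integrable \<mu> (\<lambda>z. Df (fst z) \<bullet> snd z)"
    by (rule integrable_dominated_convergence[where s = h, OF lim_meas h_meas dom]) (use h_lim h_bd in auto)
  have "(\<lambda>k. integral\<^sup>L \<mu> (h k)) \<longlonglongrightarrow> (\<integral>z. Df (fst z) \<bullet> snd z \<partial>\<mu>)"
    by (rule integral_dominated_convergence[where s = h, OF lim_meas h_meas dom]) (use h_lim h_bd in auto)
  then show "(\<integral>z. Df (fst z) \<bullet> snd z \<partial>\<mu>) = 0"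
    unfolding h_zero using LIMSEQ_unique tendsto_const by blast
qed

text \<open>The speed is at most \<open>1 + L\<close>, because a square is nonnegative and
  \<open>U\<close> is too; finite action therefore forces a finite first moment.\<close>

lemma admissible_integrable:
  assumes "admissible L \<mu>"
  shows "integrable \<mu> (\<lambda>z. norm (snd z))" "integrable \<mu> (\<lambda>z. c \<bullet> snd z)"
proof -
  have inv: "invariant_prob L \<mu>" and L_int: "integrable \<mu> (\<lambda>z. L (fst z) (snd z))"
    using assms by (auto simp: admissible_def)
  interpret prob_space \<mu> using inv by (simp add: invariant_prob_def)
  have sets [measurable_cong]: "sets \<mu> = sets borel"
    using inv by (auto simp: invariant_prob_def)
  have [measurable]: "(\<lambda>z :: (real^'n) \<times> (real^'n). norm (snd z)) \<in> borel_measurable borel"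
    "(\<lambda>z :: (real^'n) \<times> (real^'n). c \<bullet> snd z) \<in> borel_measurable borel"
    by (intro borel_measurable_continuous_onI continuous_intros)+
  show v: "integrable \<mu> (\<lambda>z. norm (snd z))"
  proof (rule Bochner_Integration.integrable_bound)
    show "integrable \<mu> (\<lambda>z. 1 + L (fst z) (snd z))" using L_int by simp
    show "AE z in \<mu>. norm (norm (snd z)) \<le> norm (1 + L (fst z) (snd z))"
    proof (rule AE_I2)
      fix z :: "(real^'n) \<times> (real^'n)"
      have "0 \<le> (norm (snd z) - 1)\<^sup>2" by simp
      then have "norm (snd z) \<le> 1 + (snd z \<bullet> snd z) / 2"
        by (simp add: power2_diff dot_square_norm)
      then show "norm (norm (snd z)) \<le> norm (1 + L (fst z) (snd z))"
        using U_nonneg[of "fst z"] by (simp add: L)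
    qed
  qed simp
  show "integrable \<mu> (\<lambda>z. c \<bullet> snd z)"
    by (rule Bochner_Integration.integrable_bound[of _ "\<lambda>z. norm c * norm (snd z)"])
       (use v in \<open>auto simp: Cauchy_Schwarz_ineq2\<close>)
qed

lemma action_eq: "admissible L \<mu> \<Longrightarrow> action L c \<mu> = (\<integral>z. L (fst z) (snd z) \<partial>\<mu>) - (\<integral>z. c \<bullet> snd z \<partial>\<mu>)"
  unfolding action_def using admissible_integrable(2)[of \<mu> c] by (simp add: admissible_def)

text \<open>The class \<open>c\<close> may be represented by the cohomologous form
  \<open>c + Df\<close> without changing the action, so a representative adapted to the dynamics can
  be used.\<close>

lemma action_twisted:
  assumes adm: "admissible L \<mu>"
    and f: "\<And>x. (f has_derivative (\<lambda>h. Df x \<bullet> h)) (at x)"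
    and per: "\<And>x k. f (x + lattice_vec k) = f x"
    and bd: "\<And>x. \<bar>f x\<bar> \<le> M" "\<And>x. norm (Df x) \<le> M"
  shows "action L c \<mu> = (\<integral>z. L (fst z) (snd z) - (c + Df (fst z)) \<bullet> snd z \<partial>\<mu>)"
proof -
  have L_int: "integrable \<mu> (\<lambda>z. L (fst z) (snd z))"
    using adm by (auto simp: admissible_def)
  note ex = integral_exact_form[OF _ admissible_integrable(1)[OF adm] f per bd]
  have "(\<integral>z. L (fst z) (snd z) - (c + Df (fst z)) \<bullet> snd z \<partial>\<mu>)
    = (\<integral>z. (L (fst z) (snd z) - c \<bullet> snd z) - Df (fst z) \<bullet> snd z \<partial>\<mu>)"
    by (simp add: algebra_simps)
  also have "\<dots> = action L c \<mu> - 0"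
    unfolding action_def using ex adm L_int admissible_integrable(2)[OF adm]
    by (subst Bochner_Integration.integral_diff) (auto simp: admissible_def)
  finally show ?thesis by simp
qed

text \<open>The first term measures how far \<open>v\<close> is from the momentum \<open>w\<close>;
  the second is minus the Hamiltonian at \<open>w\<close>. A Hamilton--Jacobi subsolution makes the
  second nonnegative, and an orbit is calibrated when both vanish.\<close>

lemma square_completion: "L x v - w \<bullet> v = (norm (v - w))\<^sup>2 / 2 + (U x - (norm w)\<^sup>2 / 2)"
  unfolding L power2_norm_eq_inner
  by (simp add: inner_diff_left inner_diff_right inner_commute[of w v] diff_divide_distrib add_divide_distrib)

lemma subsolution_action_nonneg:
  assumes adm: "admissible L \<mu>"
    and f: "\<And>x. (f has_derivative (\<lambda>h. Df x \<bullet> h)) (at x)"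
    and per: "\<And>x k. f (x + lattice_vec k) = f x"
    and bd: "\<And>x. \<bar>f x\<bar> \<le> M" "\<And>x. norm (Df x) \<le> M"
    and sub: "\<And>x. (norm (c + Df x))\<^sup>2 / 2 \<le> U x"
  shows "0 \<le> action L c \<mu>"
  unfolding action_twisted[OF adm f per bd]
  by (rule integral_nonneg_AE) (use sub in \<open>auto simp: square_completion\<close>)

section \<open>The fixed point and the lowest level of \<alpha>\<close>

lemma invariant_prob_dirac: "invariant_prob L (return borel (0, 0))"
proof -
  have "tflow L t (0, 0) = (0, 0)" for t
  proof -
    have "sol ((\<lambda>_. 0) 0, (\<lambda>_. 0) 0) t = ((\<lambda>_. 0) t, (\<lambda>_. 0) t)"
      by (rule sol_unique_pair) (simp_all add: G_0)
    then show ?thesis by (simp add: tflow_eq tproj_def vec_eq_iff)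
  qed
  moreover have "distr (return borel (0, 0)) (return borel (0, 0)) (tflow L t)
      = distr (return borel (0, 0)) borel (tflow L t)" for t
    by (rule distr_cong) auto
  moreover have "(0, 0) \<in> (fund_dom :: ((real^'n) \<times> (real^'n)) set)" by (simp add: fund_dom_def)
  ultimately show ?thesis
    unfolding invariant_prob_def
    by (auto simp: prob_space_return tflow_measurable indicator_def distr_return)
qed

lemma EL_flow_fixed: "EL_flow L t (0, 0) = (0, 0)"
proof -
  have "sol ((\<lambda>_. 0) 0, (\<lambda>_. 0) 0) t = ((\<lambda>_. 0) t, (\<lambda>_. 0) t)"
    by (rule sol_unique_pair) (simp_all add: G_0)
  then show ?thesis by (simp add: EL_flow_eq)
qed

lemma admissible_dirac: "admissible L (return borel (0, 0))"
  unfolding admissible_def using invariant_prob_dirac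
  by (auto simp: integrable_iff_bounded nn_integral_return)

lemma action_dirac: "action L c (return borel (0, 0)) = 0"
proof -
  have [measurable]: "(\<lambda>z :: (real^'n) \<times> (real^'n). c \<bullet> snd z) \<in> borel_measurable borel"
    by (intro borel_measurable_continuous_onI continuous_intros)
  have "(\<lambda>z. L (fst z) (snd z) - c \<bullet> snd z) \<in> borel_measurable borel" by measurable
  then show ?thesis unfolding action_def by (subst integral_return) (simp_all add: L[of 0 0] U_0)
qed

text \<open>Complete the square with \<open>c\<close> itself as momentum and drop what is
  nonnegative. With the Dirac measure as a member, the infimum over real numbers in
  \<open>alpha\<close> is thus one over a nonempty set bounded below.\<close>

lemma action_lower_bound:
  assumes "admissible L \<mu>"
  shows "- ((norm c)\<^sup>2 / 2) \<le> action L c \<mu>"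
proof -
  interpret prob_space \<mu> using assms by (simp add: admissible_def invariant_prob_def)
  have "(\<integral>z. - ((norm c)\<^sup>2 / 2) \<partial>\<mu>) \<le> action L c \<mu>"
    unfolding action_def
  proof (rule integral_mono)
    show "integrable \<mu> (\<lambda>z. L (fst z) (snd z) - c \<bullet> snd z)"
      using assms admissible_integrable(2)[OF assms] by (simp add: admissible_def)
    show "- ((norm c)\<^sup>2 / 2) \<le> L (fst z) (snd z) - c \<bullet> snd z" for z
      using U_nonneg[of "fst z"] by (simp add: square_completion add_increasing)
  qed simp
  then show ?thesis by (simp add: prob_space)
qed

lemma alpha_nonneg: "0 \<le> alpha L c"
proof -
  have "(INF \<mu> \<in> {\<mu>. admissible L \<mu>}. action L c \<mu>) \<le> action L c (return borel (0, 0))"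
    by (rule cINF_lower) (use action_lower_bound admissible_dirac in \<open>auto intro!: bdd_belowI2\<close>)
  then show ?thesis by (simp add: alpha_def action_dirac)
qed

text \<open>The Dirac measure at the fixed point has action 0 for every class, so the infimum is at
  most 0 and only negative actions can push it lower.\<close>

lemma alpha_eq_0_iff: "alpha L c = 0 \<longleftrightarrow> (\<forall>\<mu>. admissible L \<mu> \<longrightarrow> 0 \<le> action L c \<mu>)"
proof
  assume 0: "alpha L c = 0"
  show "\<forall>\<mu>. admissible L \<mu> \<longrightarrow> 0 \<le> action L c \<mu>"
  proof (intro allI impI)
    fix \<mu> assume "admissible L \<mu>"
    then have "(INF \<mu> \<in> {\<mu>. admissible L \<mu>}. action L c \<mu>) \<le> action L c \<mu>"
      by (intro cINF_lower) (use action_lower_bound in \<open>auto intro!: bdd_belowI2\<close>)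
    then show "0 \<le> action L c \<mu>" using 0 by (simp add: alpha_def)
  qed
next
  assume "\<forall>\<mu>. admissible L \<mu> \<longrightarrow> 0 \<le> action L c \<mu>"
  then have "0 \<le> (INF \<mu> \<in> {\<mu>. admissible L \<mu>}. action L c \<mu>)"
    by (intro cINF_greatest) (use admissible_dirac in auto)
  then show "alpha L c = 0" using alpha_nonneg[of c] by (simp add: alpha_def)
qed

text \<open>For a fixed measure the action is affine in the class, so the lowest level is an
  intersection of half-spaces. Its convexity supplies the connectedness that a flat must
  have.\<close>

lemma convex_lowest_level: "convex {c. alpha L c = 0}"
proof (rule convexI)
  fix c d and u v :: real
  assume c: "c \<in> {c. alpha L c = 0}" and d: "d \<in> {c. alpha L c = 0}" and uv: "0 \<le> u" "0 \<le> v" "u + v = 1"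
  have "0 \<le> action L (u *\<^sub>R c + v *\<^sub>R d) \<mu>" if adm: "admissible L \<mu>" for \<mu>
  proof -
    have lin: "A - (u * p + v * q) = u * (A - p) + v * (A - q)" for A p q :: real
      using uv(3) by algebra
    have "(\<integral>z. (u *\<^sub>R c + v *\<^sub>R d) \<bullet> snd z \<partial>\<mu>) = (\<integral>z. u * (c \<bullet> snd z) + v * (d \<bullet> snd z) \<partial>\<mu>)"
      by (simp add: inner_add_left)
    also have "\<dots> = u * (\<integral>z. c \<bullet> snd z \<partial>\<mu>) + v * (\<integral>z. d \<bullet> snd z \<partial>\<mu>)"
      using admissible_integrable(2)[OF adm]
      by (subst Bochner_Integration.integral_add) auto
    finally have "action L (u *\<^sub>R c + v *\<^sub>R d) \<mu> = u * action L c \<mu> + v * action L d \<mu>"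
      unfolding action_eq[OF adm] using lin by simp
    then show ?thesis using c d uv adm by (simp add: alpha_eq_0_iff)
  qed
  then show "u *\<^sub>R c + v *\<^sub>R d \<in> {c. alpha L c = 0}" by (simp add: alpha_eq_0_iff)
qed

text \<open>Maximality rests on the fact that an affine function which vanishes on a ball vanishes
  everywhere: a larger set on which \<open>alpha L\<close> is affine would still lie in the zero
  level.\<close>

lemma is_flat_lowest_level:
  assumes int: "interior {c. alpha L c = 0} \<noteq> {}"
  shows "is_flat (alpha L) {c. alpha L c = 0}"
proof -
  let ?F = "{c. alpha L c = 0}"
  have "aff_dim ?F = int (DIM(real^'n))"
    using int by (rule aff_dim_nonempty_interior)
  then have "aff_dim ?F > 0" by simp
  moreover have "affine_on (alpha L) ?F"
    unfolding affine_on_def by (intro exI[of _ 0]) auto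
  moreover have "H = ?F" if F: "?F \<subseteq> H" and H: "affine_on (alpha L) H" for H
  proof
    obtain a b where ab: "\<And>c. c \<in> H \<Longrightarrow> alpha L c = a \<bullet> c + b"
      using H by (auto simp: affine_on_def)
    obtain c0 e where e: "e > 0" "ball c0 e \<subseteq> ?F"
      using int by (auto simp: mem_interior)
    \<comment> \<open>A step in the direction of the slope \<open>a\<close>, short enough to stay in
      the ball; the summand 1 guards against \<open>a = 0\<close>. Vanishing at both ends gives
      \<open>a \<bullet> d = 0\<close> and hence \<open>a = 0\<close>.\<close>
    define d where "d = (e / (2 * (norm a + 1))) *\<^sub>R a"
    have "norm a * e < e * (2 * (norm a + 1))"
      using e(1) norm_ge_zero[of a] by (simp add: algebra_simps add_nonneg_pos)
    then have "norm d < e"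
      unfolding d_def using e(1) by (simp add: pos_divide_less_eq add_nonneg_pos mult.commute)
    then have "c0 + d \<in> ?F" "c0 \<in> ?F" using e by (auto simp: subset_iff dist_norm)
    then have "a \<bullet> (c0 + d) + b = 0" "a \<bullet> c0 + b = 0"
      using ab[of "c0 + d"] ab[of c0] F by auto
    then have "a \<bullet> d = 0" by (simp add: inner_add_right)
    then have "a = 0" using e(1) norm_ge_zero[of a] by (auto simp: d_def)
    moreover from this have "b = 0" using \<open>a \<bullet> c0 + b = 0\<close> by simp
    ultimately show "H \<subseteq> ?F" using ab by auto
  qed (rule F)
  ultimately show ?thesis
    unfolding is_flat_def using convex_connected[OF convex_lowest_level] by blast
qed

end

lemma shift_vector_derivative:
  assumes "(X has_vector_derivative D) (at (s + t))"
  shows "((\<lambda>t. X (s + t)) has_vector_derivative D) (at t)"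
proof -
  have "((\<lambda>t. s + t) has_vector_derivative 1) (at t)"
    by (auto intro!: derivative_eq_intros)
  from vector_diff_chain_at[OF this assms] show ?thesis by (simp add: o_def)
qed

section \<open>Measures carried by closed orbits\<close>

locale closed_orbit = mechanical U G K L
  for U :: "real^'n::finite \<Rightarrow> real" and G :: "real^'n \<Rightarrow> real^'n" and K :: real
    and L :: "real^'n \<Rightarrow> real^'n \<Rightarrow> real" +
  fixes \<gamma> \<gamma>' :: "real \<Rightarrow> real^'n" and T :: real and k :: "'n \<Rightarrow> int"
  assumes deriv: "\<And>t. (\<gamma> has_vector_derivative \<gamma>' t) (at t)"
    and deriv2: "\<And>t. (\<gamma>' has_vector_derivative G (\<gamma> t)) (at t)"
    and period: "\<And>t. \<gamma> (t + T) = \<gamma> t + lattice_vec k"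
    and T_pos: "0 < T"
begin

definition orbit :: "real \<Rightarrow> (real^'n) \<times> (real^'n)" where
  "orbit s = (tproj (\<gamma> s), \<gamma>' s)"

lemma velocity_period: "\<gamma>' (t + T) = \<gamma>' t"
proof -
  have "((\<lambda>t. \<gamma> (T + t)) has_vector_derivative \<gamma>' (T + t)) (at t)"
    by (rule shift_vector_derivative[OF deriv])
  moreover have "((\<lambda>t. \<gamma> (T + t)) has_vector_derivative \<gamma>' t) (at t)"
    using has_vector_derivative_add[OF deriv[of t] has_vector_derivative_const[of "lattice_vec k"]]
    by (simp add: period add.commute[of T])
  ultimately show ?thesis
    using vector_derivative_unique_at by (metis add.commute)
qed

lemma orbit_period: "orbit (s + T) = orbit s"
  by (simp add: orbit_def period velocity_period tproj_add_lattice)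

lemma tflow_orbit: "tflow L t (orbit s) = orbit (s + t)"
proof -
  have "sol (\<gamma> (s + 0), \<gamma>' (s + 0)) t = (\<gamma> (s + t), \<gamma>' (s + t))"
    by (rule sol_unique_pair) (rule shift_vector_derivative deriv deriv2)+
  then show ?thesis
    unfolding orbit_def tflow_tproj by (simp add: tflow_eq)
qed

lemma continuous_velocity: "continuous_on UNIV \<gamma>'"
  using deriv2 by (meson continuous_at_imp_continuous_on has_vector_derivative_continuous)

lemma orbit_measurable [measurable]: "orbit \<in> borel_measurable borel"
proof -
  have "continuous_on UNIV \<gamma>"
    using deriv by (meson continuous_at_imp_continuous_on has_vector_derivative_continuous)
  then have [measurable]: "\<gamma> \<in> borel_measurable borel" "\<gamma>' \<in> borel_measurable borel"
    using continuous_velocity by (auto intro: borel_measurable_continuous_onI)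
  show ?thesis
    unfolding orbit_def[abs_def] by (intro borel_measurable_Pair) measurable
qed

definition orbit_measure :: "((real^'n) \<times> (real^'n)) measure" where
  "orbit_measure = distr (uniform_measure lborel {0..<T}) borel orbit"

lemma sets_orbit_measure [measurable_cong]: "sets orbit_measure = sets borel"
  by (simp add: orbit_measure_def)

lemma orbit_measurable_uniform [measurable]: "orbit \<in> measurable (uniform_measure lborel {0..<T}) borel"
  by (simp add: measurable_cong_sets[of "uniform_measure lborel {0..<T}" borel borel borel])

lemma emeasure_orbit_measure:
  assumes A [measurable]: "A \<in> sets borel"
  shows "emeasure orbit_measure A = emeasure lborel ({0..<T} \<inter> {s. orbit s \<in> A}) / ennreal T"
proof -
  have eq: "{s. orbit s \<in> A} = orbit -` A \<inter> space borel" by auto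
  have [measurable]: "{s. orbit s \<in> A} \<in> sets borel"
    unfolding eq using orbit_measurable A by (rule measurable_sets)
  have "emeasure orbit_measure A = emeasure (uniform_measure lborel {0..<T}) {s. orbit s \<in> A}"
    unfolding orbit_measure_def by (subst emeasure_distr) (auto simp: vimage_def)
  also have "\<dots> = emeasure lborel ({0..<T} \<inter> {s. orbit s \<in> A}) / ennreal T"
    using T_pos by (subst emeasure_uniform_measure) auto
  finally show ?thesis .
qed

lemma ennreal_T: "ennreal T / ennreal T = 1"
  using T_pos by (simp add: divide_ennreal)

lemma emeasure_fund_dom: "emeasure orbit_measure fund_dom = 1"
  using T_pos by (simp add: emeasure_orbit_measure orbit_def tproj_fund_dom ennreal_T)

lemma prob_space_orbit_measure: "prob_space orbit_measure"
proof
  have "space orbit_measure = UNIV" by (simp add: orbit_measure_def)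
  then show "emeasure orbit_measure (space orbit_measure) = 1"
    using T_pos by (simp add: emeasure_orbit_measure ennreal_T)
qed

text \<open>The set of times at which the orbit is in a Borel set is periodic, and the flow only
  shifts it, so \<open>emeasure_periodic_shift\<close> applies.\<close>

lemma invariant_orbit_measure: "invariant_prob L orbit_measure"
proof -
  have "distr orbit_measure orbit_measure (tflow L t) = orbit_measure" for t
  proof (rule measure_eqI)
    fix A assume "A \<in> sets (distr orbit_measure orbit_measure (tflow L t))"
    then have A [measurable]: "A \<in> sets borel" by (simp add: sets_orbit_measure)
    have B: "{s. orbit s \<in> A} \<in> sets borel"
      using measurable_sets[OF orbit_measurable A] by (simp add: vimage_def)
    have [measurable]: "tflow L t \<in> measurable orbit_measure orbit_measure"
      using tflow_measurable[of t] by (simp add: measurable_cong_sets[OF sets_orbit_measure sets_orbit_measure])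
    have tA: "{z. tflow L t z \<in> A} \<in> sets borel"
      using measurable_sets[OF tflow_measurable A, of t] by (simp add: vimage_def)
    have "emeasure (distr orbit_measure orbit_measure (tflow L t)) A = emeasure orbit_measure {z. tflow L t z \<in> A}"
      by (subst emeasure_distr) (auto simp: sets_orbit_measure vimage_def orbit_measure_def)
    also have "\<dots> = emeasure lborel ({0..<T} \<inter> {s. s + t \<in> {s. orbit s \<in> A}}) / ennreal T"
      by (simp add: emeasure_orbit_measure[OF tA] tflow_orbit)
    also have "\<dots> = emeasure orbit_measure A"
      unfolding emeasure_orbit_measure[OF A]
      by (subst emeasure_periodic_shift[OF B _ T_pos]) (simp_all add: orbit_period)
    finally show "emeasure (distr orbit_measure orbit_measure (tflow L t)) A = emeasure orbit_measure A" .
  qed simp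
  then show ?thesis
    unfolding invariant_prob_def
    using prob_space_orbit_measure emeasure_fund_dom tflow_measurable sets_orbit_measure by auto
qed

text \<open>The flow acts transitively on the orbit: an invariant set contains all of it or
  none.\<close>

lemma ergodic_orbit_measure: "ergodic L orbit_measure"
  unfolding ergodic_def
proof (intro conjI ballI impI invariant_orbit_measure)
  fix A :: "((real^'n) \<times> (real^'n)) set"
  assume A: "A \<in> sets borel" and inv: "\<forall>t. {z \<in> fund_dom. tflow L t z \<in> A} = A \<inter> fund_dom"
  have fd: "orbit s \<in> fund_dom" for s by (simp add: orbit_def tproj_fund_dom)
  have "orbit s \<in> A \<longleftrightarrow> orbit 0 \<in> A" for s
  proof -
    have "orbit 0 \<in> {z \<in> fund_dom. tflow L s z \<in> A} \<longleftrightarrow> orbit 0 \<in> A \<inter> fund_dom"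
      using inv by simp
    then show ?thesis using fd[of 0] tflow_orbit[of s 0] by simp
  qed
  then have "{s. orbit s \<in> A} = (if orbit 0 \<in> A then UNIV else {})" by auto
  then have "emeasure orbit_measure A = (if orbit 0 \<in> A then 1 else 0)"
    using T_pos by (simp add: emeasure_orbit_measure[OF A] ennreal_T)
  then show "measure orbit_measure A = 0 \<or> measure orbit_measure A = 1"
    by (auto simp: measure_def)
qed

lemma AE_orbit_measure: "(\<And>s. P (orbit s)) \<Longrightarrow> {z. P z} \<in> sets borel \<Longrightarrow> AE z in orbit_measure. P z"
  unfolding orbit_measure_def by (subst AE_distr_iff) auto

text \<open>The velocity is continuous and periodic, hence bounded; together with
  \<open>U \<le> K\<close> this bounds \<open>L\<close> along the orbit.\<close>

lemma admissible_orbit_measure: "admissible L orbit_measure"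
proof -
  interpret prob_space orbit_measure by (rule prob_space_orbit_measure)
  obtain B where B: "\<And>s. norm (\<gamma>' s) \<le> B"
  proof -
    have "bounded (\<gamma>' ` {0..T})"
      by (intro compact_imp_bounded compact_continuous_image continuous_on_subset[OF continuous_velocity]) auto
    then obtain B where "\<forall>x\<in>{0..T}. norm (\<gamma>' x) \<le> B"
      by (auto simp: bounded_iff)
    then have B: "norm (\<gamma>' s) \<le> B" if "0 \<le> s" "s \<le> T" for s
      using that by simp
    have nat: "\<gamma>' (s + real n * T) = \<gamma>' s" for s n
    proof (induction n)
      case (Suc n)
      then show ?case using velocity_period[of "s + real n * T"] by (simp add: algebra_simps)
    qed simp
    have "norm (\<gamma>' s) \<le> B" for s
    proof -
      define m where "m = \<lfloor>s / T\<rfloor>"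
      have "of_int m \<le> s / T" "s / T < of_int m + 1" unfolding m_def by linarith+
      then have "of_int m * T \<le> s" "s < (of_int m + 1) * T"
        using T_pos by (simp_all only: pos_le_divide_eq pos_divide_less_eq)
      then have r: "0 \<le> s - of_int m * T" "s - of_int m * T \<le> T" by (simp_all add: algebra_simps)
      have "\<gamma>' s = \<gamma>' (s - of_int m * T)"
      proof (cases "0 \<le> m")
        case True
        then show ?thesis using nat[of "s - of_int m * T" "nat m"] by simp
      next
        case False
        then show ?thesis using nat[of s "nat (- m)"] by simp
      qed
      then show ?thesis using B[OF r] by simp
    qed
    then show thesis by (rule that)
  qed
  have B0: "0 \<le> B" using B[of 0] norm_ge_zero order_trans by blast
  have "integrable orbit_measure (\<lambda>z. L (fst z) (snd z))"
  proof (rule integrable_const_bound)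
    show "AE z in orbit_measure. norm (L (fst z) (snd z)) \<le> B\<^sup>2 / 2 + K"
    proof (rule AE_orbit_measure)
      fix s
      have "(norm (\<gamma>' s))\<^sup>2 \<le> B\<^sup>2" by (intro power_mono B) simp
      then show "norm (L (fst (orbit s)) (snd (orbit s))) \<le> B\<^sup>2 / 2 + K"
        using U_nonneg[of "tproj (\<gamma> s)"] U_bd[of "tproj (\<gamma> s)"]
        by (simp add: orbit_def L power2_norm_eq_inner)
    qed measurable
  qed (use L_measurable in \<open>simp add: measurable_cong_sets[OF sets_orbit_measure refl]\<close>)
  then show ?thesis unfolding admissible_def using invariant_orbit_measure by simp
qed

lemma displacement: "\<gamma> T - \<gamma> 0 = lattice_vec k"
  using period[of 0] by simp

text \<open>The mean velocity over a period is displacement divided by time, and the displacement is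
  \<open>lattice_vec k\<close>, so \<open>k\<close> is the homology class of the orbit.\<close>

lemma integral_velocity: "(\<integral>z. c \<bullet> snd z \<partial>orbit_measure) = ((1 / T) *\<^sub>R lattice_vec k) \<bullet> c"
proof -
  have [measurable]: "(\<lambda>z :: (real^'n) \<times> (real^'n). c \<bullet> snd z) \<in> borel_measurable borel"
    by (intro borel_measurable_continuous_onI continuous_intros)
  have "(\<integral>z. c \<bullet> snd z \<partial>orbit_measure) = (\<integral>s. c \<bullet> \<gamma>' s \<partial>uniform_measure lborel {0..<T})"
    unfolding orbit_measure_def by (subst integral_distr) (auto simp: orbit_def)
  also have "\<dots> = (c \<bullet> \<gamma> T - c \<bullet> \<gamma> 0) / T"
  proof (rule integral_uniform_interval[OF T_pos])
    show "((\<lambda>s. c \<bullet> \<gamma> s) has_real_derivative c \<bullet> \<gamma>' s) (at s)" for s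
      using has_derivative_inner_right[OF deriv[of s, unfolded has_vector_derivative_def], of c]
      unfolding has_field_derivative_def by (rule has_derivative_eq_rhs) (simp add: fun_eq_iff)
    show "continuous_on UNIV (\<lambda>s. c \<bullet> \<gamma>' s)"
      by (intro continuous_intros continuous_velocity)
  qed
  also have "\<dots> = ((1 / T) *\<^sub>R lattice_vec k) \<bullet> c"
    unfolding displacement[symmetric] by (simp add: inner_diff_left inner_diff_right inner_commute[of _ c])
  finally show ?thesis .
qed

lemma rotation_vector_orbit_measure: "rotation_vector orbit_measure = (1 / T) *\<^sub>R lattice_vec k"
  unfolding rotation_vector_def
  by (rule the_equality) (metis integral_velocity vector_eq_rdot inner_commute)+

text \<open>Along the orbit the velocity equals the momentum \<open>c + Df\<close> and the
  Hamilton--Jacobi equation holds with equality, so both terms of \<open>square_completion\<close>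
  vanish.\<close>

lemma calibrated_action:
  assumes f: "\<And>x. (f has_derivative (\<lambda>h. Df x \<bullet> h)) (at x)"
    and per: "\<And>x k. f (x + lattice_vec k) = f x"
    and bd: "\<And>x. \<bar>f x\<bar> \<le> M" "\<And>x. norm (Df x) \<le> M"
    and Df: "continuous_on UNIV Df" "\<And>x k. Df (x + lattice_vec k) = Df x"
    and calib: "\<And>s. \<gamma>' s = c + Df (\<gamma> s)" "\<And>s. U (\<gamma> s) = (norm (c + Df (\<gamma> s)))\<^sup>2 / 2"
  shows "action L c orbit_measure = 0"
proof -
  have "continuous_on UNIV (\<lambda>z :: (real^'n) \<times> (real^'n). (c + Df (fst z)) \<bullet> snd z)"
    by (intro continuous_intros continuous_on_compose2[OF Df(1) continuous_on_fst[OF continuous_on_id]]) auto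
  then have meas: "(\<lambda>z. L (fst z) (snd z) - (c + Df (fst z)) \<bullet> snd z) \<in> borel_measurable borel"
    by (intro borel_measurable_diff L_measurable borel_measurable_continuous_onI)
  have "(\<integral>z. L (fst z) (snd z) - (c + Df (fst z)) \<bullet> snd z \<partial>orbit_measure) = (\<integral>z. 0 \<partial>orbit_measure)"
  proof (rule integral_cong_AE)
    show "AE z in orbit_measure. L (fst z) (snd z) - (c + Df (fst z)) \<bullet> snd z = 0"
    proof (rule AE_orbit_measure)
      fix s
      have "Df (tproj (\<gamma> s)) = Df (\<gamma> s)" "U (tproj (\<gamma> s)) = U (\<gamma> s)"
        by (simp_all add: tproj_lattice Df(2) U_per)
      then show "L (fst (orbit s)) (snd (orbit s)) - (c + Df (fst (orbit s))) \<bullet> snd (orbit s) = 0"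
        using calib(1)[of s] calib(2)[of s] by (simp add: orbit_def square_completion)
    next
      show "{z. L (fst z) (snd z) - (c + Df (fst z)) \<bullet> snd z = 0} \<in> sets borel"
        using borel_measurable_eq[OF meas borel_measurable_const[of 0]] by simp
    qed
  qed (use meas in \<open>simp_all add: measurable_cong_sets[OF sets_orbit_measure refl]\<close>)
  then show ?thesis
    using action_twisted[OF admissible_orbit_measure f per bd, of c] by simp
qed

end

section \<open>Pendulum channels\<close>

lemma periodic_int:
  fixes f :: "real \<Rightarrow> 'a"
  assumes "\<And>x. f (x + 2 * pi) = f x"
  shows "f (x + 2 * pi * of_int m) = f x"
proof -
  have nat: "f (x + 2 * pi * real n) = f x" for x n
  proof (induction n)
    case (Suc n)
    then show ?case using assms[of "x + 2 * pi * real n"] by (simp add: algebra_simps)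
  qed simp
  show ?thesis
  proof (cases "0 \<le> m")
    case True
    then show ?thesis using nat[of x "nat m"] by simp
  next
    case False
    then show ?thesis using nat[of "x + 2 * pi * of_int m" "nat (- m)"] by simp
  qed
qed

lemma has_zero_derivative_imp_constant:
  fixes f :: "real \<Rightarrow> real"
  assumes "\<And>x. (f has_real_derivative 0) (at x)"
  shows "f x = f y"
  using has_field_derivative_zero_constant[of UNIV f] assms by auto

text \<open>The increment over a period has derivative zero, hence is constant, and the mean-zero
  condition makes it vanish at the origin.\<close>

lemma periodic_antiderivative:
  fixes \<phi> :: "real \<Rightarrow> real"
  assumes cont: "continuous_on UNIV \<phi>" and per: "\<And>x. \<phi> (x + 2 * pi) = \<phi> x"
    and mean: "integral {0..2 * pi} \<phi> = 0"
  obtains w where "\<And>x. (w has_real_derivative \<phi> x) (at x)" "\<And>x. w (x + 2 * pi) = w x"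
proof -
  obtain w where w: "\<And>x. (w has_vector_derivative \<phi> x) (at x)"
    using continuous_has_antiderivative[OF cont] by blast
  then have w': "(w has_real_derivative \<phi> x) (at x)" for x
    by (simp add: has_real_derivative_iff_has_vector_derivative)
  have "(\<phi> has_integral w (2 * pi) - w 0) {0..2 * pi}"
    by (rule fundamental_theorem_of_calculus) (auto intro: has_vector_derivative_at_within w)
  then have "w (2 * pi) = w 0" using mean by (simp add: integral_unique)
  moreover have "w (x + 2 * pi) - w x = w (0 + 2 * pi) - w 0" for x
  proof (rule has_zero_derivative_imp_constant[of "\<lambda>x. w (x + 2 * pi) - w x"])
    show "((\<lambda>x. w (x + 2 * pi) - w x) has_real_derivative 0) (at x)" for x
      using DERIV_diff[OF DERIV_shift[THEN iffD1, OF w'[of "x + 2 * pi"]] w'[of x]] by (simp add: per)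
  qed
  ultimately have "w (x + 2 * pi) = w x" for x
    by (metis add_0 diff_add_cancel diff_self)
  then show thesis using that w' by blast
qed

text \<open>The travel time \<open>\<Theta>\<close> is a primitive of \<open>1 / p\<close> and
  satisfies \<open>\<Theta> (X t) = t\<close>. It grows by the full integral over each turn, and as
  it is strictly increasing this relation of times becomes the asserted one of positions.\<close>

lemma circle_flow:
  fixes p :: "real \<Rightarrow> real"
  assumes p: "\<And>x. (p has_real_derivative p' x) (at x)" and bd: "\<And>x. \<bar>p' x\<bar> \<le> C"
    and pos: "\<And>x. 0 < p x" and per: "\<And>x. p (x + 2 * pi) = p x"
  obtains X where "\<And>t. (X has_real_derivative p (X t)) (at t)"
    "\<And>t. X (t + integral {0..2 * pi} (\<lambda>x. 1 / p x)) = X t + 2 * pi"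
proof -
  let ?T = "integral {0..2 * pi} (\<lambda>x. 1 / p x)"
  have C: "0 \<le> C" using bd[of 0] by linarith
  \<comment> \<open>The 1 is added because \<open>lipschitz_ode_exists\<close> asks for a positive
    constant and \<open>C\<close> may be 0.\<close>
  have lip: "norm (p x - p y) \<le> (C + 1) * norm (x - y)" for x y
  proof -
    have "norm (p x - p y) \<le> C * norm (x - y)"
      by (rule field_differentiable_bound[of UNIV p p'])
         (auto intro: has_field_derivative_at_within p simp: bd)
    then show ?thesis by (simp add: algebra_simps)
  qed
  obtain X where X0: "X 0 = 0" and X: "\<And>t. (X has_vector_derivative p (X t)) (at t)"
    using lipschitz_ode_exists[of p "C + 1" 0] lip C by auto
  then have X': "(X has_real_derivative p (X t)) (at t)" for t
    by (simp add: has_real_derivative_iff_has_vector_derivative)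
  have "continuous_on UNIV p"
    using p by (meson DERIV_isCont continuous_at_imp_continuous_on)
  then have cont: "continuous_on UNIV (\<lambda>x. 1 / p x)"
    by (intro continuous_intros) (use pos in \<open>auto, metis less_irrefl\<close>)
  obtain \<Theta> where \<Theta>0: "\<Theta> 0 = 0" and \<Theta>: "\<And>x. (\<Theta> has_vector_derivative 1 / p x) (at x)"
    using continuous_has_antiderivative[OF cont] by blast
  then have \<Theta>': "(\<Theta> has_real_derivative 1 / p x) (at x)" for x
    by (simp add: has_real_derivative_iff_has_vector_derivative)
  have inj: "\<Theta> x < \<Theta> y" if "x < y" for x y
    using that \<Theta>' pos by (intro DERIV_pos_imp_increasing[OF that]) (metis zero_less_divide_1_iff)
  have time: "\<Theta> (X t) = t" for t
  proof -
    have "\<Theta> (X t) - t = \<Theta> (X 0) - 0"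
    proof (rule has_zero_derivative_imp_constant[of "\<lambda>t. \<Theta> (X t) - t"])
      show "((\<lambda>t. \<Theta> (X t) - t) has_real_derivative 0) (at t)" for t
        using DERIV_diff[OF DERIV_chain2[OF \<Theta>' X'] DERIV_ident, of t] less_imp_neq[OF pos[of "X t"]] by simp
    qed
    then show ?thesis by (simp add: X0 \<Theta>0)
  qed
  have "((\<lambda>x. 1 / p x) has_integral \<Theta> (2 * pi) - \<Theta> 0) {0..2 * pi}"
    by (rule fundamental_theorem_of_calculus) (auto intro: has_vector_derivative_at_within \<Theta>)
  then have T: "?T = \<Theta> (2 * pi)" by (simp add: integral_unique \<Theta>0)
  have "\<Theta> (x + 2 * pi) - \<Theta> x = \<Theta> (0 + 2 * pi) - \<Theta> 0" for x
  proof (rule has_zero_derivative_imp_constant[of "\<lambda>x. \<Theta> (x + 2 * pi) - \<Theta> x"])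
    show "((\<lambda>x. \<Theta> (x + 2 * pi) - \<Theta> x) has_real_derivative 0) (at x)" for x
      using DERIV_diff[OF DERIV_shift[THEN iffD1, OF \<Theta>'[of "x + 2 * pi"]] \<Theta>'[of x]] by (simp add: per)
  qed
  then have shift: "\<Theta> (x + 2 * pi) = \<Theta> x + ?T" for x
    using T \<Theta>0 by (simp add: algebra_simps)
  have "\<Theta> (X (t + ?T)) = \<Theta> (X t + 2 * pi)" for t
    by (simp add: shift time)
  then have "X (t + ?T) = X t + 2 * pi" for t
    using inj by (metis less_irrefl linorder_less_linear)
  then show thesis using that X' by blast
qed

text \<open>Momentum of a rotating pendulum orbit before its mean is normalised; \<open>s\<close> is
  the ratio of the oscillating to the constant coefficient.\<close>

definition pend :: "real \<Rightarrow> real \<Rightarrow> real" where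
  "pend s x = sqrt (1 + s * (1 - cos x))"

definition pend_mean :: "real \<Rightarrow> real" where
  "pend_mean s = integral {0..2 * pi} (pend s) / (2 * pi)"

text \<open>Dividing the momentum by its mean multiplies the travel time of a turn by the same mean.
  The result is 2 \<pi> times the mean of \<open>pend s\<close> times the mean of its reciprocal,
  which is why the Cauchy--Schwarz inequality governs it.\<close>

definition pend_period :: "real \<Rightarrow> real" where
  "pend_period s = pend_mean s * integral {0..2 * pi} (\<lambda>x. 1 / pend s x)"

lemma pend_ge_1: "0 \<le> s \<Longrightarrow> 1 \<le> pend s x"
  by (simp add: pend_def)

lemma pend_neq_0: "0 \<le> s \<Longrightarrow> pend s x \<noteq> 0"
  using pend_ge_1[of s x] by linarith

lemma pend_sq: "0 \<le> s \<Longrightarrow> (pend s x)\<^sup>2 = 1 + s * (1 - cos x)"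
  by (simp add: pend_def add_nonneg_nonneg)

lemma continuous_pend2: "continuous_on S (\<lambda>(s, x). pend s x)"
  unfolding pend_def case_prod_unfold by (intro continuous_intros)

lemma continuous_pend: "continuous_on S (pend s)"
  unfolding pend_def[abs_def] by (intro continuous_intros)

lemma pend_integrable: "pend s integrable_on {0..2 * pi}"
  by (rule integrable_continuous_real) (rule continuous_pend)

lemma continuous_inverse_pend: "0 \<le> s \<Longrightarrow> continuous_on S (\<lambda>x. 1 / pend s x)"
  by (intro continuous_intros continuous_pend) (auto simp: pend_neq_0)

lemma pend_mean_ge_1:
  assumes "0 \<le> s"
  shows "1 \<le> pend_mean s"
proof -
  have "integral {0..2 * pi} (\<lambda>x. 1) \<le> integral {0..2 * pi} (pend s)"
    by (rule integral_le) (use pend_ge_1[OF assms] pend_integrable in auto)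
  then show ?thesis by (simp add: pend_mean_def field_simps)
qed

lemma continuous_pend_period: "continuous_on {0..1} pend_period"
proof -
  have "continuous_on {0..1} (\<lambda>s. integral (cbox 0 (2 * pi)) (pend s))"
    by (rule integral_continuous_on_param) (rule continuous_pend2)
  moreover have "continuous_on {0..1} (\<lambda>s. integral (cbox 0 (2 * pi)) (\<lambda>x. 1 / pend s x))"
  proof (rule integral_continuous_on_param)
    show "continuous_on ({0..1} \<times> cbox 0 (2 * pi)) (\<lambda>(s, x). 1 / pend s x)"
      unfolding case_prod_unfold
      by (intro continuous_intros continuous_pend2[unfolded case_prod_unfold]) (auto simp: pend_neq_0)
  qed
  ultimately show ?thesis
    unfolding pend_period_def[abs_def] pend_mean_def by (intro continuous_intros) auto
qed

lemma pend_period_0: "pend_period 0 = 2 * pi"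
proof -
  have "pend 0 = (\<lambda>x. 1)" by (simp add: pend_def fun_eq_iff)
  then show ?thesis by (simp add: pend_period_def pend_mean_def)
qed

text \<open>The strict Cauchy--Schwarz inequality between the means of \<open>pend 1\<close> and of its reciprocal.\<close>

lemma pend_period_1: "2 * pi < pend_period 1"
proof (rule ccontr)
  assume small: "\<not> 2 * pi < pend_period 1"
  let ?q = "pend 1" and ?M = "pend_mean 1"
  \<comment> \<open>Its integral is \<open>?M * (pend_period 1 - 2 * pi)\<close>. Were that not
    positive, this nonnegative function would vanish on the whole period and \<open>pend 1\<close>
    would be constant there, contrary to its values at 0 and \<open>pi\<close>.\<close>
  let ?h = "\<lambda>x. (?q x - ?M)\<^sup>2 / ?q x"
  have q1: "1 \<le> ?q x" for x by (simp add: pend_ge_1)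
  then have q0: "0 < ?q x" "?q x \<noteq> 0" for x by (smt (verit))+
  have cont: "continuous_on {0..2 * pi} ?h"
    by (intro continuous_intros continuous_pend) (use q0 in auto)
  have h0: "0 \<le> ?h x" for x using q0(1)[of x] by simp
  have inv: "(\<lambda>x. 1 / ?q x) integrable_on {0..2 * pi}"
    by (rule integrable_continuous_real) (rule continuous_inverse_pend, simp)
  have "?h = (\<lambda>x. ?q x - 2 * ?M + ?M\<^sup>2 * (1 / ?q x))"
    using q0 by (auto simp: fun_eq_iff power2_eq_square field_simps)
  then have "integral {0..2 * pi} ?h = integral {0..2 * pi} (\<lambda>x. ?q x - 2 * ?M + ?M\<^sup>2 * (1 / ?q x))"
    by simp
  also have "\<dots> = integral {0..2 * pi} ?q - 2 * ?M * (2 * pi) + ?M\<^sup>2 * integral {0..2 * pi} (\<lambda>x. 1 / ?q x)"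
    using has_integral_add[OF has_integral_diff[OF integrable_integral[OF pend_integrable[of 1]]
          has_integral_const_real[of "2 * ?M" 0 "2 * pi"]] has_integral_mult_right[OF integrable_integral[OF inv], of "?M\<^sup>2"]]
    by (intro integral_unique) (simp add: mult.commute)
  also have "\<dots> = ?M * (pend_period 1 - 2 * pi)"
    by (simp add: pend_period_def pend_mean_def power2_eq_square field_simps)
  also have "\<dots> \<le> 0"
    using small pend_mean_ge_1[of 1] by (intro mult_nonneg_nonpos) auto
  finally have "integral {0..2 * pi} ?h \<le> 0" .
  moreover have "0 \<le> integral {0..2 * pi} ?h"
    using h0 by (intro integral_nonneg integrable_continuous_real cont)
  ultimately have "integral {0..2 * pi} ?h = 0" by simp
  then have "\<forall>x\<in>{0..2 * pi}. ?h x = 0"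
    using integral_eq_0_iff[OF cont] h0 by simp
  then have "?h 0 = 0" "?h pi = 0" by auto
  then have "?q 0 = ?q pi" using q0[of 0] q0[of pi] by simp
  then show False by (simp add: pend_def)
qed

text \<open>\<open>X\<close> runs through a pendulum of potential \<open>- (A + B (1 - cos x)) / 2\<close> at energy zero with momentum
  \<open>p\<close> of mean 1, and \<open>w\<close> is the periodic part of the generating function.\<close>

definition pendulum_channel ::
  "real \<Rightarrow> real \<Rightarrow> real \<Rightarrow> (real \<Rightarrow> real) \<Rightarrow> (real \<Rightarrow> real) \<Rightarrow> (real \<Rightarrow> real) \<Rightarrow> bool" where
  "pendulum_channel s A B p w X \<longleftrightarrow> 0 < A \<and> B = s * A \<and>
     (\<forall>x. (p x)\<^sup>2 = A + B * (1 - cos x)) \<and> (\<forall>x. p (- x) = p x) \<and>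
     continuous_on UNIV p \<and> (\<forall>x. p (x + 2 * pi) = p x) \<and>
     (\<forall>x. (w has_real_derivative p x - 1) (at x)) \<and> (\<forall>x. w (x + 2 * pi) = w x) \<and>
     (\<forall>t. (X has_real_derivative p (X t)) (at t)) \<and>
     (\<forall>t. ((\<lambda>t. p (X t)) has_real_derivative B / 2 * sin (X t)) (at t)) \<and>
     (\<forall>t. X (t + pend_period s) = X t + 2 * pi) \<and> 0 < pend_period s"

text \<open>Normalising by the mean gives \<open>A = 1 / M^2\<close> and \<open>B = s / M^2\<close>,
  writing \<open>M\<close> for \<open>pend_mean s\<close>. The orbit is the flow of \<open>p\<close>
  on the circle, and its acceleration \<open>p' * p\<close> is half the derivative of the square of
  \<open>p\<close>.\<close>

lemma pendulum_channel_exists: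
  assumes s: "0 \<le> s"
  shows "\<exists>A B p w X. pendulum_channel s A B p w X"
proof -
  let ?M = "pend_mean s"
  define p where "p x = pend s x / ?M" for x
  define p' where "p' x = s * sin x / (2 * pend s x) / ?M" for x
  have M: "1 \<le> ?M" by (rule pend_mean_ge_1[OF s])
  have q: "1 \<le> pend s x" for x by (rule pend_ge_1[OF s])
  have p_deriv: "(p has_real_derivative p' x) (at x)" for x
  proof -
    have "0 < 1 + s * (1 - cos x)" using s by (simp add: add_pos_nonneg)
    then have "((\<lambda>x. sqrt (1 + s * (1 - cos x))) has_real_derivative s * sin x / (2 * pend s x)) (at x)"
      unfolding pend_def by (auto intro!: derivative_eq_intros simp: field_simps)
    then have "((\<lambda>x. pend s x / ?M) has_real_derivative s * sin x / (2 * pend s x) / ?M) (at x)"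
      unfolding pend_def[abs_def] by (rule DERIV_cdivide)
    then show ?thesis by (simp add: p_def[abs_def] p'_def)
  qed
  have p_cont: "continuous_on UNIV p"
    using p_deriv by (meson DERIV_isCont continuous_at_imp_continuous_on)
  have p_pos: "0 < p x" for x unfolding p_def using q[of x] M by simp
  have p_per: "p (x + 2 * pi) = p x" for x by (simp add: p_def pend_def)
  have p'_bd: "\<bar>p' x\<bar> \<le> s" for x
  proof -
    have "\<bar>p' x\<bar> = s * \<bar>sin x\<bar> / (2 * pend s x * ?M)"
      unfolding p'_def using s q[of x] M by (simp add: abs_mult)
    also have "\<dots> \<le> s * \<bar>sin x\<bar> / 1"
      using s q[of x] M mult_mono[of 1 "pend s x" 1 ?M] by (intro divide_left_mono) auto
    also have "\<dots> \<le> s" using s by (simp add: mult_left_le)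
    finally show ?thesis .
  qed
  obtain X where X: "\<And>t. (X has_real_derivative p (X t)) (at t)"
    and X_per: "\<And>t. X (t + integral {0..2 * pi} (\<lambda>x. 1 / p x)) = X t + 2 * pi"
    using circle_flow[OF p_deriv p'_bd p_pos p_per] by blast
  have T: "integral {0..2 * pi} (\<lambda>x. 1 / p x) = pend_period s"
  proof -
    have "(\<lambda>x. 1 / p x) = (\<lambda>x. ?M * (1 / pend s x))" by (simp add: p_def fun_eq_iff)
    then show ?thesis by (simp only: integral_mult_right pend_period_def)
  qed
  have T_pos: "0 < pend_period s"
  proof -
    have "0 \<le> integral {0..2 * pi} (\<lambda>x. 1 / pend s x)"
      using order_trans[OF zero_le_one q]
      by (intro integral_nonneg integrable_continuous_real continuous_inverse_pend[OF s]) simp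
    then have "0 \<le> pend_period s" using M by (simp add: pend_period_def)
    moreover have "pend_period s \<noteq> 0" using X_per[of 0] T by auto
    ultimately show ?thesis by simp
  qed
  have pX: "((\<lambda>t. p (X t)) has_real_derivative s * (1 / ?M\<^sup>2) / 2 * sin (X t)) (at t)" for t
  proof -
    have "p' x * p x = s * (1 / ?M\<^sup>2) / 2 * sin x" for x
      using q[of x] M by (simp add: p'_def p_def power2_eq_square)
    then show ?thesis using DERIV_chain2[OF p_deriv X, of t] by simp
  qed
  have mean: "integral {0..2 * pi} (\<lambda>x. p x - 1) = 0"
  proof -
    have "integral {0..2 * pi} (\<lambda>x. p x - 1) = integral {0..2 * pi} (\<lambda>x. pend s x / ?M) - integral {0..2 * pi} (\<lambda>x. 1)"
      unfolding p_def using integrable_on_mult_left[OF pend_integrable, of s "1 / ?M"]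
      by (intro integral_diff) auto
    also have "\<dots> = integral {0..2 * pi} (pend s) / ?M - 2 * pi" by simp
    also have "integral {0..2 * pi} (pend s) = ?M * (2 * pi)" by (simp add: pend_mean_def)
    also have "\<dots> / ?M - 2 * pi = 0" using M by simp
    finally show ?thesis .
  qed
  have "continuous_on UNIV (\<lambda>x. p x - 1)" by (intro continuous_intros p_cont)
  from periodic_antiderivative[OF this _ mean]
  obtain w where w: "\<And>x. (w has_real_derivative p x - 1) (at x)" "\<And>x. w (x + 2 * pi) = w x"
    using p_per by metis
  have p_sq: "(p x)\<^sup>2 = 1 / ?M\<^sup>2 + s * (1 / ?M\<^sup>2) * (1 - cos x)" for x
    by (simp add: p_def power_divide pend_sq[OF s] add_divide_distrib)
  have "p (- x) = p x" for x by (simp add: p_def pend_def)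
  then have "pendulum_channel s (1 / ?M\<^sup>2) (s * (1 / ?M\<^sup>2)) p w X"
    unfolding pendulum_channel_def using M X_per T p_sq p_cont p_per w X pX T_pos by auto
  then show ?thesis by blast
qed

section \<open>Potentials depending on one coordinate\<close>

text \<open>A class of smooth periodic functions that contains the quotients needed for a partition
  of unity. It is closed under differentiation, the derivative of a shifted cosine being another
  shifted cosine, so smoothness follows by iteration.\<close>

inductive trig_rational :: "(real \<Rightarrow> real) \<Rightarrow> bool" where
  const: "trig_rational (\<lambda>y. c)"
| cos_shift: "trig_rational (\<lambda>y. cos (y + b))"
| add: "trig_rational f \<Longrightarrow> trig_rational g \<Longrightarrow> trig_rational (\<lambda>y. f y + g y)"
| mult: "trig_rational f \<Longrightarrow> trig_rational g \<Longrightarrow> trig_rational (\<lambda>y. f y * g y)"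
| inverse: "trig_rational f \<Longrightarrow> (\<And>y. f y \<noteq> 0) \<Longrightarrow> trig_rational (\<lambda>y. inverse (f y))"

lemma trig_rational_sum: "(\<And>i. i \<in> I \<Longrightarrow> trig_rational (f i)) \<Longrightarrow> trig_rational (\<lambda>y. \<Sum>i\<in>I. f i y)"
  by (induction I rule: infinite_finite_induct) (auto intro: trig_rational.intros)

lemma trig_rational_prod: "(\<And>i. i \<in> I \<Longrightarrow> trig_rational (f i)) \<Longrightarrow> trig_rational (\<lambda>y. \<Prod>i\<in>I. f i y)"
  by (induction I rule: infinite_finite_induct) (auto intro: trig_rational.intros)

lemma trig_rational_diff: "trig_rational f \<Longrightarrow> trig_rational g \<Longrightarrow> trig_rational (\<lambda>y. f y - g y)"
  using trig_rational.add[OF _ trig_rational.mult[OF trig_rational.const[of "-1"]], of f g] by simp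

lemma trig_rational_cos: "trig_rational cos"
  using trig_rational.cos_shift[of 0] by simp

lemma trig_rational_sin: "trig_rational sin"
proof -
  have "sin = (\<lambda>y. cos (y + - (pi / 2)))" by (simp add: fun_eq_iff cos_diff)
  then show ?thesis by (metis trig_rational.cos_shift)
qed

lemma trig_rational_deriv:
  assumes "trig_rational f"
  obtains f' where "trig_rational f'" "\<And>x. (f has_real_derivative f' x) (at x)"
proof -
  have "\<exists>f'. trig_rational f' \<and> (\<forall>x. (f has_real_derivative f' x) (at x))"
    using assms
  proof induction
    case (const c)
    show ?case by (intro exI[of _ "\<lambda>_. 0"]) (auto intro: trig_rational.const)
  next
    case (cos_shift b)
    have "cos (x + (b + pi / 2)) = - sin (x + b)" for x
      by (simp add: cos_add sin_add flip: add.assoc)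
    then have "((\<lambda>y. cos (y + b)) has_real_derivative cos (x + (b + pi / 2))) (at x)" for x
      by (auto intro!: derivative_eq_intros)
    then show ?case using trig_rational.cos_shift by blast
  next
    case (add f g)
    then show ?case by (blast intro: trig_rational.add DERIV_add)
  next
    case (mult f g)
    then obtain f' g' where *: "trig_rational f'" "\<And>x. (f has_real_derivative f' x) (at x)"
      "trig_rational g'" "\<And>x. (g has_real_derivative g' x) (at x)" by blast
    have "((\<lambda>y. f y * g y) has_real_derivative f' x * g x + g' x * f x) (at x)" for x
      by (rule DERIV_mult[OF *(2) *(4)])
    moreover have "trig_rational (\<lambda>x. f' x * g x + g' x * f x)"
      by (intro trig_rational.add trig_rational.mult * mult)
    ultimately show ?case by blast
  next
    case (inverse f)
    then obtain f' where *: "trig_rational f'" "\<And>x. (f has_real_derivative f' x) (at x)" by blast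
    have "((\<lambda>y. inverse (f y)) has_real_derivative (-1) * (f' x * (inverse (f x) * inverse (f x)))) (at x)" for x
      using DERIV_inverse_fun[OF *(2) inverse(2), of x] by (simp add: power2_eq_square)
    moreover have "trig_rational (\<lambda>x. (-1) * (f' x * (inverse (f x) * inverse (f x))))"
      by (intro trig_rational.mult trig_rational.const * trig_rational.inverse inverse)
    ultimately show ?case by blast
  qed
  then show thesis using that by blast
qed

lemma trig_rational_smooth1: "trig_rational u \<Longrightarrow> smooth1 u"
proof -
  assume u: "trig_rational u"
  have "trig_rational ((deriv ^^ k) u)" for k
  proof (induction k)
    case (Suc k)
    then obtain f' where f': "trig_rational f'" "\<And>x. ((deriv ^^ k) u has_real_derivative f' x) (at x)"
      using trig_rational_deriv by blast
    then have "(deriv ^^ Suc k) u = f'"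
      by (simp add: fun_eq_iff DERIV_imp_deriv)
    then show ?case using f' by simp
  qed (simp add: u)
  then show ?thesis
    unfolding smooth1_def by (meson trig_rational_deriv real_differentiable_def)
qed

lemma trig_rational_periodic: "trig_rational u \<Longrightarrow> u (x + 2 * pi * of_int m) = u x"
proof (induction rule: trig_rational.induct)
  case (cos_shift b)
  have "cos ((y + b) + 2 * pi) = cos (y + b)" for y by simp
  then show ?case
    by (intro periodic_int[of "\<lambda>y. cos (y + b)"]) (metis add.commute add.left_commute)
qed simp_all

lemma trig_rational_periodic1: "trig_rational u \<Longrightarrow> periodic1 u"
  unfolding periodic1_def using trig_rational_periodic[of u _ 1] by simp

lemma trig_rational_continuous: "trig_rational u \<Longrightarrow> continuous_on UNIV u"
  by (meson trig_rational_deriv DERIV_isCont continuous_at_imp_continuous_on)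

lemma lattice_periodic_bounded:
  fixes h :: "real^'n::finite \<Rightarrow> 'b::real_normed_vector"
  assumes cont: "continuous_on UNIV h" and per: "\<And>x k. h (x + lattice_vec k) = h x"
  obtains M where "\<And>x. norm (h x) \<le> M"
proof -
  let ?Q = "cbox 0 (\<chi> i. 2 * pi) :: (real^'n) set"
  have "compact (h ` ?Q)"
    by (intro compact_continuous_image continuous_on_subset[OF cont]) auto
  then obtain M where M: "\<And>x. x \<in> ?Q \<Longrightarrow> norm (h x) \<le> M"
    by (meson bounded_iff compact_imp_bounded imageI)
  have "norm (h x) \<le> M" for x
  proof -
    have "tproj x \<in> ?Q"
      using tproj_fund_dom[of x undefined] by (auto simp: fund_dom_def mem_box_cart less_imp_le)
    then show ?thesis using M[of "tproj x"] by (simp add: tproj_lattice per)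
  qed
  then show thesis by (rule that)
qed

lemma periodic_bounded:
  fixes u :: "real \<Rightarrow> real"
  assumes cont: "continuous_on UNIV u" and per: "\<And>x. u (x + 2 * pi) = u x"
  obtains M where "\<And>x. \<bar>u x\<bar> \<le> M"
proof -
  have "continuous_on UNIV (\<lambda>x :: real^1. u (x $ 1))"
    by (rule continuous_on_compose2[OF cont]) (auto intro!: continuous_intros)
  moreover have "u ((x + lattice_vec k) $ 1) = u (x $ 1)" for x :: "real^1" and k
    by (simp add: lattice_vec_def periodic_int[of u, OF per])
  ultimately obtain M where "\<And>x :: real^1. norm (u (x $ 1)) \<le> M"
    using lattice_periodic_bounded[of "\<lambda>x :: real^1. u (x $ 1)"] by blast
  then have "\<bar>u y\<bar> \<le> M" for y
    by (metis real_norm_def vec_component)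
  then show thesis by (rule that)
qed

lemma trig_rational_bounded:
  assumes u: "trig_rational u"
  obtains M where "\<And>x. \<bar>u x\<bar> \<le> M"
  using periodic_bounded[OF trig_rational_continuous[OF u]] trig_rational_periodic[OF u, of _ 1] by auto

text \<open>Boundedness is part of the notion because it makes products of such functions Lipschitz
  again.\<close>

definition bounded_lipschitz :: "('a::real_normed_vector \<Rightarrow> real) \<Rightarrow> bool" where
  "bounded_lipschitz f \<longleftrightarrow> (\<exists>C. \<forall>x y. \<bar>f x\<bar> \<le> C \<and> \<bar>f x - f y\<bar> \<le> C * norm (x - y))"

lemma bounded_lipschitzE:
  assumes "bounded_lipschitz f"
  obtains C where "0 \<le> C" "\<And>x. \<bar>f x\<bar> \<le> C" "\<And>x y. \<bar>f x - f y\<bar> \<le> C * norm (x - y)"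
  using assms unfolding bounded_lipschitz_def by (metis abs_ge_zero order_trans)

lemma bounded_lipschitz_const: "bounded_lipschitz (\<lambda>x. c)"
  unfolding bounded_lipschitz_def by (intro exI[of _ "\<bar>c\<bar>"]) simp

lemma bounded_lipschitz_add:
  assumes "bounded_lipschitz f" "bounded_lipschitz g"
  shows "bounded_lipschitz (\<lambda>x. f x + g x)"
proof -
  obtain C D where C: "\<And>x. \<bar>f x\<bar> \<le> C" "\<And>x y. \<bar>f x - f y\<bar> \<le> C * norm (x - y)"
    and D: "\<And>x. \<bar>g x\<bar> \<le> D" "\<And>x y. \<bar>g x - g y\<bar> \<le> D * norm (x - y)"
    using assms by (meson bounded_lipschitzE)
  have "\<bar>f x + g x\<bar> \<le> C + D" for x using C(1)[of x] D(1)[of x] by linarith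
  moreover have "\<bar>f x + g x - (f y + g y)\<bar> \<le> (C + D) * norm (x - y)" for x y
    using C(2)[of x y] D(2)[of x y] unfolding distrib_right by linarith
  ultimately show ?thesis unfolding bounded_lipschitz_def by blast
qed

lemma bounded_lipschitz_mult:
  assumes "bounded_lipschitz f" "bounded_lipschitz g"
  shows "bounded_lipschitz (\<lambda>x. f x * g x)"
proof -
  obtain C where C: "0 \<le> C" "\<And>x. \<bar>f x\<bar> \<le> C" "\<And>x y. \<bar>f x - f y\<bar> \<le> C * norm (x - y)"
    using assms(1) by (meson bounded_lipschitzE)
  obtain D where D: "0 \<le> D" "\<And>x. \<bar>g x\<bar> \<le> D" "\<And>x y. \<bar>g x - g y\<bar> \<le> D * norm (x - y)"
    using assms(2) by (meson bounded_lipschitzE)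
  have "\<bar>f x * g x\<bar> \<le> 2 * (C * D)" for x
  proof -
    have "\<bar>f x * g x\<bar> \<le> C * D" unfolding abs_mult by (intro mult_mono C D) auto
    moreover have "0 \<le> C * D" using C D by simp
    ultimately show ?thesis by linarith
  qed
  moreover have "\<bar>f x * g x - f y * g y\<bar> \<le> 2 * (C * D) * norm (x - y)" for x y
  proof -
    have "f x * g x - f y * g y = f x * (g x - g y) + (f x - f y) * g y" by (simp add: algebra_simps)
    then have "\<bar>f x * g x - f y * g y\<bar> \<le> \<bar>f x\<bar> * \<bar>g x - g y\<bar> + \<bar>f x - f y\<bar> * \<bar>g y\<bar>"
      by (metis abs_mult abs_triangle_ineq)
    also have "\<dots> \<le> C * (D * norm (x - y)) + (C * norm (x - y)) * D"
      using C D by (intro add_mono mult_mono) auto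
    finally show ?thesis by (simp add: algebra_simps)
  qed
  ultimately show ?thesis unfolding bounded_lipschitz_def by blast
qed

lemma bounded_lipschitz_sum:
  "(\<And>i. i \<in> I \<Longrightarrow> bounded_lipschitz (f i)) \<Longrightarrow> bounded_lipschitz (\<lambda>x. \<Sum>i\<in>I. f i x)"
proof (induction I rule: infinite_finite_induct)
  case (insert i I)
  have "bounded_lipschitz (\<lambda>x. f i x + (\<Sum>i\<in>I. f i x))"
    by (rule bounded_lipschitz_add) (use insert in auto)
  then show ?case using insert.hyps by simp
qed (simp_all add: bounded_lipschitz_const)

lemma bounded_lipschitz_coord:
  assumes u: "trig_rational u"
  shows "bounded_lipschitz (\<lambda>x :: real^'n::finite. u (x $ i))"
proof -
  obtain u' where u': "trig_rational u'" "\<And>x. (u has_real_derivative u' x) (at x)"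
    using trig_rational_deriv[OF u] by blast
  obtain M where M: "\<And>x. \<bar>u x\<bar> \<le> M" using trig_rational_bounded[OF u] by blast
  obtain M' where M': "\<And>x. \<bar>u' x\<bar> \<le> M'" using trig_rational_bounded[OF u'(1)] by blast
  have "\<bar>u (x $ i) - u (y $ i)\<bar> \<le> max M M' * norm (x - y)" for x y :: "real^'n"
  proof -
    have "norm (u (x $ i) - u (y $ i)) \<le> M' * norm (x $ i - y $ i)"
      by (rule field_differentiable_bound[of UNIV u u'])
         (auto intro: has_field_derivative_at_within u' simp: M')
    also have "\<dots> \<le> max M M' * norm (x - y)"
      using component_le_norm_cart[of "x - y" i] M'[of 0] by (intro mult_mono) auto
    finally show ?thesis by simp
  qed
  then show ?thesis
    unfolding bounded_lipschitz_def using M by (intro exI[of _ "max M M'"]) (auto simp: le_max_iff_disj)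
qed

lemma smoothn_const: "smoothn (\<lambda>x :: real^'n::finite. c)"
  unfolding smoothn_def
proof
  fix "is" :: "'n list"
  have "\<exists>c'. fold partial is (\<lambda>x :: real^'n. c) = (\<lambda>x. c')"
  proof (induction "is" arbitrary: c)
    case (Cons i "is")
    have "partial i (\<lambda>x :: real^'n. c) = (\<lambda>x. 0)" by (simp add: partial_def fun_eq_iff)
    then show ?case using Cons[of 0] by simp
  qed auto
  then obtain c' where "fold partial is (\<lambda>x :: real^'n. c) = (\<lambda>x. c')" by blast
  then show "continuous_on UNIV (fold partial is (\<lambda>x :: real^'n. c)) \<and>
      (\<forall>i x. (\<lambda>t. fold partial is (\<lambda>x :: real^'n. c) (x + t *\<^sub>R axis i 1)) differentiable at 0)"
    by simp
qed

lemma diag_metric_const: "0 < c \<Longrightarrow> diag_metric (\<lambda>i x. c)"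
  by (simp add: diag_metric_def smoothn_const periodicn_def)

definition potential :: "(real \<Rightarrow> real) \<Rightarrow> (real \<Rightarrow> real) \<Rightarrow> (real, 'n::{finite,linorder}) vec \<Rightarrow> real" where
  "potential u1 u2 x = u1 (x $ last_idx) + u2 (x $ last_idx) * (\<Sum>i\<in>UNIV - {last_idx}. 1 - cos (x $ i))"

definition force :: "(real \<Rightarrow> real) \<Rightarrow> (real \<Rightarrow> real) \<Rightarrow> (real \<Rightarrow> real) \<Rightarrow> (real, 'n::{finite,linorder}) vec \<Rightarrow> (real, 'n) vec" where
  "force u2 u1' u2' x = (\<chi> i. if i = last_idx
     then u1' (x $ last_idx) + u2' (x $ last_idx) * (\<Sum>i\<in>UNIV - {last_idx}. 1 - cos (x $ i))
     else u2 (x $ last_idx) * sin (x $ i))"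

lemma inner_split_last:
  fixes v w :: "(real, 'n::{finite,linorder}) vec"
  shows "v \<bullet> w = v $ last_idx * w $ last_idx + (\<Sum>i\<in>UNIV - {last_idx}. v $ i * w $ i)"
  unfolding inner_vec_def by (subst sum.remove[of _ last_idx]) auto

lemma has_derivative_coord:
  assumes "(u has_real_derivative u') (at (x $ i))"
  shows "((\<lambda>x. u (x $ i)) has_derivative (\<lambda>h. u' * h $ i)) (at x)"
  using has_derivative_compose[OF bounded_linear_imp_has_derivative[OF bounded_linear_vec_nth] assms[unfolded has_field_derivative_def]]
  by simp

text \<open>The metric 1/2 turns the kinetic part into half the squared Euclidean length. The bounds
  come componentwise from \<open>bounded_lipschitz\<close>, since potential and force are built from
  functions of single coordinates.\<close>

lemma mechanical_potential:
  fixes u1 u2 :: "real \<Rightarrow> real" and U :: "(real, 'n::{finite,linorder}) vec \<Rightarrow> real"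
  defines "U \<equiv> potential u1 u2"
  assumes u: "trig_rational u1" "trig_rational u2" "trig_rational u1'" "trig_rational u2'"
    and d1: "\<And>x. (u1 has_real_derivative u1' x) (at x)" and d2: "\<And>x. (u2 has_real_derivative u2' x) (at x)"
    and nonneg: "\<And>x. 0 \<le> U x" and zero: "u1 0 = 0"
  obtains K where "mechanical U (force u2 u1' u2') K (mech_lag (\<lambda>i x. 1 / 2) u1 u2)"
proof -
  let ?G = "force u2 u1' u2' :: (real, 'n) vec \<Rightarrow> (real, 'n) vec"
  have "bounded_lipschitz (\<lambda>x :: (real, 'n) vec. 1 - cos (x $ i))" for i
    by (rule bounded_lipschitz_coord[of "\<lambda>y. 1 - cos y"])
       (intro trig_rational_diff trig_rational.const trig_rational_cos)
  then have bc: "bounded_lipschitz (\<lambda>x :: (real, 'n) vec. \<Sum>i\<in>UNIV - {last_idx}. 1 - cos (x $ i))"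
    by (rule bounded_lipschitz_sum)
  have "bounded_lipschitz U"
    unfolding U_def potential_def[abs_def] by (intro bounded_lipschitz_add bounded_lipschitz_mult bc bounded_lipschitz_coord u)
  then obtain K0 where K0: "\<And>x. \<bar>U x\<bar> \<le> K0" by (meson bounded_lipschitzE)
  have "bounded_lipschitz (\<lambda>x. ?G x $ i)" for i
  proof (cases "i = last_idx")
    case True
    then show ?thesis
      unfolding force_def by (simp, intro bounded_lipschitz_add bounded_lipschitz_mult bc bounded_lipschitz_coord u)
  next
    case False
    then show ?thesis
      unfolding force_def by (simp, intro bounded_lipschitz_mult bounded_lipschitz_coord u trig_rational_sin)
  qed
  then have "\<exists>C. 0 \<le> C \<and> (\<forall>x. \<bar>?G x $ i\<bar> \<le> C) \<and> (\<forall>x y. \<bar>?G x $ i - ?G y $ i\<bar> \<le> C * norm (x - y))" for i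
    by (meson bounded_lipschitzE)
  then obtain C where C: "\<And>i. 0 \<le> C i" "\<And>i x. \<bar>?G x $ i\<bar> \<le> C i"
    "\<And>i x y. \<bar>?G x $ i - ?G y $ i\<bar> \<le> C i * norm (x - y)" by metis
  \<comment> \<open>The sum of the componentwise constants bounds the norm through the l1 norm, the
    maximum takes care of \<open>U\<close>, and the 1 ensures positivity.\<close>
  define K where "K = max K0 (\<Sum>i\<in>UNIV. C i) + 1"
  have K: "K0 \<le> K" "(\<Sum>i\<in>UNIV. C i) \<le> K" "0 < K"
    using sum_nonneg[of UNIV C] C(1) by (auto simp: K_def)
  have "mechanical U ?G K (mech_lag (\<lambda>i x. 1 / 2) u1 u2)"
  proof
    show "mech_lag (\<lambda>i x. 1 / 2) u1 u2 x v = v \<bullet> v / 2 + U x" for x v :: "(real, 'n) vec"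
      by (simp add: mech_lag_def U_def potential_def inner_vec_def power2_eq_square sum_divide_distrib)
    show "(U has_derivative (\<bullet>) (?G x)) (at x)" for x
    proof -
      have s: "((\<lambda>x. \<Sum>i\<in>UNIV - {last_idx}. 1 - cos (x $ i)) has_derivative (\<lambda>h. \<Sum>i\<in>UNIV - {last_idx}. sin (x $ i) * h $ i)) (at x)"
        by (rule has_derivative_sum, rule has_derivative_coord) (auto intro!: derivative_eq_intros)
      show ?thesis
        unfolding U_def potential_def[abs_def]
        by (rule has_derivative_eq_rhs[OF has_derivative_add[OF has_derivative_coord[OF d1] has_derivative_mult[OF has_derivative_coord[OF d2] s]]])
           (simp add: fun_eq_iff inner_split_last force_def sum_distrib_left algebra_simps)
    qed
    show "U (x + lattice_vec k) = U x" for x k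
      by (simp add: U_def potential_def lattice_vec_def trig_rational_periodic[OF u(1)]
          trig_rational_periodic[OF u(2)] trig_rational_periodic[OF trig_rational_cos])
    show "norm (?G x - ?G y) \<le> K * norm (x - y)" for x y
    proof -
      have "norm (?G x - ?G y) \<le> (\<Sum>i\<in>UNIV. \<bar>(?G x - ?G y) $ i\<bar>)" by (rule norm_le_l1_cart)
      also have "\<dots> \<le> (\<Sum>i\<in>UNIV. C i * norm (x - y))" by (rule sum_mono) (simp add: C)
      also have "\<dots> \<le> K * norm (x - y)"
        unfolding sum_distrib_right[symmetric] by (intro mult_right_mono K) simp
      finally show ?thesis .
    qed
    show "norm (?G x) \<le> K" for x
    proof -
      have "norm (?G x) \<le> (\<Sum>i\<in>UNIV. \<bar>?G x $ i\<bar>)" by (rule norm_le_l1_cart)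
      also have "\<dots> \<le> (\<Sum>i\<in>UNIV. C i)" by (rule sum_mono) (simp add: C)
      finally show ?thesis using K by simp
    qed
    show "U x \<le> K" for x using K0[of x] K(1) by linarith
    show "U 0 = 0" by (simp add: U_def potential_def zero)
  qed (use nonneg K in auto)
  then show thesis by (rule that)
qed

section \<open>Separated channels\<close>

lemma has_vector_derivative_vecI:
  fixes f :: "real \<Rightarrow> real^'n::finite"
  assumes "\<And>i. ((\<lambda>t. f t $ i) has_real_derivative f' $ i) (at t)"
  shows "(f has_vector_derivative f') (at t)"
proof -
  have D: "((\<lambda>t. \<Sum>i\<in>UNIV. f t $ i *\<^sub>R (axis i 1 :: real^'n)) has_vector_derivative (\<Sum>i\<in>UNIV. f' $ i *\<^sub>R axis i 1)) (at t)"
    by (intro has_vector_derivative_sum) (use assms in \<open>auto intro!: derivative_eq_intros\<close>)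
  have e: "(\<Sum>i\<in>UNIV. v $ i *\<^sub>R axis i 1) = v" for v :: "real^'n"
    using basis_expansion[of v] by (simp add: scalar_mult_eq_scaleR)
  show ?thesis using D unfolding e .
qed

lemma continuous_coord:
  assumes "continuous_on UNIV u"
  shows "continuous_on UNIV (\<lambda>x :: real^'n::finite. u (x $ i))"
  by (rule continuous_on_compose2[OF assms]) (auto intro!: continuous_intros)

text \<open>Slice 0 holds the fixed point: there \<open>A 0 = 0\<close> and \<open>p 0\<close>
  satisfies the energy relation only as an inequality. The slices with \<open>0 < j\<close> carry
  genuine orbits. Every \<open>p j\<close> has mean 1, which is hidden in the periodicity of
  \<open>w j\<close>, so a single class serves all slices; the periods tell the orbits
  apart.\<close>

locale channels =
  fixes n :: nat and a A B T :: "nat \<Rightarrow> real" and p w X \<theta> \<theta>' \<theta>'' :: "nat \<Rightarrow> real \<Rightarrow> real" and W :: real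
  assumes n: "2 \<le> n"
    and A0: "A 0 = 0" and A_pos: "\<And>j. 0 < j \<Longrightarrow> j < n \<Longrightarrow> 0 < A j" and B_pos: "\<And>j. j < n \<Longrightarrow> 0 < B j"
    and p_sq_le: "\<And>j x. j < n \<Longrightarrow> (p j x)\<^sup>2 \<le> A j + B j * (1 - cos x)"
    and p_sq: "\<And>j x. 0 < j \<Longrightarrow> j < n \<Longrightarrow> (p j x)\<^sup>2 = A j + B j * (1 - cos x)"
    and p_even: "\<And>j x. j < n \<Longrightarrow> p j (- x) = p j x"
    and p_cont: "\<And>j. j < n \<Longrightarrow> continuous_on UNIV (p j)"
    and p_per: "\<And>j x. j < n \<Longrightarrow> p j (x + 2 * pi) = p j x"
    and w: "\<And>j x. j < n \<Longrightarrow> (w j has_real_derivative p j x - 1) (at x)"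
    and w_per: "\<And>j x. j < n \<Longrightarrow> w j (x + 2 * pi) = w j x"
    and w_bd: "\<And>j x. j < n \<Longrightarrow> \<bar>w j x\<bar> \<le> W"
    and X: "\<And>j t. 0 < j \<Longrightarrow> j < n \<Longrightarrow> (X j has_real_derivative p j (X j t)) (at t)"
    and pX: "\<And>j t. 0 < j \<Longrightarrow> j < n \<Longrightarrow> ((\<lambda>t. p j (X j t)) has_real_derivative B j / 2 * sin (X j t)) (at t)"
    and X_per: "\<And>j t. 0 < j \<Longrightarrow> j < n \<Longrightarrow> X j (t + T j) = X j t + 2 * pi"
    and T_pos: "\<And>j. 0 < j \<Longrightarrow> j < n \<Longrightarrow> 0 < T j"
    and T_inj: "inj_on T {0<..<n}"
    and \<theta>_tr: "\<And>j. trig_rational (\<theta> j)" "\<And>j. trig_rational (\<theta>' j)" "\<And>j. trig_rational (\<theta>'' j)"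
    and \<theta>_deriv: "\<And>j y. (\<theta> j has_real_derivative \<theta>' j y) (at y)" "\<And>j y. (\<theta>' j has_real_derivative \<theta>'' j y) (at y)"
    and \<theta>_nonneg: "\<And>j y. j < n \<Longrightarrow> 0 \<le> \<theta> j y"
    and \<theta>_sum: "\<And>y. (\<Sum>j<n. \<theta> j y) = 1"
    and \<theta>_node: "\<And>j k. j < n \<Longrightarrow> k < n \<Longrightarrow> \<theta> j (a k) = (if j = k then 1 else 0)"
    and a0: "a 0 = 0"
begin

text \<open>Two applications of Cauchy--Schwarz, over the \<open>n - 1\<close> coordinates and over
  the \<open>n\<close> channels, produce the factors \<open>real (n - 1)\<close> and
  \<open>real n\<close>; the 2 comes from the kinetic energy.\<close>

definition "\<kappa> = real (n - 1) * real n * W\<^sup>2 / 2"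

text \<open>The constant \<open>A j / 2\<close> is owed once for each coordinate other than the
  last, hence the factor \<open>real (n - 1)\<close>. The sum of the squares of
  \<open>\<theta>' j\<close> pays for the dependence of the generating function on the last
  coordinate and vanishes at the nodes.\<close>

definition "u1 y = real (n - 1) * ((\<Sum>j<n. \<theta> j y * A j) / 2 + \<kappa> * (\<Sum>j<n. (\<theta>' j y)\<^sup>2))"
definition "u1' y = real (n - 1) * ((\<Sum>j<n. \<theta>' j y * A j) / 2 + \<kappa> * (\<Sum>j<n. 2 * \<theta>' j y * \<theta>'' j y))"
definition "u2 y = (\<Sum>j<n. \<theta> j y * B j) / 2"
definition "u2' y = (\<Sum>j<n. \<theta>' j y * B j) / 2"

text \<open>At each node every weight is extremal: it takes its maximum 1 or its minimum 0. So the
  slices feel no transversal force and no penalty.\<close>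

lemma \<theta>'_node:
  assumes "j < n" "k < n"
  shows "\<theta>' j (a k) = 0"
proof (cases "j = k")
  case True
  have "\<theta> j y \<le> 1" for y
    using member_le_sum[of j "{..<n}" "\<lambda>j. \<theta> j y"] assms \<theta>_nonneg \<theta>_sum by auto
  then show ?thesis
    using True assms by (intro DERIV_local_max[OF \<theta>_deriv(1) zero_less_one]) (simp add: \<theta>_node)
next
  case False
  then show ?thesis
    using assms \<theta>_nonneg by (intro DERIV_local_min[OF \<theta>_deriv(1) zero_less_one]) (simp add: \<theta>_node)
qed

lemma sum_node: "k < n \<Longrightarrow> (\<Sum>j<n. \<theta> j (a k) * h j) = h k"
  by (subst sum.remove[of _ k]) (auto simp: \<theta>_node intro!: sum.neutral)

lemma u_node:
  assumes "k < n"
  shows "u1 (a k) = real (n - 1) * (A k / 2)" "u2 (a k) = B k / 2" "u1' (a k) = 0" "u2' (a k) = 0"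
  using assms by (simp_all add: u1_def u2_def u1'_def u2'_def sum_node \<theta>'_node)

lemma u_trig_rational: "trig_rational u1" "trig_rational u2" "trig_rational u1'" "trig_rational u2'"
proof -
  have "trig_rational (\<lambda>y. real (n - 1) * ((\<Sum>j<n. \<theta> j y * A j) * (1/2) + \<kappa> * (\<Sum>j<n. \<theta>' j y * \<theta>' j y)))"
    by (intro trig_rational.mult trig_rational.add trig_rational.const trig_rational_sum \<theta>_tr)
  then show "trig_rational u1" by (simp add: u1_def[abs_def] power2_eq_square)
  have "trig_rational (\<lambda>y. real (n - 1) * ((\<Sum>j<n. \<theta>' j y * A j) * (1/2) + \<kappa> * (\<Sum>j<n. 2 * \<theta>' j y * \<theta>'' j y)))"
    by (intro trig_rational.mult trig_rational.add trig_rational.const trig_rational_sum \<theta>_tr)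
  then show "trig_rational u1'" by (simp add: u1'_def[abs_def])
  have "trig_rational (\<lambda>y. (\<Sum>j<n. \<theta> j y * B j) * (1/2))"
    by (intro trig_rational.mult trig_rational.add trig_rational.const trig_rational_sum \<theta>_tr)
  then show "trig_rational u2" by (simp add: u2_def[abs_def])
  have "trig_rational (\<lambda>y. (\<Sum>j<n. \<theta>' j y * B j) * (1/2))"
    by (intro trig_rational.mult trig_rational.add trig_rational.const trig_rational_sum \<theta>_tr)
  then show "trig_rational u2'" by (simp add: u2'_def[abs_def])
qed

lemma u_deriv: "(u1 has_real_derivative u1' y) (at y)" "(u2 has_real_derivative u2' y) (at y)"
  unfolding u1_def[abs_def] u2_def[abs_def] u1'_def u2'_def
  by (auto intro!: derivative_eq_intros \<theta>_deriv sum.cong simp: power2_eq_square mult.commute)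

definition "P y x = (\<Sum>j<n. \<theta> j y * p j x)"

text \<open>Jensen's inequality for the weights \<open>\<theta> j y\<close>.\<close>

lemma P_sq_le: "(P y x)\<^sup>2 \<le> (\<Sum>j<n. \<theta> j y * A j) + (\<Sum>j<n. \<theta> j y * B j) * (1 - cos x)"
proof -
  have "0 \<le> (\<Sum>j<n. \<theta> j y * (p j x - P y x)\<^sup>2)"
    by (intro sum_nonneg mult_nonneg_nonneg \<theta>_nonneg) auto
  also have "\<dots> = (\<Sum>j<n. \<theta> j y * (p j x)\<^sup>2) - 2 * P y x * (\<Sum>j<n. \<theta> j y * p j x) + (P y x)\<^sup>2 * (\<Sum>j<n. \<theta> j y)"
    by (simp add: power2_diff sum_distrib_left sum_distrib_right sum.distrib sum_subtractf algebra_simps)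
  also have "\<dots> = (\<Sum>j<n. \<theta> j y * (p j x)\<^sup>2) - (P y x)\<^sup>2"
    unfolding \<theta>_sum P_def[symmetric] by (simp add: power2_eq_square)
  finally have "(P y x)\<^sup>2 \<le> (\<Sum>j<n. \<theta> j y * (p j x)\<^sup>2)" by simp
  also have "\<dots> \<le> (\<Sum>j<n. \<theta> j y * (A j + B j * (1 - cos x)))"
    by (intro sum_mono mult_left_mono p_sq_le \<theta>_nonneg) auto
  also have "\<dots> = (\<Sum>j<n. \<theta> j y * A j) + (\<Sum>j<n. \<theta> j y * B j) * (1 - cos x)"
    by (simp add: sum.distrib sum_distrib_right distrib_left mult.assoc)
  finally show ?thesis .
qed

definition wy :: "real \<Rightarrow> real \<Rightarrow> real" where "wy y x = (\<Sum>j<n. \<theta>' j y * w j x)"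

lemma wy_sq_le: "(wy y x)\<^sup>2 \<le> real n * W\<^sup>2 * (\<Sum>j<n. (\<theta>' j y)\<^sup>2)"
proof -
  have "(wy y x)\<^sup>2 \<le> (\<Sum>j<n. (\<theta>' j y * w j x)\<^sup>2) * real (card {..<n})"
    unfolding wy_def by (rule sum_squared_le_sum_of_squares)
  also have "\<dots> \<le> (\<Sum>j<n. (\<theta>' j y)\<^sup>2 * W\<^sup>2) * real (card {..<n})"
    unfolding power_mult_distrib
    by (intro mult_right_mono sum_mono mult_left_mono) (use w_bd power_mono[OF w_bd, of _ _ 2] in auto)
  finally show ?thesis by (simp add: sum_distrib_left sum_distrib_right mult_ac)
qed

definition cls :: "('n \<Rightarrow> int) \<Rightarrow> (real, 'n::{finite,linorder}) vec" where
  "cls \<sigma> = (\<chi> i. if i = last_idx then 0 else of_int (\<sigma> i))"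

text \<open>A coordinate run backwards needs only a sign in front of \<open>w j\<close>, because
  \<open>p j\<close> is even.\<close>

definition cal :: "('n \<Rightarrow> int) \<Rightarrow> (real, 'n::{finite,linorder}) vec \<Rightarrow> real" where
  "cal \<sigma> x = (\<Sum>i\<in>UNIV - {last_idx}. of_int (\<sigma> i) * (\<Sum>j<n. \<theta> j (x $ last_idx) * w j (x $ i)))"

definition Dcal :: "('n \<Rightarrow> int) \<Rightarrow> (real, 'n::{finite,linorder}) vec \<Rightarrow> (real, 'n) vec" where
  "Dcal \<sigma> x = (\<chi> i. if i = last_idx then \<Sum>i\<in>UNIV - {last_idx}. of_int (\<sigma> i) * wy (x $ last_idx) (x $ i)
     else of_int (\<sigma> i) * (P (x $ last_idx) (x $ i) - 1))"

lemma cls_Dcal: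
  "(cls \<sigma> + Dcal \<sigma> x) $ last_idx = (\<Sum>i\<in>UNIV - {last_idx}. of_int (\<sigma> i) * wy (x $ last_idx) (x $ i))"
  "i \<noteq> last_idx \<Longrightarrow> (cls \<sigma> + Dcal \<sigma> x) $ i = of_int (\<sigma> i) * P (x $ last_idx) (x $ i)"
  by (simp_all add: cls_def Dcal_def algebra_simps)

lemma cal_deriv: "(cal \<sigma> has_derivative (\<lambda>h. Dcal \<sigma> x \<bullet> h)) (at x)"
proof -
  have D: "(cal \<sigma> has_derivative (\<lambda>h. \<Sum>i\<in>UNIV - {last_idx}. of_int (\<sigma> i) *
      (\<Sum>j<n. \<theta> j (x $ last_idx) * ((p j (x $ i) - 1) * h $ i) + (\<theta>' j (x $ last_idx) * h $ last_idx) * w j (x $ i)))) (at x)"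
    unfolding cal_def[abs_def]
    by (intro has_derivative_sum has_derivative_mult_right has_derivative_mult has_derivative_coord \<theta>_deriv w) auto
  \<comment> \<open>The weights sum to 1, so the subtracted constants merge into a single 1, which
    cancels when the class \<open>cls \<sigma>\<close> is added.\<close>
  have eq: "(\<Sum>j<n. \<theta> j y * ((p j z - 1) * h) + (\<theta>' j y * h') * w j z) = (P y z - 1) * h + wy y z * h'" for y z h h'
  proof -
    have "(\<Sum>j<n. \<theta> j y * ((p j z - 1) * h) + (\<theta>' j y * h') * w j z) =
        ((\<Sum>j<n. \<theta> j y * p j z) - (\<Sum>j<n. \<theta> j y)) * h + (\<Sum>j<n. \<theta>' j y * w j z) * h'"
      by (simp add: sum.distrib sum_subtractf sum_distrib_left sum_distrib_right algebra_simps)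
    then show ?thesis by (simp add: P_def wy_def \<theta>_sum)
  qed
  show ?thesis
    by (rule has_derivative_eq_rhs[OF D], unfold eq)
       (simp add: fun_eq_iff inner_split_last Dcal_def sum.distrib sum_subtractf sum_distrib_left sum_distrib_right algebra_simps)
qed

lemma \<theta>_per: "\<theta> j (y + 2 * pi * of_int m) = \<theta> j y" "\<theta>' j (y + 2 * pi * of_int m) = \<theta>' j y"
  by (rule trig_rational_periodic[OF \<theta>_tr(1)]) (rule trig_rational_periodic[OF \<theta>_tr(2)])

lemma pw_per: "j < n \<Longrightarrow> p j (y + 2 * pi * of_int m) = p j y" "j < n \<Longrightarrow> w j (y + 2 * pi * of_int m) = w j y"
  using periodic_int[of "p j"] periodic_int[of "w j"] p_per w_per by auto

lemma cal_per: "cal \<sigma> (x + lattice_vec k) = cal \<sigma> x"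
  unfolding cal_def by (intro sum.cong refl) (simp add: lattice_vec_def \<theta>_per pw_per)

lemma cal_cont: "continuous_on UNIV (cal \<sigma>)"
  using cal_deriv by (meson continuous_at_imp_continuous_on has_derivative_continuous)

lemma P_per: "P (y + 2 * pi * of_int k) (x + 2 * pi * of_int m) = P y x"
  unfolding P_def by (intro sum.cong refl) (simp add: \<theta>_per pw_per)

lemma wy_per: "wy (y + 2 * pi * of_int k) (x + 2 * pi * of_int m) = wy y x"
  unfolding wy_def by (intro sum.cong refl) (simp add: \<theta>_per pw_per)

lemma Dcal_per: "Dcal \<sigma> (x + lattice_vec k) = Dcal \<sigma> x"
  by (simp add: Dcal_def vec_eq_iff lattice_vec_def P_per wy_per)

lemma Dcal_cont: "continuous_on UNIV (Dcal \<sigma>)"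
proof -
  have c: "continuous_on UNIV (\<theta> j)" "continuous_on UNIV (\<theta>' j)" for j
    by (intro trig_rational_continuous \<theta>_tr)+
  have "continuous_on UNIV (w j)" if "j < n" for j
    using w[OF that] by (meson DERIV_isCont continuous_at_imp_continuous_on)
  then have "continuous_on UNIV (\<lambda>x. Dcal \<sigma> x $ i)" for i
    unfolding Dcal_def P_def wy_def
    by (cases "i = last_idx") (auto intro!: continuous_intros continuous_coord c p_cont)
  then show ?thesis
    unfolding continuous_on_def by (auto intro!: vec_tendstoI simp: tendsto_vec_nth)
qed

lemma \<kappa>_nonneg: "0 \<le> \<kappa>" by (simp add: \<kappa>_def)

text \<open>The coordinates other than the last contribute squares of \<open>P\<close>, controlled
  by \<open>P_sq_le\<close>; the last one contributes the sum of the \<open>wy\<close> terms,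
  controlled by \<open>wy_sq_le\<close> and paid for by \<kappa>. The signs disappear on
  squaring.\<close>

lemma cal_subsolution:
  fixes x :: "(real, 'n::{finite,linorder}) vec"
  assumes card: "CARD('n) = n" and \<sigma>: "\<And>i. \<bar>\<sigma> i\<bar> = 1"
  shows "(norm (cls \<sigma> + Dcal \<sigma> x))\<^sup>2 / 2 \<le> potential u1 u2 x"
proof -
  let ?I = "UNIV - {last_idx :: 'n}" and ?y = "x $ last_idx"
  have I: "card ?I = n - 1" using card by simp
  have \<sigma>2: "(of_int (\<sigma> i))\<^sup>2 = (1 :: real)" for i
    using \<sigma>[of i] by (metis of_int_1 of_int_abs power2_abs power_one)
  have "(norm (cls \<sigma> + Dcal \<sigma> x))\<^sup>2 = (\<Sum>i\<in>?I. of_int (\<sigma> i) * wy ?y (x $ i))\<^sup>2 + (\<Sum>i\<in>?I. (P ?y (x $ i))\<^sup>2)"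
  proof -
    have "(cls \<sigma> + Dcal \<sigma> x) $ i * (cls \<sigma> + Dcal \<sigma> x) $ i = (P ?y (x $ i))\<^sup>2" if "i \<in> ?I" for i
      using that \<sigma>2[of i] cls_Dcal(2)[of i \<sigma> x]
      by (simp add: power2_eq_square[symmetric] power_mult_distrib)
    then have "(\<Sum>i\<in>?I. (cls \<sigma> + Dcal \<sigma> x) $ i * (cls \<sigma> + Dcal \<sigma> x) $ i) = (\<Sum>i\<in>?I. (P ?y (x $ i))\<^sup>2)"
      by (rule sum.cong[OF refl])
    then show ?thesis
      unfolding power2_norm_eq_inner inner_split_last cls_Dcal(1) by (simp add: power2_eq_square[of "sum _ _"])
  qed
  also have "(\<Sum>i\<in>?I. of_int (\<sigma> i) * wy ?y (x $ i))\<^sup>2 \<le> (\<Sum>i\<in>?I. (of_int (\<sigma> i) * wy ?y (x $ i))\<^sup>2) * real (card ?I)"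
    by (rule sum_squared_le_sum_of_squares)
  also have "\<dots> \<le> (\<Sum>i\<in>?I. real n * W\<^sup>2 * (\<Sum>j<n. (\<theta>' j ?y)\<^sup>2)) * real (card ?I)"
    by (intro mult_right_mono sum_mono) (simp_all add: power_mult_distrib \<sigma>2 wy_sq_le)
  also have "\<dots> = 2 * (real (n - 1) * (\<kappa> * (\<Sum>j<n. (\<theta>' j ?y)\<^sup>2)))"
    unfolding I sum_constant \<kappa>_def by simp
  also have "(\<Sum>i\<in>?I. (P ?y (x $ i))\<^sup>2) \<le> (\<Sum>i\<in>?I. (\<Sum>j<n. \<theta> j ?y * A j) + (\<Sum>j<n. \<theta> j ?y * B j) * (1 - cos (x $ i)))"
    by (intro sum_mono P_sq_le)
  also have "\<dots> = 2 * (real (n - 1) * ((\<Sum>j<n. \<theta> j ?y * A j) / 2) + u2 ?y * (\<Sum>i\<in>?I. 1 - cos (x $ i)))"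
    unfolding sum.distrib sum_constant I u2_def sum_distrib_left[symmetric] by simp
  finally show ?thesis
    unfolding potential_def u1_def by (simp add: distrib_left)
qed

lemma u1_ge: "real (n - 1) * ((\<Sum>j<n. \<theta> j y * A j) / 2) \<le> u1 y"
  unfolding u1_def by (intro mult_left_mono) (auto intro!: mult_nonneg_nonneg \<kappa>_nonneg sum_nonneg)

lemma A_nonneg: "j < n \<Longrightarrow> 0 \<le> A j"
  using A0 A_pos[of j] by (cases "j = 0") auto

lemma potential_nonneg: "0 \<le> potential u1 u2 x"
proof -
  have "0 \<le> (\<Sum>j<n. \<theta> j y * A j)" "0 \<le> (\<Sum>j<n. \<theta> j y * B j)" for y
    by (intro sum_nonneg mult_nonneg_nonneg \<theta>_nonneg A_nonneg less_imp_le[OF B_pos]; simp)+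
  then have "0 \<le> u1 y" "0 \<le> u2 y" for y
    by (auto simp: u2_def intro!: order_trans[OF _ u1_ge] mult_nonneg_nonneg)
  then show ?thesis
    unfolding potential_def by (intro add_nonneg_nonneg mult_nonneg_nonneg sum_nonneg) auto
qed

lemma u1_0: "u1 0 = 0"
  using u_node(1)[of 0] n a0 A0 by simp

definition curve :: "nat \<Rightarrow> ('n \<Rightarrow> int) \<Rightarrow> real \<Rightarrow> (real, 'n::{finite,linorder}) vec" where
  "curve j \<sigma> t = (\<chi> i. if i = last_idx then a j else of_int (\<sigma> i) * X j t)"

definition curve' :: "nat \<Rightarrow> ('n \<Rightarrow> int) \<Rightarrow> real \<Rightarrow> (real, 'n::{finite,linorder}) vec" where
  "curve' j \<sigma> t = (\<chi> i. if i = last_idx then 0 else of_int (\<sigma> i) * p j (X j t))"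

definition winding :: "('n \<Rightarrow> int) \<Rightarrow> 'n::{finite,linorder} \<Rightarrow> int" where
  "winding \<sigma> i = (if i = last_idx then 0 else \<sigma> i)"

text \<open>At a node \<open>u1'\<close> and \<open>u2'\<close> vanish, so the slice is invariant
  and the other coordinates decouple into identical pendulums; signs pass through the odd
  sine.\<close>

lemma closed_orbit_curve:
  fixes \<sigma> :: "'n::{finite,linorder} \<Rightarrow> int"
  assumes mech: "mechanical (potential u1 u2 :: (real, 'n) vec \<Rightarrow> real) (force u2 u1' u2') K L"
    and \<sigma>: "\<And>i. \<bar>\<sigma> i\<bar> = 1" and j: "0 < j" "j < n"
  shows "closed_orbit (potential u1 u2) (force u2 u1' u2') K L (curve j \<sigma>) (curve' j \<sigma>) (T j) (winding \<sigma>)"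
proof -
  interpret mechanical "potential u1 u2 :: (real, 'n) vec \<Rightarrow> real" "force u2 u1' u2'" K L by (rule mech)
  have sin_odd: "sin (of_int (\<sigma> i) * x) = of_int (\<sigma> i) * sin x" for i x
    using \<sigma>[of i] by (cases "0 \<le> \<sigma> i") auto
  show ?thesis
  proof
    show "(curve j \<sigma> has_vector_derivative curve' j \<sigma> t) (at t)" for t
    proof (rule has_vector_derivative_vecI)
      show "((\<lambda>t. curve j \<sigma> t $ i) has_real_derivative curve' j \<sigma> t $ i) (at t)" for i
        using DERIV_cmult[OF X[OF j]] by (cases "i = last_idx") (simp_all add: curve_def curve'_def)
    qed
    show "(curve' j \<sigma> has_vector_derivative force u2 u1' u2' (curve j \<sigma> t)) (at t)" for t
    proof (rule has_vector_derivative_vecI)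
      show "((\<lambda>t. curve' j \<sigma> t $ i) has_real_derivative force u2 u1' u2' (curve j \<sigma> t) $ i) (at t)" for i
      proof (cases "i = last_idx")
        case True
        then show ?thesis using j by (simp add: curve'_def curve_def force_def u_node)
      next
        case False
        then show ?thesis
          using j DERIV_cmult[OF pX[OF j], of "of_int (\<sigma> i)" t]
          by (simp add: curve'_def curve_def force_def u_node sin_odd mult_ac)
      qed
    qed
    show "curve j \<sigma> (t + T j) = curve j \<sigma> t + lattice_vec (winding \<sigma>)" for t
      using j by (simp add: curve_def lattice_vec_def winding_def vec_eq_iff X_per algebra_simps)
    show "0 < T j" by (rule T_pos[OF j])
  qed
qed

text \<open>On slice \<open>j\<close> the weights select one channel: \<open>P\<close> reduces to
  \<open>p j\<close> and \<open>wy\<close> vanishes. Because \<open>0 < j\<close>, the energy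
  relation is an equality there.\<close>

lemma curve_calibrated:
  fixes \<sigma> :: "'n::{finite,linorder} \<Rightarrow> int"
  assumes card: "CARD('n) = n" and \<sigma>: "\<And>i. \<bar>\<sigma> i\<bar> = 1" and j: "0 < j" "j < n"
  shows "curve' j \<sigma> t = cls \<sigma> + Dcal \<sigma> (curve j \<sigma> t)"
    "potential u1 u2 (curve j \<sigma> t) = (norm (curve' j \<sigma> t))\<^sup>2 / 2"
proof -
  let ?I = "UNIV - {last_idx :: 'n}"
  have I: "card ?I = n - 1" using card by simp
  have even: "g (of_int (\<sigma> i) * x) = g x" if "\<And>x. g (- x) = g x" for g :: "real \<Rightarrow> real" and i x
    using \<sigma>[of i] that by (cases "0 \<le> \<sigma> i") auto
  have \<sigma>2: "(of_int (\<sigma> i))\<^sup>2 = (1 :: real)" for i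
    using \<sigma>[of i] by (metis of_int_1 of_int_abs power2_abs power_one)
  have wy0: "wy (a j) x = 0" for x using j(2) by (simp add: wy_def \<theta>'_node)
  have P: "P (a j) (of_int (\<sigma> i) * x) = p j x" for i x
    using sum_node[OF j(2), of "\<lambda>j. p j (of_int (\<sigma> i) * x)"] even[of "p j" i x] p_even[OF j(2)] by (simp add: P_def)
  have curve: "curve j \<sigma> t $ last_idx = a j" "i \<noteq> last_idx \<Longrightarrow> curve j \<sigma> t $ i = of_int (\<sigma> i) * X j t" for i
    by (simp_all add: curve_def)
  show "curve' j \<sigma> t = cls \<sigma> + Dcal \<sigma> (curve j \<sigma> t)"
    unfolding vec_eq_iff
  proof
    fix i
    show "curve' j \<sigma> t $ i = (cls \<sigma> + Dcal \<sigma> (curve j \<sigma> t)) $ i"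
    proof (cases "i = last_idx")
      case True
      then show ?thesis using cls_Dcal(1)[of \<sigma> "curve j \<sigma> t"] by (simp add: curve'_def curve wy0)
    next
      case False
      then show ?thesis using cls_Dcal(2)[OF False, of \<sigma> "curve j \<sigma> t"] by (simp add: curve'_def curve P)
    qed
  qed
  have "(norm (curve' j \<sigma> t))\<^sup>2 = (\<Sum>i\<in>?I. (p j (X j t))\<^sup>2)"
  proof -
    have "(\<Sum>i\<in>?I. curve' j \<sigma> t $ i * curve' j \<sigma> t $ i) = (\<Sum>i\<in>?I. (p j (X j t))\<^sup>2)"
      by (intro sum.cong refl) (simp add: curve'_def power2_eq_square[symmetric] power_mult_distrib \<sigma>2)
    then show ?thesis
      unfolding power2_norm_eq_inner inner_split_last by (simp add: curve'_def)
  qed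
  also have "\<dots> = 2 * potential u1 u2 (curve j \<sigma> t)"
  proof -
    have "potential u1 u2 (curve j \<sigma> t) = u1 (a j) + u2 (a j) * (\<Sum>i\<in>?I. 1 - cos (X j t))"
      unfolding potential_def curve(1)
      by (intro arg_cong2[of _ _ _ _ "(+)"] arg_cong2[of _ _ _ _ "(*)"] sum.cong refl) (simp add: curve(2) even[of cos])
    also have "\<dots> = real (n - 1) * (A j / 2) + B j / 2 * (real (n - 1) * (1 - cos (X j t)))"
      unfolding u_node[OF j(2)] sum_constant I ..
    finally show ?thesis
      unfolding p_sq[OF j] sum_constant I by (simp add: distrib_left)
  qed
  finally show "potential u1 u2 (curve j \<sigma> t) = (norm (curve' j \<sigma> t))\<^sup>2 / 2" by simp
qed

lemma action_cls_nonneg: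
  fixes \<sigma> :: "'n::{finite,linorder} \<Rightarrow> int"
  assumes mech: "mechanical (potential u1 u2 :: (real, 'n) vec \<Rightarrow> real) (force u2 u1' u2') K L"
    and card: "CARD('n) = n" and \<sigma>: "\<And>i. \<bar>\<sigma> i\<bar> = 1" and adm: "admissible L \<mu>"
  shows "0 \<le> action L (cls \<sigma>) \<mu>"
proof -
  interpret mechanical "potential u1 u2 :: (real, 'n) vec \<Rightarrow> real" "force u2 u1' u2'" K L by (rule mech)
  obtain M M' where M: "\<And>x. norm (cal \<sigma> x) \<le> M" "\<And>x. norm (Dcal \<sigma> x) \<le> M'"
    using lattice_periodic_bounded[of "cal \<sigma>"] lattice_periodic_bounded[of "Dcal \<sigma>"]
      cal_per Dcal_per Dcal_cont cal_cont by metis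
  show ?thesis
    by (rule subsolution_action_nonneg[OF adm cal_deriv cal_per, of _ "max M M'"])
       (use M cal_subsolution[OF card \<sigma>] in \<open>auto simp: le_max_iff_disj\<close>)
qed

lemma action_curve:
  fixes \<sigma> :: "'n::{finite,linorder} \<Rightarrow> int"
  assumes orb: "closed_orbit (potential u1 u2 :: (real, 'n) vec \<Rightarrow> real) (force u2 u1' u2') K L (curve j \<sigma>) (curve' j \<sigma>) (T j) (winding \<sigma>)"
    and card: "CARD('n) = n" and \<sigma>: "\<And>i. \<bar>\<sigma> i\<bar> = 1" and j: "0 < j" "j < n"
  shows "action L (cls \<sigma>) (closed_orbit.orbit_measure (curve j \<sigma>) (curve' j \<sigma>) (T j)) = 0"
proof -
  interpret closed_orbit "potential u1 u2 :: (real, 'n) vec \<Rightarrow> real" "force u2 u1' u2'" K L "curve j \<sigma>" "curve' j \<sigma>" "T j" "winding \<sigma>"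
    by (rule orb)
  obtain M M' where M: "\<And>x. norm (cal \<sigma> x) \<le> M" "\<And>x. norm (Dcal \<sigma> x) \<le> M'"
    using lattice_periodic_bounded[of "cal \<sigma>"] lattice_periodic_bounded[of "Dcal \<sigma>"]
      cal_per Dcal_per Dcal_cont cal_cont by metis
  show ?thesis
    by (rule calibrated_action[OF cal_deriv cal_per, of _ "max M M'"])
       (use M Dcal_cont Dcal_per curve_calibrated[OF card \<sigma> j] in \<open>auto simp: le_max_iff_disj\<close>)
qed

text \<open>For a small class a different generating function is used. In each coordinate other than
  the last, subtracting \<open>c $ i * sin (x $ i)\<close> turns the momentum into
  \<open>c $ i * (1 - cos (x $ i))\<close>, whose square is dominated by the \<open>u2\<close> part
  of the potential. In the last coordinate the class is redistributed in proportion to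
  \<open>r\<close>, which vanishes at the node 0, as \<open>u1\<close> does.\<close>

lemma lowest_level_interior:
  assumes mech: "mechanical (potential u1 u2 :: (real, 'n::{finite,linorder}) vec \<Rightarrow> real) (force u2 u1' u2') K L"
    and card: "CARD('n) = n"
  obtains e where "0 < e" "\<And>c \<mu>. norm c < e \<Longrightarrow> admissible L \<mu> \<Longrightarrow> 0 \<le> action L c \<mu>"
proof -
  interpret mechanical "potential u1 u2 :: (real, 'n) vec \<Rightarrow> real" "force u2 u1' u2'" K L by (rule mech)
  let ?I = "UNIV - {last_idx :: 'n}"
  define b where "b = Min (B ` {..<n})"
  define \<alpha> where "\<alpha> = Min (A ` {0<..<n})"
  have b: "0 < b" "\<And>j. j < n \<Longrightarrow> b \<le> B j"
  proof -
    have "0 \<in> {..<n}" using n by simp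
    then have "{..<n} \<noteq> {}" by blast
    then show "0 < b" unfolding b_def by (subst Min_gr_iff) (auto simp: B_pos)
    show "b \<le> B j" if "j < n" for j
      unfolding b_def using that by (intro Min_le) auto
  qed
  have \<alpha>: "0 < \<alpha>" "\<And>j. 0 < j \<Longrightarrow> j < n \<Longrightarrow> \<alpha> \<le> A j"
  proof -
    have "1 \<in> {0<..<n}" using n by simp
    then have "{0<..<n} \<noteq> {}" by blast
    then show "0 < \<alpha>" unfolding \<alpha>_def by (subst Min_gr_iff) (auto simp: A_pos)
    show "\<alpha> \<le> A j" if "0 < j" "j < n" for j
      unfolding \<alpha>_def using that by (intro Min_le) auto
  qed
  \<comment> \<open>The total weight of the slices with \<open>0 < j\<close>; times \<alpha> / 2 it
    is a lower bound for \<open>u1\<close>.\<close>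
  define r where "r y = 1 - \<theta> 0 y" for y
  have r_sum: "r y = (\<Sum>j\<in>{0<..<n}. \<theta> j y)" for y
  proof -
    have "{..<n} - {0} = {0<..<n}" by auto
    moreover have "(\<Sum>j<n. \<theta> j y) = \<theta> 0 y + (\<Sum>j\<in>{..<n} - {0}. \<theta> j y)"
      by (rule sum.remove) (use n in auto)
    ultimately show ?thesis using \<theta>_sum[of y] by (simp add: r_def)
  qed
  have r: "0 \<le> r y" "r y \<le> 1" for y
  proof -
    show "0 \<le> r y" unfolding r_sum by (intro sum_nonneg \<theta>_nonneg) simp
    show "r y \<le> 1" using \<theta>_nonneg[of 0 y] n by (simp add: r_def)
  qed
  have r_cont: "continuous_on UNIV r"
    unfolding r_def[abs_def] by (intro continuous_intros trig_rational_continuous \<theta>_tr)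
  have r_per: "r (y + 2 * pi) = r y" for y using \<theta>_per(1)[of 0 y 1] by (simp add: r_def)
  \<comment> \<open>Dividing by the mean makes \<open>r / m - 1\<close> a function of mean zero,
    whose primitive \<open>h\<close> is periodic.\<close>
  define m where "m = integral {0..2 * pi} r / (2 * pi)"
  have m: "0 < m"
  proof -
    have r_int: "r integrable_on {0..2 * pi}"
      by (rule integrable_continuous_real[OF continuous_on_subset[OF r_cont]]) simp
    have "0 \<le> integral {0..2 * pi} r" by (rule integral_nonneg[OF r_int r(1)])
    moreover have "integral {0..2 * pi} r \<noteq> 0"
    proof
      assume "integral {0..2 * pi} r = 0"
      then have z: "\<forall>y\<in>{0..2 * pi}. r y = 0"
        using integral_eq_0_iff[OF continuous_on_subset[OF r_cont], of 0 "2 * pi"] r(1) by auto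
      have "r y = 0" for y
      proof -
        have "tproj (vec y :: real^1) $ 1 \<in> {0..2 * pi}"
          using tproj_fund_dom[of "vec y :: real^1" undefined] by (auto simp: fund_dom_def less_imp_le)
        moreover have "r (tproj (vec y :: real^1) $ 1) = r y"
          using periodic_int[of r y "- \<lfloor>y / (2 * pi)\<rfloor>"] r_per by (simp add: tproj_def)
        ultimately show ?thesis using z by metis
      qed
      moreover have "r (a 1) = 1" using n by (simp add: r_def \<theta>_node)
      ultimately show False by simp
    qed
    ultimately show ?thesis by (simp add: m_def)
  qed
  have "integral {0..2 * pi} (\<lambda>y. r y / m - 1) = 0"
  proof -
    have "(r has_integral (m * (2 * pi))) {0..2 * pi}"
      using integrable_integral[OF integrable_continuous_real[OF continuous_on_subset[OF r_cont]], of 0 "2 * pi"]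
      by (simp add: m_def)
    from has_integral_diff[OF has_integral_mult_left[OF this, of "1 / m"] has_integral_const_real[of 1 0 "2 * pi"]]
    show ?thesis using m by (intro integral_unique) simp
  qed
  moreover have "continuous_on UNIV (\<lambda>y. r y / m - 1)"
    using m by (intro continuous_intros r_cont) auto
  ultimately obtain h where h: "\<And>y. (h has_real_derivative r y / m - 1) (at y)" "\<And>y. h (y + 2 * pi) = h y"
    using periodic_antiderivative[of "\<lambda>y. r y / m - 1"] r_per by auto
  \<comment> \<open>The two bounds ensure \<open>(c $ i)\<^sup>2 \<le> b / 2\<close> and
    \<open>(c $ last_idx / m)\<^sup>2 \<le> \<alpha>\<close>, which the estimates of the two groups
    of coordinates require.\<close>
  define e where "e = min (sqrt b / 2) (m * sqrt \<alpha> / 2)"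
  have e: "0 < e" using b \<alpha> m by (simp add: e_def)
  have "0 \<le> action L c \<mu>" if c: "norm c < e" and adm: "admissible L \<mu>" for c \<mu>
  proof -
    define f where "f x = (\<Sum>i\<in>?I. - (c $ i) * sin (x $ i)) + c $ last_idx * h (x $ last_idx)" for x :: "(real, 'n) vec"
    define Df where "Df x = (\<chi> i. if i = last_idx then c $ last_idx * (r (x $ last_idx) / m - 1) else - (c $ i) * cos (x $ i))"
      for x :: "(real, 'n) vec"
    have f: "(f has_derivative (\<lambda>h. Df x \<bullet> h)) (at x)" for x
    proof -
      have "(f has_derivative (\<lambda>k. (\<Sum>i\<in>?I. - (c $ i) * (cos (x $ i) * k $ i)) + c $ last_idx * ((r (x $ last_idx) / m - 1) * k $ last_idx))) (at x)"
        unfolding f_def[abs_def]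
        by (intro has_derivative_add has_derivative_sum has_derivative_mult_right has_derivative_coord h DERIV_sin)
      then show ?thesis
        by (rule has_derivative_eq_rhs) (simp add: fun_eq_iff inner_split_last Df_def algebra_simps)
    qed
    have h_int: "h (y + 2 * pi * of_int k) = h y" and r_int: "r (y + 2 * pi * of_int k) = r y" for y k
      using periodic_int[of h] periodic_int[of r] h(2) r_per by auto
    have per: "f (x + lattice_vec k) = f x" "Df (x + lattice_vec k) = Df x" for x k
      by (simp_all add: f_def Df_def lattice_vec_def h_int r_int vec_eq_iff
          trig_rational_periodic[OF trig_rational_sin] trig_rational_periodic[OF trig_rational_cos])
    have "continuous_on UNIV (\<lambda>x. Df x $ i)" for i
      unfolding Df_def using m
      by (cases "i = last_idx") (auto intro!: continuous_intros continuous_coord[OF r_cont])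
    then have "continuous_on UNIV Df"
      unfolding continuous_on_def by (auto intro!: vec_tendstoI simp: tendsto_vec_nth)
    moreover have "continuous_on UNIV f"
      using f by (meson continuous_at_imp_continuous_on has_derivative_continuous)
    ultimately obtain M M' where M: "\<And>x. norm (f x) \<le> M" "\<And>x. norm (Df x) \<le> M'"
      using lattice_periodic_bounded[of f] lattice_periodic_bounded[of Df] per by metis
    have sub: "(norm (c + Df x))\<^sup>2 / 2 \<le> potential u1 u2 x" for x
    proof -
      let ?y = "x $ last_idx"
      have c_bd: "\<bar>c $ i\<bar> \<le> e" for i
        using component_le_norm_cart[of c i] c by simp
      have ci: "(c $ i)\<^sup>2 \<le> b / 2" for i
      proof -
        have "\<bar>c $ i\<bar>\<^sup>2 \<le> (sqrt b / 2)\<^sup>2"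
          using c_bd[of i] by (intro power_mono) (auto simp: e_def)
        then show ?thesis using b by (simp add: power_divide)
      qed
      have cl: "(c $ last_idx / m)\<^sup>2 \<le> \<alpha>"
      proof -
        have "\<bar>c $ last_idx / m\<bar> \<le> sqrt \<alpha>"
        proof -
          have "2 * \<bar>c $ last_idx\<bar> \<le> m * sqrt \<alpha>" using c_bd[of last_idx] by (simp add: e_def)
          then have "\<bar>c $ last_idx\<bar> \<le> m * sqrt \<alpha>" by simp
          then show ?thesis using m by (simp add: abs_div pos_divide_le_eq mult.commute)
        qed
        then have "\<bar>c $ last_idx / m\<bar>\<^sup>2 \<le> (sqrt \<alpha>)\<^sup>2" by (intro power_mono) auto
        then show ?thesis using \<alpha> by (simp add: power_divide)
      qed
      have "(norm (c + Df x))\<^sup>2 = (c $ last_idx / m * r ?y)\<^sup>2 + (\<Sum>i\<in>?I. (c $ i)\<^sup>2 * (1 - cos (x $ i))\<^sup>2)"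
      proof -
        have "(c + Df x) $ last_idx = c $ last_idx / m * r ?y"
          by (simp add: Df_def algebra_simps)
        moreover have "(c + Df x) $ i * (c + Df x) $ i = (c $ i)\<^sup>2 * (1 - cos (x $ i))\<^sup>2" if "i \<in> ?I" for i
          using that by (simp add: Df_def power2_eq_square algebra_simps)
        ultimately show ?thesis
          unfolding power2_norm_eq_inner inner_split_last power2_eq_square[of "_ * r ?y"]
          by (intro arg_cong2[of _ _ _ _ "(+)"] sum.cong refl) auto
      qed
      also have "(c $ last_idx / m * r ?y)\<^sup>2 \<le> \<alpha> * r ?y"
      proof -
        have "(r ?y)\<^sup>2 \<le> r ?y" using r[of ?y] by (simp add: power2_eq_square mult_left_le)
        then show ?thesis unfolding power_mult_distrib using \<alpha>(1) cl by (intro mult_mono) auto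
      qed
      also have "\<alpha> * r ?y \<le> (\<Sum>j\<in>{0<..<n}. \<theta> j ?y * A j)"
        unfolding r_sum sum_distrib_left using \<alpha>(2) \<theta>_nonneg
        by (intro sum_mono) (auto simp: mult.commute[of "\<theta> _ _"] intro!: mult_right_mono)
      also have "\<dots> = (\<Sum>j<n. \<theta> j ?y * A j)"
        using A0 by (intro sum.mono_neutral_left) auto
      also have "\<dots> \<le> real (n - 1) * (\<Sum>j<n. \<theta> j ?y * A j)"
      proof -
        have "0 \<le> (\<Sum>j<n. \<theta> j ?y * A j)"
          by (intro sum_nonneg mult_nonneg_nonneg \<theta>_nonneg A_nonneg) auto
        then show ?thesis using n mult_right_mono[of 1 "real (n - 1)"] by fastforce
      qed
      also have "\<dots> \<le> 2 * u1 ?y" using u1_ge[of ?y] by simp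
      also have "(\<Sum>i\<in>?I. (c $ i)\<^sup>2 * (1 - cos (x $ i))\<^sup>2) \<le> (\<Sum>i\<in>?I. b * (1 - cos (x $ i)))"
      proof (rule sum_mono)
        fix i
        have "(1 - cos (x $ i))\<^sup>2 \<le> 2 * (1 - cos (x $ i))"
          unfolding power2_eq_square using cos_ge_minus_one[of "x $ i"] by (intro mult_right_mono) auto
        then have "(c $ i)\<^sup>2 * (1 - cos (x $ i))\<^sup>2 \<le> (b / 2) * (2 * (1 - cos (x $ i)))"
          using b(1) by (intro mult_mono ci) auto
        also have "\<dots> = b * (1 - cos (x $ i))" by (simp only: mult.assoc[symmetric])
        finally show "(c $ i)\<^sup>2 * (1 - cos (x $ i))\<^sup>2 \<le> b * (1 - cos (x $ i))" .
      qed
      also have "\<dots> \<le> 2 * u2 ?y * (\<Sum>i\<in>?I. 1 - cos (x $ i))"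
      proof -
        have "b = (\<Sum>j<n. \<theta> j ?y) * b" by (simp add: \<theta>_sum)
        also have "\<dots> \<le> (\<Sum>j<n. \<theta> j ?y * B j)"
          unfolding sum_distrib_right by (intro sum_mono mult_left_mono b \<theta>_nonneg) auto
        finally have "b \<le> 2 * u2 ?y" by (simp add: u2_def)
        then show ?thesis
          unfolding sum_distrib_left[symmetric] by (intro mult_right_mono sum_nonneg) auto
      qed
      finally show ?thesis by (simp add: potential_def)
    qed
    show ?thesis
      by (rule subsolution_action_nonneg[OF adm f per(1), of "max M M'"])
         (use M sub in \<open>auto simp: le_max_iff_disj\<close>)
  qed
  then show thesis using that e by blast
qed

end

section \<open>Trigonometric partitions of unity and the choice of channels\<close>

lemma cos_diff_eq_1_imp_eq:
  fixes x y :: real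
  assumes "cos (z - x) = 1" "cos (z - y) = 1" "\<bar>x - y\<bar> < 2 * pi"
  shows "x = y"
proof -
  obtain k l :: int where k: "z - x = of_int k * (2 * pi)" and l: "z - y = of_int l * (2 * pi)"
    using assms(1,2) by (auto simp: cos_one_2pi_int mult_ac)
  have yx: "y - x = of_int (k - l) * (2 * pi)" using k l by (simp add: algebra_simps)
  have "\<bar>real_of_int (k - l)\<bar> * (2 * pi) = \<bar>y - x\<bar>" unfolding yx abs_mult by simp
  then have "\<bar>real_of_int (k - l)\<bar> * (2 * pi) < 1 * (2 * pi)"
    using assms(3) by (simp only: abs_minus_commute mult_1)
  then have "\<bar>real_of_int (k - l)\<bar> < 1"
    by (rule mult_right_less_imp_less) simp
  then have "\<bar>k - l\<bar> < 1" by (simp only: of_int_abs[symmetric] of_int_less_1_iff)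
  then show ?thesis using k l by simp
qed

text \<open>Each \<open>F j\<close> is a product of factors that vanish only at the other nodes
  modulo 2 \<pi>. A point meets at most one node modulo 2 \<pi>, so some \<open>F j\<close> is
  positive there and the family can be divided by its sum.\<close>

lemma trig_partition_of_unity:
  fixes a :: "nat \<Rightarrow> real"
  assumes n: "0 < n" and a: "inj_on a {..<n}" "\<And>j k. j < n \<Longrightarrow> k < n \<Longrightarrow> \<bar>a j - a k\<bar> < 2 * pi"
  obtains \<theta> :: "nat \<Rightarrow> real \<Rightarrow> real" where "\<And>j. trig_rational (\<theta> j)" "\<And>j y. 0 \<le> \<theta> j y"
    "\<And>y. (\<Sum>j<n. \<theta> j y) = 1" "\<And>j k. j < n \<Longrightarrow> k < n \<Longrightarrow> \<theta> j (a k) = (if j = k then 1 else 0)"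
proof -
  define F where "F j y = (\<Prod>k\<in>{..<n} - {j}. 1 - cos (y - a k))" for j y
  define S where "S y = (\<Sum>j<n. F j y)" for y
  have F_tr: "trig_rational (F j)" for j
  proof -
    have "trig_rational (\<lambda>y. 1 - cos (y + - a k))" for k
      by (intro trig_rational_diff trig_rational.const trig_rational.cos_shift)
    then show ?thesis unfolding F_def[abs_def] by (intro trig_rational_prod) simp
  qed
  have F_nonneg: "0 \<le> F j y" for j y unfolding F_def by (intro prod_nonneg) auto
  have F_pos: "0 < F j y" if "\<And>k. k < n \<Longrightarrow> k \<noteq> j \<Longrightarrow> cos (y - a k) \<noteq> 1" for j y
    unfolding F_def using that by (intro prod_pos) (auto simp: less_le)
  have S_pos: "0 < S y" for y
  proof -
    obtain j where j: "j < n" "\<And>k. k < n \<Longrightarrow> k \<noteq> j \<Longrightarrow> cos (y - a k) \<noteq> 1"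
    proof (cases "\<exists>j<n. cos (y - a j) = 1")
      case True
      then obtain j where j: "j < n" "cos (y - a j) = 1" by blast
      show thesis
      proof (rule that[OF j(1)])
        fix k assume k: "k < n" "k \<noteq> j"
        show "cos (y - a k) \<noteq> 1"
          using cos_diff_eq_1_imp_eq[OF j(2), of "a k"] a k j(1) by (auto simp: inj_on_def)
      qed
    qed (use n in auto)
    have "0 < F j y" by (rule F_pos[OF j(2)])
    also have "F j y \<le> S y"
      unfolding S_def using j(1) F_nonneg by (intro member_le_sum) auto
    finally show ?thesis .
  qed
  have S_tr: "trig_rational S" unfolding S_def[abs_def] by (intro trig_rational_sum F_tr)
  define \<theta> where "\<theta> j y = F j y * inverse (S y)" for j y
  have F_node: "F j (a k) = 0" if "j < n" "k < n" "j \<noteq> k" for j k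
    unfolding F_def using that by (intro prod_zero bexI[of _ k]) auto
  show thesis
  proof
    show "trig_rational (\<theta> j)" for j
      unfolding \<theta>_def[abs_def]
      by (intro trig_rational.mult trig_rational.inverse F_tr S_tr) (use S_pos in \<open>metis less_irrefl\<close>)
    show "0 \<le> \<theta> j y" for j y
      unfolding \<theta>_def using F_nonneg[of j y] S_pos[of y] by simp
    show "(\<Sum>j<n. \<theta> j y) = 1" for y
      unfolding \<theta>_def sum_distrib_right[symmetric] S_def[symmetric] using S_pos[of y] by simp
    show "\<theta> j (a k) = (if j = k then 1 else 0)" if "j < n" "k < n" for j k
    proof (cases "j = k")
      case True
      have "S (a k) = F k (a k) + (\<Sum>j\<in>{..<n} - {k}. F j (a k))"
        unfolding S_def by (rule sum.remove) (use that in auto)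
      also have "(\<Sum>j\<in>{..<n} - {k}. F j (a k)) = 0"
        by (rule sum.neutral) (use that F_node in auto)
      finally show ?thesis using S_pos[of "a k"] True by (simp add: \<theta>_def)
    qed (simp add: \<theta>_def F_node that)
  qed
qed

text \<open>Channel 0 is explicit: \<open>1 - cos x\<close> has mean 1 and its square is at most
  \<open>2 * (1 - cos x)\<close>. The others are pendulums whose parameters are fixed by their
  periods.\<close>

lemma channels_exist:
  assumes n: "2 \<le> n"
  obtains a A B T p w X \<theta> \<theta>' \<theta>'' W where "channels n a A B T p w X \<theta> \<theta>' \<theta>'' W"
proof -
  \<comment> \<open>The nodes with \<open>j < n\<close> lie in the unit interval, so no two of them
    are congruent modulo 2 \<pi>.\<close>
  define a where "a j = real j / real n" for j :: nat
  have "inj_on a {..<n}" using n by (auto simp: inj_on_def a_def)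
  moreover have "\<bar>a j - a k\<bar> < 2 * pi" if "j < n" "k < n" for j k
  proof -
    have "0 \<le> a j" "a j < 1" "0 \<le> a k" "a k < 1" using that by (simp_all add: a_def)
    then show ?thesis using pi_gt3 by linarith
  qed
  ultimately obtain \<theta> where \<theta>: "\<And>j. trig_rational (\<theta> j)" "\<And>j y. 0 \<le> \<theta> j y"
    "\<And>y. (\<Sum>j<n. \<theta> j y) = 1" "\<And>j k. j < n \<Longrightarrow> k < n \<Longrightarrow> \<theta> j (a k) = (if j = k then 1 else 0)"
    using trig_partition_of_unity[of n a] n by (metis gr0I not_numeral_le_zero)
  have "\<forall>j. \<exists>g. trig_rational g \<and> (\<forall>y. (\<theta> j has_real_derivative g y) (at y))"
    using trig_rational_deriv[OF \<theta>(1)] by metis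
  then obtain \<theta>' where \<theta>': "\<And>j. trig_rational (\<theta>' j)" "\<And>j y. (\<theta> j has_real_derivative \<theta>' j y) (at y)" by metis
  have "\<forall>j. \<exists>g. trig_rational g \<and> (\<forall>y. (\<theta>' j has_real_derivative g y) (at y))"
    using trig_rational_deriv[OF \<theta>'(1)] by metis
  then obtain \<theta>'' where \<theta>'': "\<And>j. trig_rational (\<theta>'' j)" "\<And>j y. (\<theta>' j has_real_derivative \<theta>'' j y) (at y)" by metis
  \<comment> \<open>Target periods, evenly spaced strictly between 2 \<pi> and
    \<open>pend_period 1\<close> for \<open>0 < j\<close> and \<open>j < n\<close>, hence pairwise
    different.\<close>
  define \<tau> where "\<tau> j = 2 * pi + real j / real n * (pend_period 1 - 2 * pi)" for j
  \<comment> \<open>The intermediate value theorem attains the target on the interval from 0 to 1;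
    since the target exceeds \<open>pend_period 0\<close>, the parameter is positive, as
    \<open>0 < B j\<close> demands.\<close>
  have "\<exists>s\<ge>0. 0 < j \<longrightarrow> j < n \<longrightarrow> 0 < s \<and> pend_period s = \<tau> j" for j
  proof (cases "0 < j \<and> j < n")
    case True
    then have f: "0 < real j / real n" "real j / real n < 1" by auto
    have "2 * pi < \<tau> j" unfolding \<tau>_def using mult_pos_pos[OF f(1), of "pend_period 1 - 2 * pi"] pend_period_1 by simp
    moreover have "\<tau> j \<le> pend_period 1"
      unfolding \<tau>_def using f pend_period_1 mult_right_mono[of "real j / real n" 1 "pend_period 1 - 2 * pi"] by simp
    ultimately obtain s where s: "0 \<le> s" "pend_period s = \<tau> j"
      using IVT'[of pend_period 0 "\<tau> j" 1] continuous_pend_period pend_period_0 by auto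
    moreover have "s \<noteq> 0" using s \<open>2 * pi < \<tau> j\<close> pend_period_0 by auto
    ultimately show ?thesis by (intro exI[of _ s]) auto
  qed auto
  then obtain s where s: "\<And>j. 0 \<le> s j" "\<And>j. 0 < j \<Longrightarrow> j < n \<Longrightarrow> 0 < s j"
    "\<And>j. 0 < j \<Longrightarrow> j < n \<Longrightarrow> pend_period (s j) = \<tau> j" by metis
  have "\<forall>j. \<exists>A B p w X. pendulum_channel (s j) A B p w X"
    using pendulum_channel_exists s(1) by blast
  from this[unfolded choice_iff] obtain A B p w X
    where "\<And>j. pendulum_channel (s j) (A j) (B j) (p j) (w j) (X j)" by blast
  then have ch: "\<And>j. 0 < A j" "\<And>j. B j = s j * A j"
      "\<And>j x. (p j x)\<^sup>2 = A j + B j * (1 - cos x)" "\<And>j x. p j (- x) = p j x"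
      "\<And>j. continuous_on UNIV (p j)" "\<And>j x. p j (x + 2 * pi) = p j x"
      "\<And>j x. (w j has_real_derivative p j x - 1) (at x)" "\<And>j x. w j (x + 2 * pi) = w j x"
      "\<And>j t. (X j has_real_derivative p j (X j t)) (at t)"
      "\<And>j t. ((\<lambda>t. p j (X j t)) has_real_derivative B j / 2 * sin (X j t)) (at t)"
      "\<And>j t. X j (t + pend_period (s j)) = X j t + 2 * pi" "\<And>j. 0 < pend_period (s j)"
    unfolding pendulum_channel_def by blast+
  \<comment> \<open>Channel 0 is overwritten by the explicit data \<open>A = 0\<close>,
    \<open>B = 2\<close>, \<open>p = 1 - cos x\<close> and \<open>w = - sin x\<close>.\<close>
  define A' where "A' j = (if j = 0 then 0 else A j)" for j
  define B' where "B' j = (if j = 0 then 2 else B j)" for j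
  define p' where "p' j x = (if j = 0 then 1 - cos x else p j x)" for j x
  define w' where "w' j x = (if j = 0 then - sin x else w j x)" for j x
  have w'_deriv: "(w' j has_real_derivative p' j x - 1) (at x)" for j x
  proof (cases "j = 0")
    case True
    have "((\<lambda>x. - sin x) has_real_derivative - cos x) (at x)" by (auto intro!: derivative_eq_intros)
    then show ?thesis using True by (simp add: w'_def[abs_def] p'_def)
  qed (simp add: w'_def[abs_def] p'_def ch)
  have w'_per: "w' j (x + 2 * pi) = w' j x" for j x by (simp add: w'_def ch)
  have "\<exists>M. \<forall>x. \<bar>w' j x\<bar> \<le> M" for j
  proof -
    have "continuous_on UNIV (w' j)"
      using w'_deriv by (meson DERIV_isCont continuous_at_imp_continuous_on)
    from periodic_bounded[OF this w'_per] show ?thesis by blast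
  qed
  then obtain M where M: "\<And>j x. \<bar>w' j x\<bar> \<le> M j" by metis
  define W where "W = (\<Sum>j<n. M j)"
  have "0 \<le> M j" for j using M[of j 0] by linarith
  then have W: "\<bar>w' j x\<bar> \<le> W" if "j < n" for j x
    using order_trans[OF M[of j x] member_le_sum[of j "{..<n}" M]] that by (simp add: W_def)
  have "channels n a A' B' (\<lambda>j. pend_period (s j)) p' w' X \<theta> \<theta>' \<theta>'' W"
  proof
    show "(p' j x)\<^sup>2 \<le> A' j + B' j * (1 - cos x)" for j x
    proof (cases "j = 0")
      case True
      have "(1 - cos x) * (1 - cos x) \<le> 2 * (1 - cos x)"
        using cos_ge_minus_one[of x] by (intro mult_right_mono) auto
      then show ?thesis using True by (simp add: p'_def A'_def B'_def power2_eq_square)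
    qed (simp add: p'_def A'_def B'_def ch)
    show "continuous_on UNIV (p' j)" for j
      by (cases "j = 0") (auto simp: p'_def[abs_def] ch(5) intro!: continuous_intros)
    show "inj_on (\<lambda>j. pend_period (s j)) {0<..<n}"
    proof (rule inj_onI)
      fix j k assume jk: "j \<in> {0<..<n}" "k \<in> {0<..<n}" "pend_period (s j) = pend_period (s k)"
      then have "\<tau> j = \<tau> k" by (simp add: s)
      then show "j = k" using jk n pend_period_1 by (simp add: \<tau>_def)
    qed
    show "(\<Sum>j<n. \<theta> j y) = 1" for y by (rule \<theta>)
    show "\<theta> j (a k) = (if j = k then 1 else 0)" if "j < n" "k < n" for j k by (rule \<theta>(4)[OF that])
    show "((\<lambda>t. p' j (X j t)) has_real_derivative B' j / 2 * sin (X j t)) (at t)" if "0 < j" for j t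
      using that ch(10)[of j t] by (simp add: p'_def B'_def)
    show "0 < B' j" if "j < n" for j
      using that s(2)[of j] ch(1)[of j] by (auto simp: B'_def ch(2))
  qed (use n ch w'_deriv w'_per W \<theta>(1,2) \<theta>' \<theta>'' in \<open>auto simp: A'_def B'_def p'_def a_def\<close>)
  then show thesis by (rule that)
qed

text \<open>Sign patterns away from the last index correspond to the subsets of
  \<open>UNIV - {last_idx}\<close>, and there are \<open>2 ^ (CARD('n) - 1)\<close> of
  those.\<close>

lemma exists_sign_vectors:
  obtains \<sigma> :: "nat \<Rightarrow> 'n::{finite,linorder} \<Rightarrow> int" where "\<And>k i. \<bar>\<sigma> k i\<bar> = 1"
    "\<And>k l. k < 2 ^ (CARD('n) - 1) \<Longrightarrow> l < 2 ^ (CARD('n) - 1) \<Longrightarrow>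
      (\<And>i. i \<noteq> last_idx \<Longrightarrow> \<sigma> k i = \<sigma> l i) \<Longrightarrow> k = l"
proof -
  let ?P = "Pow (UNIV - {last_idx :: 'n})"
  have "card ?P = 2 ^ (CARD('n) - 1)" by (simp add: card_Pow)
  then obtain S where S: "bij_betw S {..<(2::nat) ^ (CARD('n) - 1)} ?P"
    using ex_bij_betw_nat_finite[of ?P] by (auto simp: atLeast0LessThan)
  define \<sigma> where "\<sigma> k i = (if i \<in> S k then 1 else - 1 :: int)" for k i
  have "k = l" if kl: "k < 2 ^ (CARD('n) - 1)" "l < 2 ^ (CARD('n) - 1)"
    and eq: "\<And>i. i \<noteq> last_idx \<Longrightarrow> \<sigma> k i = \<sigma> l i" for k l
  proof -
    have "S k \<subseteq> UNIV - {last_idx}" "S l \<subseteq> UNIV - {last_idx}"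
      using bij_betwE[OF S] kl by auto
    moreover have "i \<in> S k \<longleftrightarrow> i \<in> S l" if "i \<noteq> last_idx" for i
      using eq[OF that] by (auto simp: \<sigma>_def split: if_splits)
    ultimately have "S k = S l" by blast
    then show ?thesis using S kl by (auto simp: bij_betw_def inj_on_def)
  qed
  moreover have "\<bar>\<sigma> k i\<bar> = 1" for k i by (simp add: \<sigma>_def)
  ultimately show thesis using that by blast
qed

section \<open>The flat, its boundary classes and the orbit measures\<close>

theorem theorem1:
  assumes "CARD('n::{finite,linorder}) \<ge> 2"
  shows "\<exists>(u1::real \<Rightarrow> real) (u2::real \<Rightarrow> real) (g::'n \<Rightarrow> (real, 'n) vec \<Rightarrow> real).
    smooth1 u1 \<and> smooth1 u2 \<and> periodic1 u1 \<and> periodic1 u2 \<and> diag_metric g \<and>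
    (\<exists>F. is_flat (alpha (mech_lag g u1 u2)) F \<and>
         (\<forall>c\<in>F. \<forall>c'. alpha (mech_lag g u1 u2) c \<le> alpha (mech_lag g u1 u2) c') \<and>
         interior F \<noteq> {} \<and>
         (\<exists>C :: nat \<Rightarrow> (real, 'n) vec. inj_on C {..<2 ^ (CARD('n) - 1)} \<and>
            (\<forall>k < 2 ^ (CARD('n) - 1). C k \<in> frontier F \<and>
               (\<exists>x0. (x0, 0) \<in> fund_dom \<and>
                  (\<forall>x. mech_lag g u1 u2 x0 0 \<le> mech_lag g u1 u2 x 0) \<and>
                  (\<forall>t. EL_flow (mech_lag g u1 u2) t (x0, 0) = (x0, 0)) \<and>
                  c_minimizing (mech_lag g u1 u2) (C k) (return borel (x0, 0))) \<and>
               (\<exists>\<mu> :: nat \<Rightarrow> (((real, 'n) vec) \<times> ((real, 'n) vec)) measure.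
                  (\<forall>j < CARD('n) - 1. ergodic (mech_lag g u1 u2) (\<mu> j) \<and>
                     c_minimizing (mech_lag g u1 u2) (C k) (\<mu> j) \<and>
                     rotation_vector (\<mu> j) \<noteq> 0) \<and>
                  inj_on (\<lambda>j. rotation_vector (\<mu> j)) {..< CARD('n) - 1}))))"
proof -
  define n where "n = CARD('n)"
  have n: "2 \<le> n" using assms by (simp add: n_def)
  obtain a A B T p w X \<theta> \<theta>' \<theta>'' W where "channels n a A B T p w X \<theta> \<theta>' \<theta>'' W"
    using channels_exist[OF n] by blast
  then interpret channels n a A B T p w X \<theta> \<theta>' \<theta>'' W .
  define L :: "(real, 'n) vec \<Rightarrow> (real, 'n) vec \<Rightarrow> real" where "L = mech_lag (\<lambda>i x. 1 / 2) u1 u2"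
  obtain K where mech: "mechanical (potential u1 u2 :: (real, 'n) vec \<Rightarrow> real) (force u2 u1' u2') K L"
    unfolding L_def
    using mechanical_potential[OF u_trig_rational u_deriv potential_nonneg u1_0] by blast
  interpret mechanical "potential u1 u2 :: (real, 'n) vec \<Rightarrow> real" "force u2 u1' u2'" K L
    by (rule mech)
  obtain \<sigma> :: "nat \<Rightarrow> 'n \<Rightarrow> int" where \<sigma>: "\<And>k i. \<bar>\<sigma> k i\<bar> = 1"
    and \<sigma>_inj: "\<And>k l. k < 2 ^ (CARD('n) - 1) \<Longrightarrow> l < 2 ^ (CARD('n) - 1) \<Longrightarrow>
      (\<And>i. i \<noteq> last_idx \<Longrightarrow> \<sigma> k i = \<sigma> l i) \<Longrightarrow> k = l"
    using exists_sign_vectors by blast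
  define C :: "nat \<Rightarrow> (real, 'n) vec" where "C k = cls (\<sigma> k)" for k
  define F where "F = {c. alpha L c = 0}"
  have card: "CARD('n) = n" by (simp add: n_def)
  have orbit: "closed_orbit (potential u1 u2) (force u2 u1' u2') K L (curve j (\<sigma> k)) (curve' j (\<sigma> k)) (T j) (winding (\<sigma> k))"
    if "0 < j" "j < n" for j k
    by (rule closed_orbit_curve[OF mech \<sigma> that])
  \<comment> \<open>Index \<open>j\<close> refers to channel \<open>Suc j\<close>, because channel 0
    is reserved for the fixed point.\<close>
  define \<mu> where "\<mu> k j = closed_orbit.orbit_measure (curve (Suc j) (\<sigma> k)) (curve' (Suc j) (\<sigma> k)) (T (Suc j))" for k j
  have \<mu>: "ergodic L (\<mu> k j)" "admissible L (\<mu> k j)" "action L (C k) (\<mu> k j) = 0"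
    "rotation_vector (\<mu> k j) = (1 / T (Suc j)) *\<^sub>R lattice_vec (winding (\<sigma> k))"
    "(\<integral>z. c \<bullet> snd z \<partial>\<mu> k j) = ((1 / T (Suc j)) *\<^sub>R lattice_vec (winding (\<sigma> k))) \<bullet> c"
    if "j < n - 1" for k j c
  proof -
    have j: "0 < Suc j" "Suc j < n" using that by auto
    interpret closed_orbit "potential u1 u2" "force u2 u1' u2'" K L "curve (Suc j) (\<sigma> k)" "curve' (Suc j) (\<sigma> k)" "T (Suc j)" "winding (\<sigma> k)"
      by (rule orbit[OF j])
    show "ergodic L (\<mu> k j)" unfolding \<mu>_def by (rule ergodic_orbit_measure)
    show "admissible L (\<mu> k j)" unfolding \<mu>_def by (rule admissible_orbit_measure)
    show "action L (C k) (\<mu> k j) = 0" unfolding \<mu>_def C_def by (rule action_curve[OF orbit[OF j] card \<sigma> j])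
    show "rotation_vector (\<mu> k j) = (1 / T (Suc j)) *\<^sub>R lattice_vec (winding (\<sigma> k))"
      unfolding \<mu>_def by (rule rotation_vector_orbit_measure)
    show "(\<integral>z. c \<bullet> snd z \<partial>\<mu> k j) = ((1 / T (Suc j)) *\<^sub>R lattice_vec (winding (\<sigma> k))) \<bullet> c"
      unfolding \<mu>_def by (rule integral_velocity)
  qed
  have T: "0 < T (Suc j)" if "j < n - 1" for j using T_pos[of "Suc j"] that by auto
  \<comment> \<open>Since \<open>n\<close> is at least 2 there is an index other than the last;
    there every \<open>C k\<close> has an entry 1 or -1 and so is nonzero.\<close>
  have "UNIV - {last_idx :: 'n} \<noteq> {}"
  proof
    assume "UNIV - {last_idx :: 'n} = {}"
    then have "CARD('n) - 1 = 0" by (metis card.empty card_Diff_singleton UNIV_I)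
    then show False using n card by simp
  qed
  then obtain i0 :: 'n where i0: "i0 \<noteq> last_idx" by blast
  have lv: "lattice_vec (winding (\<sigma> k)) = (2 * pi) *\<^sub>R C k" for k
    by (simp add: lattice_vec_def winding_def C_def cls_def vec_eq_iff)
  have C_nz: "C k \<noteq> 0" for k
    using \<sigma>[of k i0] i0 by (auto simp: C_def cls_def vec_eq_iff intro!: exI[of _ i0])
  have C_F: "C k \<in> F" for k
    unfolding F_def C_def using action_cls_nonneg[OF mech card \<sigma>] by (auto simp: alpha_eq_0_iff)
  have minimizing: "c_minimizing L (C k) (\<mu> k j)" if "j < n - 1" for k j
    unfolding c_minimizing_def using \<mu>(2,3)[OF that] C_F[of k] by (simp add: F_def)
  have C_frontier: "C k \<in> frontier F" for k
  proof -
    \<comment> \<open>The rotation vector of \<open>\<mu> k 0\<close> is a positive multiple of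
      \<open>C k\<close>. Moving the class outward along itself therefore lowers the action of this
      measure, which is 0 at \<open>C k\<close>, below 0, and leaves the lowest level.\<close>
    have "C k \<notin> interior F"
    proof
      assume "C k \<in> interior F"
      then obtain r where r: "0 < r" "ball (C k) r \<subseteq> F" by (auto simp: mem_interior)
      define d where "d = r / (2 * norm (C k))"
      have d: "0 < d" using r C_nz by (simp add: d_def)
      have "dist (C k) (C k + d *\<^sub>R C k) < r"
        using r(1) C_nz[of k] by (simp add: dist_norm d_def)
      then have "alpha L (C k + d *\<^sub>R C k) = 0" using r(2) by (auto simp: F_def)
      moreover have j: "0 < n - 1" using n by simp
      ultimately have "0 \<le> action L (C k + d *\<^sub>R C k) (\<mu> k 0)"
        using \<mu>(2)[OF j] by (simp add: alpha_eq_0_iff)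
      also have "\<dots> = action L (C k) (\<mu> k 0) - d * (\<integral>z. C k \<bullet> snd z \<partial>\<mu> k 0)"
        unfolding action_eq[OF \<mu>(2)[OF j]] \<mu>(5)[OF j] by (simp add: inner_add_right algebra_simps)
      also have "\<dots> = - (d * (2 * pi / T (Suc 0) * (C k \<bullet> C k)))"
        unfolding \<mu>(3)[OF j] \<mu>(5)[OF j] lv by simp
      also have "\<dots> < 0"
        using d T[OF j] C_nz[of k] by simp
      finally show False by simp
    qed
    then show ?thesis using C_F[of k] closure_subset[of F] by (auto simp: frontier_def)
  qed
  have interior: "interior F \<noteq> {}"
  proof -
    obtain e where e: "0 < e" "\<And>c \<mu>. norm c < e \<Longrightarrow> admissible L \<mu> \<Longrightarrow> 0 \<le> action L c \<mu>"
      using lowest_level_interior[OF mech card] by blast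
    then have "ball 0 e \<subseteq> F" by (auto simp: F_def alpha_eq_0_iff)
    then have "0 \<in> interior F" using e(1) by (auto simp: mem_interior)
    then show ?thesis by blast
  qed
  have C_inj: "inj_on C {..<2 ^ (CARD('n) - 1)}"
  proof (rule inj_onI)
    fix k l assume kl: "k \<in> {..<2 ^ (CARD('n) - 1)}" "l \<in> {..<2 ^ (CARD('n) - 1)}" "C k = C l"
    have "\<sigma> k i = \<sigma> l i" if "i \<noteq> last_idx" for i
    proof -
      have "C k $ i = C l $ i" using kl(3) by simp
      then show ?thesis using that by (simp add: C_def cls_def)
    qed
    then show "k = l" using \<sigma>_inj kl by auto
  qed
  have rotation_nz: "rotation_vector (\<mu> k j) \<noteq> 0" if "j < n - 1" for k j
    using \<mu>(4)[OF that] T[OF that] C_nz[of k] by (simp add: lv)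
  \<comment> \<open>All these vectors point along \<open>C k\<close>, so they are told apart by
    their lengths, that is by the periods.\<close>
  have rotation_inj: "inj_on (\<lambda>j. rotation_vector (\<mu> k j)) {..<n - 1}" for k
  proof (rule inj_onI)
    fix i j assume ij: "i \<in> {..<n - 1}" "j \<in> {..<n - 1}" "rotation_vector (\<mu> k i) = rotation_vector (\<mu> k j)"
    then have "(1 / T (Suc i)) *\<^sub>R ((2 * pi) *\<^sub>R C k) = (1 / T (Suc j)) *\<^sub>R ((2 * pi) *\<^sub>R C k)"
      by (simp only: \<mu>(4) lv lessThan_iff)
    then have "1 / T (Suc i) = 1 / T (Suc j)"
      using C_nz[of k] by (metis pi_neq_zero mult_eq_0_iff scaleR_cancel_right scaleR_eq_0_iff zero_neq_numeral)
    then have "T (Suc i) = T (Suc j)" by (metis inverse_eq_divide inverse_inverse_eq)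
    then have "Suc i = Suc j" by (rule inj_onD[OF T_inj]) (use ij in auto)
    then show "i = j" by simp
  qed
  have fixed_point: "(0, 0 :: (real, 'n) vec) \<in> fund_dom \<and> (\<forall>x. L 0 0 \<le> L x 0) \<and>
      (\<forall>t. EL_flow L t (0, 0) = (0, 0)) \<and> c_minimizing L (C k) (return borel (0, 0))" for k
    using EL_flow_fixed admissible_dirac action_dirac C_F[of k] U_nonneg U_0
    by (auto simp: fund_dom_def L c_minimizing_def F_def)
  have flat: "is_flat (alpha L) F" "\<forall>c\<in>F. \<forall>c'. alpha L c \<le> alpha L c'"
    using is_flat_lowest_level interior alpha_nonneg by (auto simp: F_def)
  have measures: "\<exists>\<mu>. (\<forall>j < CARD('n) - 1. ergodic L (\<mu> j) \<and> c_minimizing L (C k) (\<mu> j) \<and> rotation_vector (\<mu> j) \<noteq> 0) \<and>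
      inj_on (\<lambda>j. rotation_vector (\<mu> j)) {..< CARD('n) - 1}" for k
    unfolding card
    by (intro exI[of _ "\<mu> k"] conjI allI impI \<mu>(1) minimizing rotation_nz rotation_inj)
  have "\<forall>k < 2 ^ (CARD('n) - 1). C k \<in> frontier F \<and>
      (\<exists>x0. (x0, 0) \<in> fund_dom \<and> (\<forall>x. L x0 0 \<le> L x 0) \<and> (\<forall>t. EL_flow L t (x0, 0) = (x0, 0)) \<and>
        c_minimizing L (C k) (return borel (x0, 0))) \<and>
      (\<exists>\<mu>. (\<forall>j < CARD('n) - 1. ergodic L (\<mu> j) \<and> c_minimizing L (C k) (\<mu> j) \<and> rotation_vector (\<mu> j) \<noteq> 0) \<and>
        inj_on (\<lambda>j. rotation_vector (\<mu> j)) {..< CARD('n) - 1})"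
    by (intro allI impI conjI C_frontier measures exI[of _ 0] fixed_point)
  then have "\<exists>F. is_flat (alpha L) F \<and> (\<forall>c\<in>F. \<forall>c'. alpha L c \<le> alpha L c') \<and> interior F \<noteq> {} \<and>
    (\<exists>C :: nat \<Rightarrow> (real, 'n) vec. inj_on C {..<2 ^ (CARD('n) - 1)} \<and>
      (\<forall>k < 2 ^ (CARD('n) - 1). C k \<in> frontier F \<and>
        (\<exists>x0. (x0, 0) \<in> fund_dom \<and> (\<forall>x. L x0 0 \<le> L x 0) \<and> (\<forall>t. EL_flow L t (x0, 0) = (x0, 0)) \<and>
          c_minimizing L (C k) (return borel (x0, 0))) \<and>
        (\<exists>\<mu>. (\<forall>j < CARD('n) - 1. ergodic L (\<mu> j) \<and> c_minimizing L (C k) (\<mu> j) \<and> rotation_vector (\<mu> j) \<noteq> 0) \<and>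
          inj_on (\<lambda>j. rotation_vector (\<mu> j)) {..< CARD('n) - 1})))"
    using flat interior C_inj by blast
  moreover have "diag_metric (\<lambda>(i :: 'n) (x :: (real, 'n) vec). 1 / 2)" by (rule diag_metric_const) simp
  ultimately show ?thesis
    using u_trig_rational(1,2) trig_rational_smooth1 trig_rational_periodic1 unfolding L_def by blast
qed

end
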